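(* Let $K$ be a field with $\operatorname{char}K=2$, let $q=2^m$ with $m\ge 1$, and let $G=SL_2(\mathbb{F}_q)$. Then $\operatorname{ed}_K(G)=1$ if and only if $K\supseteq\mathbb{F}_q$.
   Context: Essential dimension: for a finite group $G$ and a field $K$, choose a faithful finite-dimensional representation $G\to GL(V)$ over $K$ and let $K(V)$ be the field of rational functions on $V$ with the induced $G$-action. A faithful $G$-subfield is a subfield $E$ with $K\subseteq E\subseteq K(V)$, stable under $G$, on which $G$ acts faithfully. Then $\operatorname{ed}_K(G)$ is the minimum of $\operatorname{trdeg}_K E$ over all faithful $G$-subfields $E$; it is independent of $V$. *)

theory Defs
  imports "HOL-Analysis.Analysis"
begin

definition is_subfield :: "'l::field set \<Rightarrow> bool" where
  "is_subfield E \<longleftrightarrow> 0 \<in> E \<and> 1 \<in> E \<and>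
     (\<forall>a\<in>E. \<forall>b\<in>E. a + b \<in> E \<and> a * b \<in> E) \<and>
     (\<forall>a\<in>E. - a \<in> E \<and> inverse a \<in> E)"

definition is_ring_hom :: "('a::field \<Rightarrow> 'b::field) \<Rightarrow> bool" where
  "is_ring_hom f \<longleftrightarrow> f 1 = 1 \<and> (\<forall>a b. f (a + b) = f a + f b) \<and> (\<forall>a b. f (a * b) = f a * f b)"

text \<open>The family y 0, ..., y (d-1) is algebraically independent over the subfield F:
  no nontrivial polynomial with coefficients in F vanishes at it. A polynomial is a finite
  set P of monomials (exponent vectors supported in {..<d}) with coefficients c.\<close>
definition alg_indep :: "'l::field set \<Rightarrow> (nat \<Rightarrow> 'l) \<Rightarrow> nat \<Rightarrow> bool" where
  "alg_indep F y d \<longleftrightarrow>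
     (\<forall>(P :: (nat \<Rightarrow> nat) set) c. finite P \<and> (\<forall>\<alpha>\<in>P. \<forall>i. d \<le> i \<longrightarrow> \<alpha> i = 0) \<and>
        (\<forall>\<alpha>\<in>P. c \<alpha> \<in> F) \<and> (\<Sum>\<alpha>\<in>P. c \<alpha> * (\<Prod>i<d. y i ^ \<alpha> i)) = 0
        \<longrightarrow> (\<forall>\<alpha>\<in>P. c \<alpha> = 0))"

definition trdeg :: "'l::field set \<Rightarrow> 'l set \<Rightarrow> nat" where
  "trdeg F E = (GREATEST d. \<exists>y. (\<forall>i<d. y i \<in> E) \<and> alg_indep F y d)"

definition SL2 :: "('f::field ^ 2 ^ 2) set" where
  "SL2 = {A. det A = 1}"

text \<open>A model of the field K(V) of rational functions on a faithful n-dimensional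
  representation V of the matrix group G over K:
  iota embeds K into the field 'l; x 0..x (n-1) (the coordinate functions, a basis of V^*)
  are algebraically independent over K and generate 'l as a field over K;
  sigma is an action of G on 'l by field automorphisms fixing K, acting K-linearly on
  the span of the coordinates (i.e. induced from a linear representation), and the
  linear action is faithful.\<close>
definition rat_fun_field_rep ::
  "('k::field \<Rightarrow> 'l::field) \<Rightarrow> (nat \<Rightarrow> 'l) \<Rightarrow> nat \<Rightarrow> ('g::semiring_1 ^ 'm ^ 'm) set
     \<Rightarrow> ('g ^ 'm ^ 'm \<Rightarrow> 'l \<Rightarrow> 'l) \<Rightarrow> bool" where
  "rat_fun_field_rep iota x n G \<sigma> \<longleftrightarrow>
     is_ring_hom iota \<and>
     alg_indep (range iota) x n \<and>
     (\<forall>E. is_subfield E \<and> range iota \<subseteq> E \<and> x ` {..<n} \<subseteq> E \<longrightarrow> E = UNIV) \<and>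
     \<sigma> (mat 1) = id \<and>
     (\<forall>g\<in>G. \<forall>h\<in>G. \<sigma> (g ** h) = \<sigma> g \<circ> \<sigma> h) \<and>
     (\<forall>g\<in>G. is_ring_hom (\<sigma> g) \<and> (\<forall>a. \<sigma> g (iota a) = iota a)) \<and>
     (\<forall>g\<in>G. \<forall>j<n. \<exists>c. \<sigma> g (x j) = (\<Sum>i<n. iota (c i) * x i)) \<and>
     (\<forall>g\<in>G. (\<forall>j<n. \<sigma> g (x j) = x j) \<longrightarrow> g = mat 1)"

definition faithful_G_subfield ::
  "('k::field \<Rightarrow> 'l::field) \<Rightarrow> ('g::semiring_1 ^ 'm ^ 'm) set \<Rightarrow> ('g ^ 'm ^ 'm \<Rightarrow> 'l \<Rightarrow> 'l)
     \<Rightarrow> 'l set \<Rightarrow> bool" where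
  "faithful_G_subfield iota G \<sigma> E \<longleftrightarrow>
     is_subfield E \<and> range iota \<subseteq> E \<and> (\<forall>g\<in>G. \<sigma> g ` E \<subseteq> E) \<and>
     (\<forall>g\<in>G. (\<forall>e\<in>E. \<sigma> g e = e) \<longrightarrow> g = mat 1)"

definition ess_dim ::
  "('k::field \<Rightarrow> 'l::field) \<Rightarrow> ('g::semiring_1 ^ 'm ^ 'm) set \<Rightarrow> ('g ^ 'm ^ 'm \<Rightarrow> 'l \<Rightarrow> 'l) \<Rightarrow> nat" where
  "ess_dim iota G \<sigma> = (LEAST d. \<exists>E. faithful_G_subfield iota G \<sigma> E \<and> trdeg (range iota) E = d)"

end

theory Submission
  imports Defs "HOL-Computational_Algebra.Polynomial_Factorial"
begin

text \<open>
  Suppose that \<open>F\<^sub>q\<close> embeds into \<open>K\<close>. By independence of characters some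
  \<open>w = (\<Sum>g. g\<^sub>1\<^sub>1 g(f), \<Sum>g. g\<^sub>2\<^sub>1 g(f))\<close> is nonzero; the group acts on its span through the
  standard representation, hence on \<open>t = w\<^sub>1 / w\<^sub>2\<close> by fractional linear transformations, and \<open>K(t)\<close>
  is a faithful subfield because \<open>SL\<^sub>2(F\<^sub>q)\<close> has trivial center in characteristic two.

  Conversely, let \<open>E\<close> be a faithful subfield of transcendence degree one, which may be replaced by
  one generated by finitely many orbits. A Kronecker substitution \<open>x\<^sub>i \<mapsto> s^(N^i)\<close> with large \<open>N\<close>
  embeds it into \<open>K(s)\<close>, so \<open>E = K(t)\<close> by Lueroth's theorem and the group acts through \<open>PGL\<^sub>2(K)\<close>.
  The diagonal matrices normalize, but do not centralize, the unipotent upper triangular ones, which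
  forces the latter to be \<open>1 + \<beta>(b) N\<close> up to scalars with a nilpotent matrix \<open>N\<close> over \<open>K\<close>; then
  \<open>c \<mapsto> \<beta>(c) / \<beta>(1)\<close> is a ring homomorphism \<open>F\<^sub>q \<rightarrow> K\<close>.
\<close>

text \<open>The substitution is not defined on the whole field of rational functions: a fraction
  survives only if its denominator does, and distinct elements may collapse. On a subfield of
  transcendence degree one it is injective all the same, because an element sent to zero would turn
  its algebraic relation with a nonconstant \<open>y\<close> into an algebraic equation for the
  image of \<open>y\<close>. One choice of weights can separate only finitely many monomials, whence
  the passage to a finitely generated field. The field K need not be perfect, so an element of order
  two of PGL_2(K) need not have an eigenvalue in K: its square is a scalar that may fail to be a
  square. This is the obstacle to finding \<open>N\<close> over K. The torus removes it, but only
  through an element of F_q other than 0 and 1; for q = 2 the inclusion of F_q in K is clear and is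
  treated apart. Matrices are known only up to scalars. In characteristic two a scalar is determined
  by its square, so comparing determinants removes much of that ambiguity.\<close>

section \<open>A copy of a field with the gcd structure of the library\<close>

text \<open>Greatest common divisors and the Gauss lemma are available for polynomials over types of class
  \<open>field_gcd\<close>, to which an arbitrary field type does not belong; a copy of the type can be made an
  instance.\<close>

typedef (overloaded) 'a gfield = "UNIV :: 'a::field set"
  morphisms of_gfield to_gfield by simp

setup_lifting type_definition_gfield

instantiation gfield :: (field) field
begin
lift_definition zero_gfield :: "'a gfield" is 0 .
lift_definition one_gfield :: "'a gfield" is 1 .
lift_definition plus_gfield :: "'a gfield \<Rightarrow> 'a gfield \<Rightarrow> 'a gfield" is "(+)" .
lift_definition minus_gfield :: "'a gfield \<Rightarrow> 'a gfield \<Rightarrow> 'a gfield" is "(-)" .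
lift_definition uminus_gfield :: "'a gfield \<Rightarrow> 'a gfield" is uminus .
lift_definition times_gfield :: "'a gfield \<Rightarrow> 'a gfield \<Rightarrow> 'a gfield" is "(*)" .
lift_definition divide_gfield :: "'a gfield \<Rightarrow> 'a gfield \<Rightarrow> 'a gfield" is "(/)" .
lift_definition inverse_gfield :: "'a gfield \<Rightarrow> 'a gfield" is inverse .
instance
  by standard (transfer; simp add: algebra_simps field_class.field_divide_inverse)+
end

instantiation gfield :: (field)
  "{unique_euclidean_ring, normalization_euclidean_semiring, normalization_semidom_multiplicative}"
begin
definition normalize_gfield :: "'a gfield \<Rightarrow> 'a gfield"
  where [simp]: "normalize_gfield x = (if x = 0 then 0 else 1)"
definition unit_factor_gfield :: "'a gfield \<Rightarrow> 'a gfield"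
  where [simp]: "unit_factor_gfield x = x"
definition euclidean_size_gfield :: "'a gfield \<Rightarrow> nat"
  where [simp]: "euclidean_size_gfield x = (if x = 0 then 0 else 1)"
definition modulo_gfield :: "'a gfield \<Rightarrow> 'a gfield \<Rightarrow> 'a gfield"
  where [simp]: "modulo_gfield x y = (if y = 0 then x else 0)"
definition division_segment_gfield :: "'a gfield \<Rightarrow> 'a gfield"
  where [simp]: "division_segment_gfield x = 1"
instance
  by standard (simp_all add: dvd_field_iff field_split_simps split: if_splits)
end

instantiation gfield :: (field) euclidean_ring_gcd
begin
definition gcd_gfield :: "'a gfield \<Rightarrow> 'a gfield \<Rightarrow> 'a gfield"
  where "gcd_gfield = Euclidean_Algorithm.gcd"
definition lcm_gfield :: "'a gfield \<Rightarrow> 'a gfield \<Rightarrow> 'a gfield"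
  where "lcm_gfield = Euclidean_Algorithm.lcm"
definition Gcd_gfield :: "'a gfield set \<Rightarrow> 'a gfield"
  where "Gcd_gfield = Euclidean_Algorithm.Gcd"
definition Lcm_gfield :: "'a gfield set \<Rightarrow> 'a gfield"
  where "Lcm_gfield = Euclidean_Algorithm.Lcm"
instance
  by standard (simp_all add: gcd_gfield_def lcm_gfield_def Gcd_gfield_def Lcm_gfield_def)
end

instance gfield :: (field) field_gcd ..

section \<open>Ring homomorphisms, subfields and evaluation of polynomials\<close>

locale ring_homo =
  fixes h :: "'a::comm_ring_1 \<Rightarrow> 'b::comm_ring_1"
  assumes hom_1 [simp]: "h 1 = 1"
    and hom_add: "h (a + b) = h a + h b"
    and hom_mult: "h (a * b) = h a * h b"
begin

lemma hom_0 [simp]: "h 0 = 0"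
  using hom_add[of 0 0] by simp

lemma hom_uminus: "h (- a) = - h a"
  using hom_add[of a "- a"] by (simp add: eq_neg_iff_add_eq_0 add.commute)

lemma hom_diff: "h (a - b) = h a - h b"
  using hom_add[of a "- b"] by (simp add: hom_uminus)

lemma hom_power: "h (a ^ k) = h a ^ k"
  by (induction k) (simp_all add: hom_mult)

lemma hom_sum: "h (sum f A) = (\<Sum>i\<in>A. h (f i))"
  by (induction A rule: infinite_finite_induct) (simp_all add: hom_add)

definition ev :: "'a poly \<Rightarrow> 'b \<Rightarrow> 'b" where
  "ev p z = poly (map_poly h p) z"

lemma ring_homo_map_poly: "ring_homo (map_poly h)"
proof
  show "map_poly h 1 = 1"
    by (simp add: map_poly_1')
  show "map_poly h (p + q) = map_poly h p + map_poly h q" for p q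
    by (rule poly_eqI) (simp add: coeff_map_poly hom_add)
  show "map_poly h (p * q) = map_poly h p * map_poly h q" for p q
    by (rule poly_eqI) (simp add: coeff_map_poly coeff_mult hom_mult hom_sum)
qed

lemma ring_homo_ev: "ring_homo (\<lambda>p. ev p z)"
  using ring_homo_map_poly by (auto simp: ring_homo_def ev_def)

lemmas ev_1 [simp] = ring_homo.hom_1[OF ring_homo_ev]
lemmas ev_0 [simp] = ring_homo.hom_0[OF ring_homo_ev]
lemmas ev_add = ring_homo.hom_add[OF ring_homo_ev]
lemmas ev_mult = ring_homo.hom_mult[OF ring_homo_ev]
lemmas ev_diff = ring_homo.hom_diff[OF ring_homo_ev]
lemmas ev_uminus = ring_homo.hom_uminus[OF ring_homo_ev]
lemmas ev_power = ring_homo.hom_power[OF ring_homo_ev]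
lemmas ev_sum = ring_homo.hom_sum[OF ring_homo_ev]

lemma ev_pCons [simp]: "ev (pCons a p) z = h a + z * ev p z"
  by (cases "p = 0 \<and> a = 0") (auto simp: ev_def map_poly_pCons)

lemma ev_monom: "ev (monom a k) z = h a * z ^ k"
  by (simp add: ev_def map_poly_monom poly_monom)

lemma ev_altdef: "degree p \<le> d \<Longrightarrow> ev p z = (\<Sum>i\<le>d. h (coeff p i) * z ^ i)"
  by (subst poly_as_sum_of_monoms'[symmetric, of p d]) (simp_all add: ev_sum ev_monom)

end

text \<open>If \<open>g\<close> fixes the constants, then \<open>\<lambda>a. g (h a)\<close> is
  \<open>h\<close> again; this is how automorphisms are moved through rational expressions in
  \<open>t\<close>.\<close>

lemma ev_comp:
  assumes "ring_homo h" "ring_homo g"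
  shows "g (ring_homo.ev h p z) = ring_homo.ev (\<lambda>a. g (h a)) p (g z)"
proof -
  interpret h: ring_homo h by fact
  interpret g: ring_homo g by fact
  interpret gh: ring_homo "\<lambda>a. g (h a)"
    by unfold_locales (simp_all add: h.hom_add g.hom_add h.hom_mult g.hom_mult)
  show ?thesis
    by (induction p) (simp_all add: g.hom_add g.hom_mult)
qed

lemma ring_homo_to_fract: "ring_homo to_fract"
  by unfold_locales simp_all

locale field_homo = ring_homo h for h :: "'a::field \<Rightarrow> 'b::field"
begin

lemma hom_eq_0_iff [simp]: "h a = 0 \<longleftrightarrow> a = 0"
proof
  show "a = 0" if "h a = 0"
  proof (rule ccontr)
    assume "a \<noteq> 0"
    then have "h 1 = h a * h (inverse a)" by (simp flip: hom_mult)
    with that show False by simp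
  qed
qed simp

lemma hom_eq_iff [simp]: "h a = h b \<longleftrightarrow> a = b"
  using hom_eq_0_iff[of "a - b"] by (simp add: hom_diff)

lemma hom_inverse: "h (inverse a) = inverse (h a)"
proof (cases "a = 0")
  case False
  then have "h a * h (inverse a) = 1" by (simp flip: hom_mult)
  then show ?thesis by (simp add: inverse_unique)
qed simp

lemma hom_divide: "h (a / b) = h a / h b"
  by (simp add: divide_inverse hom_mult hom_inverse)

end

lemma is_ring_hom_iff_field_homo: "is_ring_hom h \<longleftrightarrow> field_homo h"
  by (auto simp: is_ring_hom_def ring_homo_def field_homo_def)

locale subfield =
  fixes E :: "'l::field set"
  assumes is_subfield: "is_subfield E"
begin

lemma zero_mem [simp]: "0 \<in> E" and one_mem [simp]: "1 \<in> E"
  and add_mem: "a \<in> E \<Longrightarrow> b \<in> E \<Longrightarrow> a + b \<in> E"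
  and mult_mem: "a \<in> E \<Longrightarrow> b \<in> E \<Longrightarrow> a * b \<in> E"
  and uminus_mem: "a \<in> E \<Longrightarrow> - a \<in> E"
  and inverse_mem: "a \<in> E \<Longrightarrow> inverse a \<in> E"
  using is_subfield by (auto simp: is_subfield_def)

lemma diff_mem: "a \<in> E \<Longrightarrow> b \<in> E \<Longrightarrow> a - b \<in> E"
  using add_mem[of a "- b"] uminus_mem by simp

lemma divide_mem: "a \<in> E \<Longrightarrow> b \<in> E \<Longrightarrow> a / b \<in> E"
  using mult_mem[of a "inverse b"] inverse_mem by (simp add: divide_inverse)

lemma power_mem: "a \<in> E \<Longrightarrow> a ^ k \<in> E"
  by (induction k) (auto intro: mult_mem)

lemma sum_mem: "(\<And>i. i \<in> A \<Longrightarrow> f i \<in> E) \<Longrightarrow> sum f A \<in> E"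
  by (induction A rule: infinite_finite_induct) (auto intro: add_mem)

text \<open>A subfield is a set and not a type, so the ring E[Z] is carved out of the polynomials
  over \<open>'l\<close>.\<close>

definition polys :: "'l poly set" where
  "polys = {p. \<forall>i. coeff p i \<in> E}"

lemma polys_add: "p \<in> polys \<Longrightarrow> q \<in> polys \<Longrightarrow> p + q \<in> polys"
  and polys_diff: "p \<in> polys \<Longrightarrow> q \<in> polys \<Longrightarrow> p - q \<in> polys"
  and polys_mult: "p \<in> polys \<Longrightarrow> q \<in> polys \<Longrightarrow> p * q \<in> polys"
  and polys_smult: "a \<in> E \<Longrightarrow> q \<in> polys \<Longrightarrow> smult a q \<in> polys"
  and polys_monom: "a \<in> E \<Longrightarrow> monom a k \<in> polys"
  and polys_0: "0 \<in> polys"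
  by (auto simp: polys_def coeff_mult intro: add_mem diff_mem mult_mem sum_mem)

text \<open>Long division is carried out explicitly because quotient and remainder have to stay over
  \<open>E\<close>; each round cancels the leading term of \<open>g\<close> and recurs on the
  degree.\<close>

lemma polys_division:
  assumes "f \<in> polys" "f \<noteq> 0" "g \<in> polys"
  obtains q r where "q \<in> polys" "r \<in> polys" "g = q * f + r" "r = 0 \<or> degree r < degree f"
  using assms(3)
proof (induction "degree g" arbitrary: g thesis rule: less_induct)
  case less
  show ?case
  proof (cases "g = 0 \<or> degree g < degree f")
    case True
    then show ?thesis using less.prems(1)[of 0 g] less.prems(2) polys_0 by auto
  next
    case False
    define c where "c = monom (lead_coeff g / lead_coeff f) (degree g - degree f)"
    have cp: "c \<in> polys"
      unfolding c_def using assms(1) less.prems(2)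
      by (intro polys_monom divide_mem) (auto simp: polys_def)
    define g' where "g' = g - c * f"
    have g'p: "g' \<in> polys"
      unfolding g'_def using cp assms(1) less.prems(2) by (intro polys_diff polys_mult)
    have c0: "lead_coeff g / lead_coeff f \<noteq> 0" using False assms(2) by auto
    have dc: "degree (c * f) = degree g"
      using False assms(2) c0 by (simp add: c_def degree_mult_eq degree_monom_eq monom_eq_0_iff)
    have lc: "coeff (c * f) (degree g) = lead_coeff g"
      using False assms(2) unfolding c_def by (simp add: coeff_monom_mult)
    show ?thesis
    \<comment> \<open>In degree zero cancelling the leading term cannot lower the degree; the
      difference is zero outright.\<close>
    proof (cases "degree g = 0")
      case True
      then have "degree f = 0" using False by simp
      then have "g' = 0"
        using True lc dc unfolding g'_def
        by (metis (no_types) coeff_diff degree_diff_le diff_self le_zero_eq leading_coeff_0_iff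
            order_refl)
      then show ?thesis using less.prems(1)[of c 0] cp polys_0 by (simp add: g'_def)
    next
      case 2: False
      have "degree g' \<le> degree g" unfolding g'_def by (intro degree_diff_le) (simp_all add: dc)
      moreover have "coeff g' (degree g) = 0" by (simp add: g'_def lc)
      ultimately have "degree g' < degree g"
        using 2 by (metis leading_coeff_0_iff le_neq_implies_less degree_0)
      then obtain q r where qr: "q \<in> polys" "r \<in> polys" "g' = q * f + r"
        "r = 0 \<or> degree r < degree f"
        using less.hyps[of g'] g'p by blast
      show ?thesis
        by (rule less.prems(1)[of "q + c" r])
           (use qr cp in \<open>auto intro: polys_add simp: g'_def algebra_simps\<close>)
    qed
  qed
qed

lemma poly_mem: "p \<in> polys \<Longrightarrow> z \<in> E \<Longrightarrow> poly p z \<in> E"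
  unfolding poly_altdef polys_def by (auto intro!: sum_mem mult_mem power_mem)

end

text \<open>Serves both for K(t) in Lueroth's theorem and for the quotients of the ring generated by
  the \<open>x i\<close>.\<close>

lemma subfield_quotients:
  fixes R :: "'l::field set"
  assumes "1 \<in> R" "\<And>a b. a \<in> R \<Longrightarrow> b \<in> R \<Longrightarrow> a + b \<in> R"
    and "\<And>a b. a \<in> R \<Longrightarrow> b \<in> R \<Longrightarrow> a * b \<in> R" "\<And>a. a \<in> R \<Longrightarrow> - a \<in> R"
  shows "is_subfield {a / b | a b. a \<in> R \<and> b \<in> R \<and> b \<noteq> 0}" (is "is_subfield ?Q")
proof -
  have R0: "0 \<in> R" using assms(2)[OF assms(1) assms(4)[OF assms(1)]] by simp
  have sum: "x + y \<in> ?Q" and prod: "x * y \<in> ?Q" if "x \<in> ?Q" "y \<in> ?Q" for x y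
  proof -
    obtain a b c d where ab: "x = a / b" "a \<in> R" "b \<in> R" "b \<noteq> 0"
      and cd: "y = c / d" "c \<in> R" "d \<in> R" "d \<noteq> 0" using \<open>x \<in> ?Q\<close> \<open>y \<in> ?Q\<close> by auto
    have "x + y = (a * d + c * b) / (b * d)" using ab cd by (simp add: add_frac_eq)
    moreover have "a * d + c * b \<in> R" "b * d \<in> R" "b * d \<noteq> 0" using ab cd assms by auto
    ultimately show "x + y \<in> ?Q" by blast
    have "x * y = (a * c) / (b * d)" using ab cd by simp
    moreover have "a * c \<in> R" using ab cd assms by auto
    ultimately show "x * y \<in> ?Q" using \<open>b * d \<in> R\<close> \<open>b * d \<noteq> 0\<close> by blast
  qed
  have mem: "a / b \<in> ?Q" if "a \<in> R" "b \<in> R" "b \<noteq> 0" for a b using that by blast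
  have neg: "- x \<in> ?Q" if x: "x \<in> ?Q" for x
  proof -
    obtain a b where "x = a / b" "a \<in> R" "b \<in> R" "b \<noteq> 0" using x by auto
    then show ?thesis using mem[of "- a" b] assms(4) by simp
  qed
  have inv: "inverse x \<in> ?Q" if x: "x \<in> ?Q" for x
  proof -
    obtain a b where "x = a / b" "a \<in> R" "b \<in> R" "b \<noteq> 0" using x by auto
    then show ?thesis using mem[of b a] mem[of 0 1] assms(1) R0 by (cases "a = 0") auto
  qed
  show ?thesis
    unfolding is_subfield_def using sum prod neg inv mem[of 0 1] mem[of 1 1] R0 assms(1) by auto
qed

section \<open>Lueroth's theorem\<close>

lemma ring_homo_const_poly: "ring_homo (\<lambda>a::'a::comm_ring_1. [:a:])"
  by unfold_locales (simp_all add: one_pCons)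

text \<open>In k[s][Z] the coefficients are polynomials in s. Exchanging the variables makes the
  degree in s accessible as \<open>degree\<close>.\<close>

definition swap_vars :: "'a::comm_ring_1 poly poly \<Rightarrow> 'a poly poly" where
  "swap_vars p = ring_homo.ev (map_poly (\<lambda>a. [:a:])) p [:[:0, 1:]:]"

lemma ring_homo_swap_vars: "ring_homo swap_vars"
  unfolding swap_vars_def by (intro ring_homo.ring_homo_ev ring_homo.ring_homo_map_poly ring_homo_const_poly)

lemma coeff_swap_vars: "coeff (coeff (swap_vars p) i) j = coeff (coeff p j) i"
proof (induction p arbitrary: i j)
  case 0
  then show ?case by (simp add: ring_homo.hom_0[OF ring_homo_swap_vars])
next
  case (pCons c p)
  have "swap_vars (pCons c p) = map_poly (\<lambda>a. [:a:]) c + [:[:0, 1:]:] * swap_vars p"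
    by (simp only: swap_vars_def ring_homo.ev_pCons[OF ring_homo.ring_homo_map_poly[OF ring_homo_const_poly]])
  then have "coeff (swap_vars (pCons c p)) i = [:coeff c i:] + pCons 0 (coeff (swap_vars p) i)"
    by (simp add: coeff_map_poly)
  then show ?case by (cases j) (simp_all add: pCons.IH)
qed

definition const_fract :: "'a::field \<Rightarrow> 'a poly fract" where
  "const_fract a = to_fract [:a:]"

interpretation const_fract: field_homo const_fract
  by unfold_locales (simp_all add: const_fract_def flip: one_pCons to_fract_add to_fract_mult)

lemma ev_const_fract_X: "const_fract.ev p (to_fract [:0, 1:]) = to_fract p"
proof (induction p)
  case (pCons a p)
  then show ?case by (simp add: const_fract_def[of a] flip: to_fract_add to_fract_mult)
qed simp

lemma fract_coprime_cases:
  fixes e :: "'a::field_gcd poly fract"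
  obtains a b where "e = to_fract a / to_fract b" "coprime a b" "b \<noteq> 0"
proof
  show "e = to_fract (fst (quot_of_fract e)) / to_fract (snd (quot_of_fract e))"
    by (simp flip: Fract_conv_to_fract)
qed (simp_all add: coprime_quot_of_fract)

text \<open>Let \<open>f\<close> be the minimal polynomial of s over \<open>E\<close>. Some
  coefficient t = a(s)/b(s) of it is not constant, and s is a root of a(Z) - t b(Z), of degree k =
  max (deg a) (deg b). So \<open>f\<close> divides that polynomial, and the point is that the
  degrees agree. Cleared of denominators it becomes H(s, Z) = b(s) a(Z) - a(s) b(Z), which is
  antisymmetric and hence of degree k in s as well, while the primitive form of \<open>f\<close>
  already has degree at least k in s. The cofactor is therefore free of s, and then
  constant.\<close>

theorem luroth:
  fixes E :: "'a::field_gcd poly fract set"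
  assumes E: "is_subfield E" and kE: "range const_fract \<subseteq> E" and e0: "e0 \<in> E" "e0 \<notin> range const_fract"
  obtains t where "t \<in> E" "t \<notin> range const_fract"
    "\<And>e. e \<in> E \<Longrightarrow> \<exists>a b. const_fract.ev b t \<noteq> 0 \<and> e = const_fract.ev a t / const_fract.ev b t"
proof -
  interpret E: subfield E by unfold_locales fact
  define s :: "'a poly fract" where "s = to_fract [:0, 1:]"
  define Phi where "Phi a b e = map_poly const_fract a - smult e (map_poly const_fract b)" for a b and e :: "'a poly fract"
  have coeff_Phi: "coeff (Phi a b e) i = const_fract (coeff a i) - e * const_fract (coeff b i)" for a b e i
    by (simp add: Phi_def coeff_map_poly)
  have coeff_Phi_0: "coeff a i = 0 \<and> coeff b i = 0"
    if "e \<notin> range const_fract" "coeff (Phi a b e) i = 0" for a b e i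
  proof -
    have "coeff b i = 0"
    proof (rule ccontr)
      assume "coeff b i \<noteq> 0"
      then have "e = const_fract (coeff a i / coeff b i)"
        using that(2) by (simp add: coeff_Phi const_fract.hom_divide field_simps)
      then show False using that(1) by blast
    qed
    then show ?thesis using that(2) by (simp add: coeff_Phi)
  qed
  have degree_Phi: "degree (Phi a b e) = max (degree a) (degree b)" "Phi a b e \<noteq> 0"
    if "e \<notin> range const_fract" "b \<noteq> 0" for a b e
  proof -
    have nz: "coeff (Phi a b e) (max (degree a) (degree b)) \<noteq> 0"
    proof
      assume "coeff (Phi a b e) (max (degree a) (degree b)) = 0"
      from coeff_Phi_0[OF that(1) this] have "a = 0 \<or> b = 0"
        by (auto simp: max_def split: if_splits)
      with that(2) have "a = 0" by simp
      then show False using coeff_Phi_0[OF that(1), of a b "degree b"] that(2)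
        \<open>coeff (Phi a b e) (max (degree a) (degree b)) = 0\<close> by simp
    qed
    then show "Phi a b e \<noteq> 0" by auto
    show "degree (Phi a b e) = max (degree a) (degree b)"
      by (intro antisym le_degree nz degree_le) (simp add: coeff_Phi coeff_eq_0)
  qed
  have s: "poly (map_poly const_fract p) s = to_fract p" for p :: "'a poly"
    using ev_const_fract_X[of p] by (simp add: const_fract.ev_def s_def)
  have root_Phi: "poly (Phi a b e) s = 0" if "e = to_fract a / to_fract b" "b \<noteq> 0" for a b e
    using that by (simp add: Phi_def s)
  have Phi_mem: "Phi a b e \<in> subfield.polys E'" if "is_subfield E'" "range const_fract \<subseteq> E'" "e \<in> E'" for a b e E'
  proof -
    interpret E': subfield E' by unfold_locales fact
    show ?thesis using that(2,3)
      by (auto simp: E'.polys_def coeff_Phi intro!: E'.diff_mem E'.mult_mem)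
  qed

  \<comment> \<open>Minimal degree among the nonzero elements of E[Z] that vanish at s, followed by
    normalization, yields the minimal polynomial \<open>f\<close>. The candidate built from
    \<open>e0\<close> shows that s is algebraic over \<open>E\<close>.\<close>
  define A where "A g \<longleftrightarrow> g \<in> E.polys \<and> g \<noteq> 0 \<and> poly g s = 0" for g
  obtain a0 b0 where ab0: "e0 = to_fract a0 / to_fract b0" "b0 \<noteq> 0"
    using fract_coprime_cases by metis
  have "A (Phi a0 b0 e0)"
    using Phi_mem[OF E kE e0(1)] degree_Phi(2)[OF e0(2) ab0(2)] root_Phi[OF ab0] by (simp add: A_def)
  then obtain f0 where f0: "A f0" "\<And>g. A g \<Longrightarrow> degree f0 \<le> degree g"
    using ex_has_least_nat[of A _ degree] by blast
  define f where "f = smult (inverse (lead_coeff f0)) f0"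
  have f: "f \<in> E.polys" "f \<noteq> 0" "poly f s = 0" "lead_coeff f = 1"
    using f0(1) by (auto simp: A_def f_def intro!: E.polys_smult E.inverse_mem) (simp add: E.polys_def)
  have fmin: "degree f \<le> degree g" if "g \<in> E.polys" "g \<noteq> 0" "poly g s = 0" for g
    using f0(2)[of g] that by (simp add: A_def f_def)
  have fdvd: "f dvd g" if g: "g \<in> E.polys" "poly g s = 0" for g
  proof -
    obtain q r where qr: "q \<in> E.polys" "r \<in> E.polys" "g = q * f + r" "r = 0 \<or> degree r < degree f"
      using E.polys_division[OF f(1,2) g(1)] .
    have "poly r s = 0" using g(2) f(3) qr(3) by simp
    then have "r = 0" using fmin[OF qr(2)] qr(4) by fastforce
    then show ?thesis using qr(3) by simp
  qed

  \<comment> \<open>If all coefficients were constant, s would be algebraic over K.\<close>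
  have "\<exists>i. coeff f i \<notin> range const_fract"
  proof (rule ccontr)
    assume "\<nexists>i. coeff f i \<notin> range const_fract"
    then have "\<forall>i. \<exists>x. coeff f i = const_fract x" by blast
    from choice[OF this] obtain c where c: "\<And>i. coeff f i = const_fract (c i)" by blast
    define p where "p = (\<Sum>i\<le>degree f. monom (c i) i)"
    have "const_fract.ev p s = (\<Sum>i\<le>degree f. coeff f i * s ^ i)"
      by (simp add: p_def const_fract.ev_sum const_fract.ev_monom c)
    also have "\<dots> = poly f s" by (simp add: poly_altdef)
    finally have "to_fract p = 0" using f(3) by (simp add: s_def ev_const_fract_X)
    then have "p = 0" by simp
    then have "coeff p (degree f) = 0" by simp
    then have "c (degree f) = 0" by (simp add: p_def coeff_sum)
    then show False using c[of "degree f"] f(2) by simp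
  qed
  then obtain i where i: "coeff f i \<notin> range const_fract" by blast
  define t where "t = coeff f i"
  have tE: "t \<in> E" using f(1) by (simp add: t_def E.polys_def)
  have tk: "t \<notin> range const_fract" using i by (simp add: t_def)
  have t0: "t \<noteq> 0" using tk const_fract.hom_0 by (metis rangeI)
  obtain a b where ab: "t = to_fract a / to_fract b" "coprime a b" "b \<noteq> 0"
    using fract_coprime_cases .
  have a0: "a \<noteq> 0" using t0 ab(1) by auto
  define k where "k = max (degree a) (degree b)"
  have dPhi: "degree (Phi a b t) = k" "Phi a b t \<noteq> 0"
    using degree_Phi[OF tk ab(3)] by (simp_all add: k_def)

  \<comment> \<open>\<open>F\<close> is primitive in k[s][Z], so by the Gauss lemma divisibility
    over the quotient field descends to k[s][Z].\<close>
  obtain c F where F: "f = smult c (fract_poly F)" "Polynomial.content F = 1"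
    using content_decompose_fract .
  have c0: "c \<noteq> 0" using f(2) F(1) by auto
  have F0: "F \<noteq> 0" using f(2) F(1) by auto
  have cF: "coeff f j = c * to_fract (coeff F j)" for j by (simp add: F(1) coeff_map_poly)
  have dF: "degree F = degree f"
    using F(1) c0 by (simp add: degree_map_poly)
  \<comment> \<open>As \<open>f\<close> is monic, t is the ratio of two coefficients of
    \<open>F\<close>. The fraction a/b being reduced, a divides the one and b the other, so
    \<open>F\<close> has degree at least k in s.\<close>
  have "to_fract (coeff F i) = t * to_fract (lead_coeff F)"
    using cF[of i] cF[of "degree f"] f(4) c0 by (simp add: t_def dF field_simps)
  then have "to_fract (coeff F i * b) = to_fract (a * lead_coeff F)"
    using ab(3) by (simp add: ab(1))
  then have FF: "coeff F i * b = a * lead_coeff F" by (simp only: to_fract_eq_iff)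
  have "a dvd coeff F i" using FF ab(2) by (metis coprime_dvd_mult_left_iff dvd_triv_left)
  moreover have "coeff F i \<noteq> 0" using t0 cF[of i] by (auto simp: t_def)
  ultimately have "degree a \<le> degree (coeff F i)" by (rule dvd_imp_degree_le)
  have "b dvd lead_coeff F"
    using FF ab(2) by (metis coprime_commute coprime_dvd_mult_right_iff dvd_triv_right)
  then have "degree b \<le> degree (lead_coeff F)" by (rule dvd_imp_degree_le) (simp add: F0)
  have degree_swap_vars: "degree (coeff F j) \<le> degree (swap_vars F)" for j
  proof (cases "coeff F j = 0")
    case False
    then have "coeff (coeff (swap_vars F) (degree (coeff F j))) j \<noteq> 0" by (simp add: coeff_swap_vars)
    then show ?thesis by (intro le_degree) auto
  qed simp
  have kswap: "k \<le> degree (swap_vars F)"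
    using \<open>degree a \<le> _\<close> \<open>degree b \<le> _\<close> degree_swap_vars[of i] degree_swap_vars[of "degree F"]
    unfolding k_def by linarith

  define H where "H = smult b (map_poly (\<lambda>x. [:x:]) a) - smult a (map_poly (\<lambda>x. [:x:]) b)"
  have cH: "coeff H j = smult (coeff a j) b - smult (coeff b j) a" for j
    by (simp add: H_def coeff_map_poly mult.commute)
  have fH: "fract_poly H = smult (to_fract b) (Phi a b t)"
  proof (rule poly_eqI)
    fix j
    have *: "to_fract (smult c p) = const_fract c * to_fract p" for c and p :: "'a poly"
      by (simp add: const_fract_def flip: to_fract_mult)
    have "to_fract b * t = to_fract a" using ab(1,3) by simp
    then show "coeff (fract_poly H) j = coeff (smult (to_fract b) (Phi a b t)) j"
      by (simp add: coeff_map_poly cH coeff_Phi * right_diff_distrib mult.left_commute[of _ t])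
         (simp add: mult.commute mult.left_commute)
  qed
  have H0: "H \<noteq> 0" using fH dPhi(2) ab(3) by (metis fract_poly_eq_0_iff smult_eq_0_iff to_fract_eq_0_iff)
  have dH: "degree H = k"
  proof -
    have "degree (fract_poly H) = degree H" by (simp add: degree_map_poly)
    then show ?thesis using fH dPhi(1) ab(3) by simp
  qed
  have swapH: "swap_vars H = - H"
    by (intro poly_eqI) (simp add: coeff_swap_vars cH mult.commute)
  have "f dvd Phi a b t" by (rule fdvd[OF Phi_mem[OF E kE tE] root_Phi[OF ab(1,3)]])
  then have "f dvd fract_poly H" unfolding fH by (rule dvd_smult)
  then have "fract_poly F dvd fract_poly H" using F(1) c0 smult_dvd_iff by metis
  then have "F dvd H" using F(2) by (rule fract_poly_dvdD)
  then obtain q where q: "H = F * q" by (rule dvdE)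
  have q0: "q \<noteq> 0" using q H0 by auto
  \<comment> \<open>Comparison of the degrees in s: \<open>F\<close> already accounts for all of k,
    so the cofactor \<open>q\<close> is a polynomial \<open>r\<close> in Z alone.\<close>
  have "swap_vars H = swap_vars F * swap_vars q" using q ring_homo.hom_mult[OF ring_homo_swap_vars] by simp
  then have sw: "swap_vars F * swap_vars q = - H" using swapH by simp
  then have "swap_vars F \<noteq> 0" "swap_vars q \<noteq> 0" using H0 by auto
  then have "k = degree (swap_vars F) + degree (swap_vars q)"
    using dH sw by (metis degree_minus degree_mult_eq)
  then have "degree (swap_vars q) = 0" using kswap by simp
  then obtain r where r: "swap_vars q = [:r:]" by (rule degree_eq_zeroE)
  \<comment> \<open>By antisymmetry \<open>r\<close>, read as a polynomial in s, divides each
    coefficient of \<open>H\<close> with respect to Z. These coefficients are combinations of a and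
    b over K; two independent ones, which exist because t is not constant, show that
    \<open>r\<close> divides both a and b.\<close>
  have rH: "r dvd coeff H j" for j
  proof -
    have "coeff H j = - coeff (swap_vars F * swap_vars q) j" using sw by simp
    then show ?thesis using r by simp
  qed
  have "\<exists>i j. coeff a i * coeff b j \<noteq> coeff a j * coeff b i"
  proof (rule ccontr)
    assume *: "\<not> ?thesis"
    define x where "x = coeff a (degree b) / lead_coeff b"
    have "a = smult x b"
    proof (rule poly_eqI)
      fix j
      have "coeff a j * lead_coeff b = coeff a (degree b) * coeff b j" using * by metis
      then show "coeff a j = coeff (smult x b) j" using ab(3) by (simp add: x_def field_simps)
    qed
    then have "to_fract a = const_fract x * to_fract b" by (simp add: const_fract_def flip: to_fract_mult)
    then have "t = const_fract x" using ab(1,3) by simp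
    then show False using tk by blast
  qed
  then obtain i1 j1 where ij: "coeff a i1 * coeff b j1 - coeff a j1 * coeff b i1 \<noteq> 0" by auto
  define D where "D = coeff a i1 * coeff b j1 - coeff a j1 * coeff b i1"
  have "smult (coeff b j1) (coeff H i1) - smult (coeff b i1) (coeff H j1) = smult D b"
    by (simp add: cH D_def smult_diff_right smult_diff_left algebra_simps)
  then have "r dvd smult D b" using rH by (metis dvd_diff dvd_smult)
  then have rb: "r dvd b" using ij by (simp add: D_def dvd_smult_iff)
  have "smult (coeff a j1) (coeff H i1) - smult (coeff a i1) (coeff H j1) = smult D a"
    by (simp add: cH D_def smult_diff_right smult_diff_left algebra_simps)
  then have "r dvd smult D a" using rH by (metis dvd_diff dvd_smult)
  then have "r dvd a" using ij by (simp add: D_def dvd_smult_iff)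
  with rb ab(2) have "is_unit r" by (meson coprime_common_divisor)
  then have dr: "degree r = 0" by (auto simp: is_unit_poly_iff)
  have "degree q = 0"
  proof -
    have "coeff q j = 0" if "j > 0" for j
    proof (rule poly_eqI)
      fix l
      have "coeff (coeff q j) l = coeff (coeff [:r:] l) j"
        unfolding r[symmetric] coeff_swap_vars ..
      also have "\<dots> = 0" using that dr by (cases l) (simp_all add: coeff_eq_0)
      finally show "coeff (coeff q j) l = coeff 0 l" by simp
    qed
    then show ?thesis by (metis bot_nat_0.not_eq_extremum leading_coeff_0_iff q0)
  qed
  then have km: "k = degree f" using q q0 F0 dH dF by (simp add: degree_mult_eq)

  define Et where "Et = {const_fract.ev a t / const_fract.ev b t | a b. const_fract.ev b t \<noteq> 0}"
  have "Et = {x / y | x y. x \<in> range (\<lambda>p. const_fract.ev p t) \<and> y \<in> range (\<lambda>p. const_fract.ev p t) \<and> y \<noteq> 0}"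
    by (auto simp: Et_def)
  also have "is_subfield \<dots>"
    by (rule subfield_quotients)
       (auto simp: image_iff simp flip: const_fract.ev_add const_fract.ev_mult const_fract.ev_uminus intro: exI[of _ 1])
  finally have Et: "is_subfield Et" .
  then interpret Et: subfield Et by unfold_locales
  have kEt: "range const_fract \<subseteq> Et"
  proof safe
    fix x :: 'a
    have "const_fract x = const_fract.ev [:x:] t / const_fract.ev 1 t" by (subst const_fract.ev_pCons) simp
    then show "const_fract x \<in> Et" unfolding Et_def by fastforce
  qed
  have "t = const_fract.ev [:0, 1:] t / const_fract.ev 1 t" by (simp)
  then have tEt: "t \<in> Et" unfolding Et_def by fastforce
  have EtE: "Et \<subseteq> E"
  proof -
    have "const_fract.ev p t \<in> E" for p unfolding const_fract.ev_def
      using kE by (intro E.poly_mem tE) (auto simp: E.polys_def coeff_map_poly)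
    then show ?thesis by (auto simp: Et_def intro: E.divide_mem)
  qed
  have pE: "p \<in> Et.polys \<Longrightarrow> p \<in> E.polys" for p using EtE by (auto simp: Et.polys_def E.polys_def)
  have kp: "map_poly const_fract p \<in> Et.polys" for p using kEt by (auto simp: Et.polys_def coeff_map_poly)
  show ?thesis
  proof
    fix e assume e: "e \<in> E"
    \<comment> \<open>Numerator and denominator of e are reduced modulo a(Z) - t b(Z) over K(t), to
      degrees below k = deg f. Then e R1 - P1 lies in E[Z], vanishes at s and has degree less than
      that of \<open>f\<close>, so it is zero, and one of its coefficients expresses e in
      K(t).\<close>
    obtain P R where PR: "e = to_fract P / to_fract R" "R \<noteq> 0" using fract_coprime_cases by metis
    note PhiEt = Phi_mem[OF Et kEt tEt, of a b]
    obtain q1 P1 where P1: "P1 \<in> Et.polys" "map_poly const_fract P = q1 * Phi a b t + P1"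
      "P1 = 0 \<or> degree P1 < degree (Phi a b t)"
      using Et.polys_division[OF PhiEt dPhi(2) kp] .
    obtain q2 R1 where R1: "R1 \<in> Et.polys" "map_poly const_fract R = q2 * Phi a b t + R1"
      "R1 = 0 \<or> degree R1 < degree (Phi a b t)"
      using Et.polys_division[OF PhiEt dPhi(2) kp] .
    have P1s: "poly P1 s = to_fract P" and R1s: "poly R1 s = to_fract R"
      using s[of P] s[of R] root_Phi[OF ab(1,3)] unfolding P1(2) R1(2) by simp_all
    have R10: "R1 \<noteq> 0" using R1s PR(2) by auto
    then have dR: "degree R1 < k" using R1(3) dPhi(1) by simp
    define g where "g = smult e R1 - P1"
    have gE: "g \<in> E.polys" unfolding g_def using e P1(1) R1(1) by (intro E.polys_diff E.polys_smult pE)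
    have gs: "poly g s = 0" by (simp add: g_def P1s R1s PR)
    have "degree g < k" unfolding g_def
      using dR P1(3) dPhi(1) by (intro degree_diff_less le_less_trans[OF degree_smult_le]) auto
    then have "g = 0" using fmin[OF gE _ gs] km by fastforce
    then have "e * coeff R1 (degree R1) = coeff P1 (degree R1)" unfolding g_def
      by (metis coeff_diff coeff_smult right_minus_eq coeff_0)
    then have "e = coeff P1 (degree R1) / lead_coeff R1" using R10 by (simp add: field_simps)
    also have "\<dots> \<in> Et" using P1(1) R1(1) by (intro Et.divide_mem) (auto simp: Et.polys_def)
    finally show "\<exists>a b. const_fract.ev b t \<noteq> 0 \<and> e = const_fract.ev a t / const_fract.ev b t" by (auto simp: Et_def)
  qed (fact tE tk)+
qed

section \<open>Automorphisms of a simple transcendental extension\<close>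

text \<open>The rational root theorem for C/D with denominators cleared: modulo D only the top term
  survives, modulo C only the bottom one, and coprimality strips off the powers.\<close>

lemma homogeneous_rational_root:
  fixes C D :: "'b::{idom, semiring_gcd}" and M :: "nat \<Rightarrow> 'b"
  assumes "(\<Sum>i\<le>d. M i * C ^ i * D ^ (d - i)) = 0" "coprime C D"
  shows "D dvd M d" "C dvd M 0"
proof -
  have "(\<Sum>i\<le>d. M i * C ^ i * D ^ (d - i)) = M d * C ^ d + (\<Sum>i<d. M i * C ^ i * D ^ (d - i))"
    by (simp add: lessThan_Suc_atMost[symmetric])
  moreover have "D dvd (\<Sum>i<d. M i * C ^ i * D ^ (d - i))"
    by (intro dvd_sum dvd_mult) (auto intro: dvd_power)
  ultimately have "D dvd M d * C ^ d" using assms(1) by (metis dvd_0_right dvd_add_left_iff)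
  then show "D dvd M d"
    using assms(2) by (simp add: coprime_dvd_mult_left_iff coprime_commute)
  define R where "R = (\<Sum>i\<in>{..d} - {0}. M i * C ^ i * D ^ (d - i))"
  have "(\<Sum>i\<le>d. M i * C ^ i * D ^ (d - i)) = M 0 * D ^ d + R"
    unfolding R_def by (subst sum.remove[of _ 0]) auto
  moreover have "C dvd R"
    unfolding R_def by (intro dvd_sum dvd_mult2 dvd_mult) (auto intro: dvd_power)
  ultimately have "C dvd M 0 * D ^ d" using assms(1) dvd_add_left_iff[of C R "M 0 * D ^ d"] by simp
  then show "C dvd M 0"
    using assms(2) by (simp add: coprime_dvd_mult_left_iff)
qed

locale transcendental = field_homo h for h :: "'k::field_gcd \<Rightarrow> 'l::field" +
  fixes t :: 'l
  assumes transcendental: "ev p t = 0 \<Longrightarrow> p = 0"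
begin

definition simple_ext :: "'l set" where
  "simple_ext = {ev a t / ev b t | a b. ev b t \<noteq> 0}"

lemma ev_eq_0_iff [simp]: "ev p t = 0 \<longleftrightarrow> p = 0"
  using transcendental by auto

lemma not_const: "t \<noteq> h x"
proof
  assume "t = h x"
  then have "ev [:- x, 1:] t = 0" by (simp add: hom_uminus)
  then have "[:- x, 1:] = 0" by (simp only: ev_eq_0_iff)
  then show False by simp
qed

lemma simple_ext_coprime:
  assumes "e \<in> simple_ext"
  obtains a b where "e = ev a t / ev b t" "b \<noteq> 0" "coprime a b"
proof -
  obtain a b where ab: "e = ev a t / ev b t" "b \<noteq> 0" using assms by (auto simp: simple_ext_def)
  then have "gcd a b \<noteq> 0" by simp
  from gcd_coprime_exists[OF this] obtain a' b'
    where *: "a = a' * gcd a b" "b = b' * gcd a b" "coprime a' b'" by blast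
  have "ev (gcd a b) t \<noteq> 0" using \<open>gcd a b \<noteq> 0\<close> by simp
  then have "ev a t / ev b t = ev a' t / ev b' t"
    by (subst *(1), subst *(2)) (simp add: ev_mult)
  moreover have "b' \<noteq> 0" using *(2) ab(2) by (metis mult_zero_left)
  ultimately show ?thesis using that[of a' b'] ab(1) *(3) by simp
qed

text \<open>If \<open>t' = a(t)/b(t)\<close> is the preimage of \<open>t\<close>, then \<open>\<sigma> t\<close> is a root of the polynomial
  \<open>a(Z) - t b(Z)\<close>, whose coefficients have degree at most one in \<open>t\<close>.\<close>
lemma automorphism_fractional_linear:
  assumes "field_homo \<sigma>" "\<And>a. \<sigma> (h a) = h a" "t' \<in> simple_ext" "\<sigma> t' = t" "\<sigma> t \<in> simple_ext"
  obtains \<alpha> \<beta> \<gamma> \<delta> where "\<sigma> t = (h \<alpha> * t + h \<beta>) / (h \<gamma> * t + h \<delta>)" "\<alpha> * \<delta> - \<beta> * \<gamma> \<noteq> 0"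
proof -
  interpret s: field_homo \<sigma> by fact
  have rh: "ring_homo h" ..
  obtain a b where ab: "t' = ev a t / ev b t" "b \<noteq> 0" "coprime a b"
    using simple_ext_coprime[OF assms(3)] .
  obtain C D where CD: "\<sigma> t = ev C t / ev D t" "D \<noteq> 0" "coprime C D"
    using simple_ext_coprime[OF assms(5)] .
  have sev: "\<sigma> (ev p t) = ev p (\<sigma> t)" for p
    using ev_comp[OF rh s.ring_homo_axioms, of p t] by (simp add: assms(2))
  have "ev b (\<sigma> t) \<noteq> 0" using sev[of b] ab(2) by (metis ev_eq_0_iff s.hom_eq_0_iff)
  then have eq: "ev a (\<sigma> t) = t * ev b (\<sigma> t)"
    using assms(4) unfolding ab(1) s.hom_divide sev by (simp add: field_simps)
  define d where "d = max (degree a) (degree b)"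
  define L where "L i = [:coeff a i, - coeff b i:]" for i
  have D0: "ev D t \<noteq> 0" using CD(2) by simp
  have pw: "ev D t ^ d * \<sigma> t ^ i = ev C t ^ i * ev D t ^ (d - i)" if "i \<le> d" for i
  proof -
    have "ev D t ^ d = ev D t ^ i * ev D t ^ (d - i)" using that by (simp flip: power_add)
    then show ?thesis using D0 by (simp add: CD(1) power_divide)
  qed
  have evL: "ev (L i) t = h (coeff a i) - t * h (coeff b i)" for i
    by (simp add: L_def hom_uminus)
  have "ev (\<Sum>i\<le>d. L i * C ^ i * D ^ (d - i)) t =
      (\<Sum>i\<le>d. (h (coeff a i) - t * h (coeff b i)) * (ev C t ^ i * ev D t ^ (d - i)))"
    by (simp add: ev_sum ev_mult ev_power evL mult.assoc)
  also have "\<dots> = (\<Sum>i\<le>d. ev D t ^ d * (h (coeff a i) * \<sigma> t ^ i - t * (h (coeff b i) * \<sigma> t ^ i)))"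
    by (intro sum.cong refl) (simp add: pw[symmetric] algebra_simps)
  also have "\<dots> = ev D t ^ d * (ev a (\<sigma> t) - t * ev b (\<sigma> t))"
    by (simp add: ev_altdef[of a d] ev_altdef[of b d] d_def sum_distrib_left sum_subtractf
        right_diff_distrib)
  finally have S0: "(\<Sum>i\<le>d. L i * C ^ i * D ^ (d - i)) = 0" using eq by simp
  \<comment> \<open>Divisors of a nonzero polynomial of degree at most one have degree at most one.
    The top coefficient is nonzero by the choice of \<open>d\<close>, the bottom one because the
    coprime a and b do not both vanish at 0.\<close>
  have "L d \<noteq> 0"
  proof
    assume "L d = 0"
    then have "coeff a d = 0" "coeff b d = 0" by (simp_all add: L_def)
    then have "a = 0 \<or> b = 0" by (auto simp: d_def max_def split: if_splits)
    with ab(2) have "a = 0" by simp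
    then show False using \<open>coeff b d = 0\<close> ab(2) by (simp add: d_def)
  qed
  moreover have "D dvd L d" by (rule homogeneous_rational_root[OF S0 CD(3)])
  ultimately have "degree D \<le> degree (L d)" by (metis dvd_imp_degree_le)
  then have dD: "degree D \<le> 1" by (simp add: L_def split: if_splits)
  have "L 0 \<noteq> 0"
  proof
    assume "L 0 = 0"
    then have "coeff a 0 = 0" "coeff b 0 = 0" by (simp_all add: L_def)
    then have "[:0, 1:] dvd a" "[:0, 1:] dvd b" 
      using poly_eq_0_iff_dvd[of a 0] poly_eq_0_iff_dvd[of b 0] by (simp_all add: poly_0_coeff_0)
    with ab(3) have "is_unit [:0, 1::'k:]" by (meson coprime_common_divisor)
    then show False by (simp add: is_unit_poly_iff)
  qed
  moreover have "C dvd L 0" by (rule homogeneous_rational_root[OF S0 CD(3)])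
  ultimately have "degree C \<le> degree (L 0)" by (metis dvd_imp_degree_le)
  then have dC: "degree C \<le> 1" by (simp add: L_def split: if_splits)
  have lin: "\<exists>x y. p = [:x, y:]" if "degree p \<le> 1" for p :: "'k poly"
  proof -
    obtain y r where "p = pCons y r" by (cases p)
    moreover from this that have "degree r = 0" by (auto split: if_splits)
    then obtain x where "r = [:x:]" by (rule degree_eq_zeroE)
    ultimately show ?thesis by auto
  qed
  obtain \<alpha> \<beta> where C: "C = [:\<beta>, \<alpha>:]" using lin[OF dC] by auto
  obtain \<gamma> \<delta> where D: "D = [:\<delta>, \<gamma>:]" using lin[OF dD] by auto
  have z: "\<sigma> t = (h \<alpha> * t + h \<beta>) / (h \<gamma> * t + h \<delta>)"
    using CD(1) by (simp add: C D algebra_simps)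
  have den: "h \<gamma> * t + h \<delta> \<noteq> 0" using D0 by (simp add: D algebra_simps)
  have "\<alpha> * \<delta> - \<beta> * \<gamma> \<noteq> 0"
  proof
    assume det: "\<alpha> * \<delta> - \<beta> * \<gamma> = 0"
    \<comment> \<open>With proportional rows \<sigma> t would be a constant h x = \<sigma> (h x),
      and injectivity of \<sigma> would make t itself constant.\<close>
    have "\<exists>x. \<alpha> = x * \<gamma> \<and> \<beta> = x * \<delta>"
    proof (cases "\<gamma> = 0")
      case True
      then have "\<delta> \<noteq> 0" using CD(2) D by simp
      then show ?thesis using det True by (intro exI[of _ "\<beta> / \<delta>"]) simp
    next
      case False
      then show ?thesis using det by (intro exI[of _ "\<alpha> / \<gamma>"]) (simp add: field_simps)
    qed
    then obtain x where "\<alpha> = x * \<gamma>" "\<beta> = x * \<delta>" by blast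
    then have "h \<alpha> * t + h \<beta> = h x * (h \<gamma> * t + h \<delta>)" by (simp add: hom_mult algebra_simps)
    then have "\<sigma> t = \<sigma> (h x)" using z den assms(2) by simp
    then show False using not_const by simp
  qed
  with z show ?thesis using that by blast
qed

lemma linear_nonzero:
  assumes "\<gamma> \<noteq> 0 \<or> \<delta> \<noteq> 0"
  shows "h \<gamma> * t + h \<delta> \<noteq> 0"
proof
  assume "h \<gamma> * t + h \<delta> = 0"
  then have "ev [:\<delta>, \<gamma>:] t = 0" by (simp add: algebra_simps)
  then have "[:\<delta>, \<gamma>:] = 0" by (simp only: ev_eq_0_iff)
  with assms show False by simp
qed

lemma quadratic_zero:
  assumes "h a * t ^ 2 + h b * t + h c = 0"
  shows "a = 0 \<and> b = 0 \<and> c = 0"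
proof -
  have "ev [:c, b, a:] t = 0" using assms by (simp add: algebra_simps power2_eq_square)
  then have "[:c, b, a:] = 0" by (simp only: ev_eq_0_iff)
  then show ?thesis by simp
qed

end

section \<open>Projective representations by two-by-two matrices\<close>

text \<open>A separate type lets \<open>*\<close> be the matrix product, so that the ring laws are
  available for it; on \<open>'a ^ 2 ^ 2\<close> the operation \<open>*\<close> is
  entrywise.\<close>

datatype 'a mat2 = Mat2 (m11: 'a) (m12: 'a) (m21: 'a) (m22: 'a)

instantiation mat2 :: (comm_ring_1) ring_1
begin
definition "0 = Mat2 0 0 0 0"
definition "1 = Mat2 1 0 0 1"
definition "A + B = Mat2 (m11 A + m11 B) (m12 A + m12 B) (m21 A + m21 B) (m22 A + m22 B)"
definition "A - B = Mat2 (m11 A - m11 B) (m12 A - m12 B) (m21 A - m21 B) (m22 A - m22 B)"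
definition "- A = Mat2 (- m11 A) (- m12 A) (- m21 A) (- m22 A)"
definition "A * B = Mat2 (m11 A * m11 B + m12 A * m21 B) (m11 A * m12 B + m12 A * m22 B)
  (m21 A * m11 B + m22 A * m21 B) (m21 A * m12 B + m22 A * m22 B)"
instance
  by standard (simp_all add: zero_mat2_def one_mat2_def plus_mat2_def minus_mat2_def
      uminus_mat2_def times_mat2_def algebra_simps)
end

definition smul :: "'a::comm_ring_1 \<Rightarrow> 'a mat2 \<Rightarrow> 'a mat2" where
  "smul a A = Mat2 (a * m11 A) (a * m12 A) (a * m21 A) (a * m22 A)"

definition det2 :: "'a::comm_ring_1 mat2 \<Rightarrow> 'a" where
  "det2 A = m11 A * m22 A - m12 A * m21 A"

lemmas mat2_defs = zero_mat2_def one_mat2_def plus_mat2_def minus_mat2_def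
  uminus_mat2_def times_mat2_def smul_def det2_def

lemma smul_add: "smul a (A + B) = smul a A + smul a B"
  and add_smul: "smul (a + b) A = smul a A + smul b A"
  and smul_smul: "smul a (smul b A) = smul (a * b) A"
  and smul_mult_left: "smul a A * B = smul a (A * B)"
  and smul_mult_right: "A * smul a B = smul a (A * B)"
  and smul_1: "smul 1 A = A"
  and smul_0: "smul 0 A = 0"
  and smul_zero: "smul a 0 = 0"
  by (simp_all add: mat2_defs algebra_simps)

lemmas smul_simps = smul_add add_smul smul_smul smul_mult_left smul_mult_right smul_1 smul_0 smul_zero

lemma det2_mult: "det2 (A * B) = det2 A * det2 B"
  and det2_smul: "det2 (smul a A) = a ^ 2 * det2 A"
  by (simp_all add: mat2_defs algebra_simps power2_eq_square)

text \<open>The cross term is left as a sum of two equal summands because it is used in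
  characteristic two, where that sum vanishes.\<close>

lemma smul_square:
  "(smul a 1 + smul b X) * (smul a 1 + smul b X) =
    smul (a ^ 2) 1 + (smul (a * b) X + smul (a * b) X) + smul (b ^ 2) (X * X)"
  by (cases X) (simp add: mat2_defs algebra_simps power2_eq_square)

lemma mult_cancel_det2:
  fixes A B D :: "'a::field mat2"
  assumes "A * D = B * D" "det2 D \<noteq> 0"
  shows "A = B"
proof -
  define D' where "D' = smul (inverse (det2 D)) (Mat2 (m22 D) (- m12 D) (- m21 D) (m11 D))"
  have "D * Mat2 (m22 D) (- m12 D) (- m21 D) (m11 D) = smul (det2 D) 1"
    by (simp add: mat2_defs algebra_simps)
  then have "D * D' = 1"
    using assms(2) by (simp add: D'_def smul_simps)
  have "A * (D * D') = B * (D * D')" by (metis assms(1) mult.assoc)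
  then show ?thesis unfolding \<open>D * D' = 1\<close> by simp
qed

lemma lin_indep_1:
  fixes N :: "'a::field mat2"
  assumes "\<And>a. N \<noteq> smul a 1" "smul a 1 + smul b N = smul c 1 + smul d N"
  shows "a = c" "b = d"
proof -
  have *: "smul (b - d) N = smul (c - a) 1"
    using assms(2) by (cases N) (simp add: mat2_defs algebra_simps)
  show "b = d"
  proof (rule ccontr)
    assume "b \<noteq> d"
    then have "N = smul (inverse (b - d)) (smul (b - d) N)" by (simp add: smul_simps)
    then have "N = smul (inverse (b - d) * (c - a)) 1" unfolding * by (simp add: smul_simps)
    then show False using assms(1) by blast
  qed
  with assms(2) show "a = c" by (cases N) (simp add: mat2_defs)
qed

text \<open>\<open>A b\<close> and \<open>D a\<close> are matrices, known up to scalars, of the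
  unipotent element with entry \<open>b\<close> and of a diagonal element. Determinants turn
  commutation up to a scalar into genuine commutation: the \<open>A b\<close> commute, have scalar
  squares and lie in the span of 1 and \<open>A 1\<close>. The torus is used twice, first to find an
  eigenvalue of \<open>A 1\<close> in the field and then to obtain multiplicativity.\<close>

lemma additive_projective_ring_hom:
  fixes A D :: "'f::{finite,field} \<Rightarrow> 'k::field mat2"
  assumes char2: "(1::'k) + 1 = 0" "(1::'f) + 1 = 0"
    and detA: "\<And>b. det2 (A b) \<noteq> 0" and detD: "\<And>a. a \<noteq> 0 \<Longrightarrow> det2 (D a) \<noteq> 0"
    and A_add: "\<And>b c. \<exists>l. l \<noteq> 0 \<and> A (b + c) = smul l (A b * A c)"
    and D_conj: "\<And>a b. a \<noteq> 0 \<Longrightarrow> \<exists>l. l \<noteq> 0 \<and> D a * A b = smul l (A (a ^ 2 * b) * D a)"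
    and A_scalar: "\<And>b l. A b = smul l 1 \<Longrightarrow> b = 0"
    and a0: "a0 \<noteq> 0" "a0 \<noteq> (1::'f)"
  shows "\<exists>\<phi> :: 'f \<Rightarrow> 'k. is_ring_hom \<phi>"
proof -
  have two: "x + x = 0" for x :: 'k
    using char2(1) by (metis distrib_left mult_1_right mult_zero_right)
  have twof: "x + x = 0" for x :: 'f
    using char2(2) by (metis distrib_left mult_1_right mult_zero_right)
  have neg: "- x = x" for x :: 'k using two[of x] by (simp add: eq_neg_iff_add_eq_0 neg_eq_iff_add_eq_0)
  have minus: "x - y = x + y" for x y :: 'k using neg[of y] by (metis diff_conv_add_uminus)
  have double: "X + X = 0" for X :: "'k mat2"
    by (simp add: mat2_defs two)
  have sq_eq: "x = y" if "x ^ 2 = y ^ 2" for x y :: 'k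
    using that neg by (metis power2_eq_iff)
  have A_comm: "A b * A c = A c * A b" for b c
  proof -
    obtain l1 where l1: "l1 \<noteq> 0" "A (b + c) = smul l1 (A b * A c)" using A_add by blast
    obtain l2 where l2: "l2 \<noteq> 0" "A (b + c) = smul l2 (A c * A b)"
      using A_add[of c b] by (metis add.commute)
    have "l1 ^ 2 * (det2 (A b) * det2 (A c)) = det2 (A (b + c))"
      unfolding l1(2) by (simp only: det2_mult det2_smul)
    also have "\<dots> = l2 ^ 2 * (det2 (A b) * det2 (A c))"
      unfolding l2(2) by (simp only: det2_mult det2_smul mult.commute)
    finally have "l1 ^ 2 = l2 ^ 2" using detA[of b] detA[of c] by simp
    then have "l1 = l2" by (rule sq_eq)
    then have "smul (inverse l1) (smul l1 (A b * A c)) = smul (inverse l1) (smul l1 (A c * A b))"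
      using l1(2) l2(2) by metis
    then show ?thesis using l1(1) by (simp add: smul_simps)
  qed
  \<comment> \<open>\<open>A 0\<close> is invertible and a multiple of its own square, hence scalar;
    and b + b = 0 makes the square of \<open>A b\<close> a multiple of \<open>A 0\<close>.\<close>
  have A_sq: "\<exists>l. A b * A b = smul l 1" for b
  proof -
    obtain l where l: "l \<noteq> 0" "A 0 = smul l (A b * A b)" using A_add[of b b] twof[of b] by auto
    obtain l' where l': "l' \<noteq> 0" "A 0 = smul l' (A 0 * A 0)" using A_add[of 0 0] by auto
    have "1 * A 0 = smul l' (A 0) * A 0" using l'(2) by (simp add: smul_simps)
    then have "1 = smul l' (A 0)" using detA[of 0] by (rule mult_cancel_det2)
    then have "1 = smul (l' * l) (A b * A b)" using l(2) by (simp add: smul_simps)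
    moreover have "l' * l \<noteq> 0" using l(1) l'(1) by simp
    ultimately obtain k where k: "k \<noteq> 0" "1 = smul k (A b * A b)" by blast
    have "smul (inverse k) 1 = smul (inverse k) (smul k (A b * A b))" by (simp only: flip: k(2))
    also have "\<dots> = A b * A b" using k(1) by (simp add: smul_simps)
    finally show ?thesis by metis
  qed
  \<comment> \<open>The diagonal entries of the scalar matrix \<open>A b * A b\<close> agree, so
    those of \<open>A b\<close> have equal squares and are equal: the trace is zero in
    characteristic two.\<close>
  have A_trace: "m22 (A b) = m11 (A b)" for b
  proof -
    obtain l where "A b * A b = smul l 1" using A_sq by blast
    then have eqs: "m12 (A b) * (m11 (A b) + m22 (A b)) = 0" "m21 (A b) * (m11 (A b) + m22 (A b)) = 0"
      "m11 (A b) ^ 2 = m22 (A b) ^ 2"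
      by (auto simp: mat2_defs algebra_simps power2_eq_square)
    then show ?thesis using sq_eq by metis
  qed
  define A1 where "A1 = A 1"
  have A1_ns: "A1 \<noteq> smul l 1" for l using A_scalar[of 1 l] by (auto simp: A1_def)
  \<comment> \<open>Commuting with \<open>A1\<close> makes the off-diagonal entries proportional to
    those of \<open>A1\<close>; since diagonal entries are equal, what is left over is
    scalar.\<close>
  have A_span: "\<exists>p q. A b = smul p 1 + smul q A1" for b
  proof -
    have "m12 A1 \<noteq> 0 \<or> m21 A1 \<noteq> 0"
    proof (rule ccontr)
      assume "\<not> ?thesis"
      then have "A1 = smul (m11 A1) 1" using A_trace[of 1] by (cases A1) (simp add: mat2_defs A1_def)
      then show False using A1_ns by blast
    qed
    moreover have comm: "m12 (A b) * m21 A1 = m12 A1 * m21 (A b)"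
      using arg_cong[OF A_comm[of b 1], of m11] by (simp add: A1_def mat2_defs algebra_simps)
    ultimately have "\<exists>q. m12 (A b) = q * m12 A1 \<and> m21 (A b) = q * m21 A1"
    proof (elim disjE)
      assume "m12 A1 \<noteq> 0"
      then show ?thesis using comm by (intro exI[of _ "m12 (A b) / m12 A1"]) (simp add: field_simps)
    next
      assume "m21 A1 \<noteq> 0"
      then show ?thesis using comm by (intro exI[of _ "m21 (A b) / m21 A1"]) (simp add: field_simps)
    qed
    then obtain q where q: "m12 (A b) = q * m12 A1" "m21 (A b) = q * m21 A1" by blast
    have "A b = smul (m11 (A b) - q * m11 A1) 1 + smul q A1"
      using q A_trace[of b] A_trace[of 1] by (cases "A b") (simp add: mat2_defs A1_def)
    then show ?thesis by blast
  qed
  obtain dl where dl: "A1 * A1 = smul dl 1" using A_sq A1_def by metis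

  text \<open>Conjugation by \<open>D a0\<close> maps \<open>A1\<close> to a different element \<open>p + q A1\<close> with the same
    square \<open>dl\<close>; hence \<open>dl\<close> is a square and \<open>A1\<close> has an eigenvalue in the field.\<close>
  have "\<exists>e. dl = e ^ 2"
  proof -
    obtain l where l: "l \<noteq> 0" "D a0 * A 1 = smul l (A (a0 ^ 2) * D a0)"
      using D_conj[OF a0(1), of 1] by auto
    obtain p0 q0 where "A (a0 ^ 2) = smul p0 1 + smul q0 A1" using A_span by blast
    then have B: "smul l (A (a0 ^ 2)) = smul (l * p0) 1 + smul (l * q0) A1" by (simp add: smul_simps)
    define p q where "p = l * p0" and "q = l * q0"
    define B where "B = smul p 1 + smul q A1"
    have DB: "D a0 * A1 = B * D a0" 
      unfolding B_def p_def q_def B[symmetric] by (simp add: l(2) A1_def smul_mult_left)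
    have "smul dl 1 * D a0 = D a0 * (A1 * A1)" by (simp add: dl smul_simps)
    also have "\<dots> = B * B * D a0" by (metis DB mult.assoc)
    finally have BB: "smul dl 1 = B * B" using detD[OF a0(1)] by (rule mult_cancel_det2)
    have BB': "B * B = smul (p ^ 2 + q ^ 2 * dl) 1"
      by (simp add: B_def smul_square dl double smul_smul add_smul)
    have dl_eq: "dl = p ^ 2 + q ^ 2 * dl"
      by (rule lin_indep_1(1)[OF A1_ns, of _ 0 _ 0]) (simp add: smul_0 BB flip: BB')
    have "(1 + q) ^ 2 = 1 + q ^ 2 + (q + q)" by (simp add: power2_eq_square algebra_simps)
    then have "(1 + q) ^ 2 = 1 + q ^ 2" unfolding two by simp
    then have "dl * (1 + q) ^ 2 = dl + q ^ 2 * dl" by (simp add: algebra_simps)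
    also have "\<dots> = p ^ 2 + (q ^ 2 * dl + q ^ 2 * dl)"
      by (subst (1) dl_eq) (simp only: add.assoc)
    finally have eq: "p ^ 2 = dl * (1 + q) ^ 2" unfolding two by simp
    \<comment> \<open>If q = 1, then p = 0 and \<open>A (a0 ^ 2)\<close> is a multiple of
      \<open>A 1\<close>. Then \<open>A (1 + a0 ^ 2)\<close> is scalar, so (1 + a0)^2 = 0 and a0 =
      1.\<close>
    have "1 + q \<noteq> 0"
    proof
      assume q: "1 + q = 0"
      then have "p = 0" using eq by simp
      have "q = 1" using q neg by (metis add_eq_0_iff)
      then have "B = A1" using \<open>p = 0\<close> by (simp add: B_def smul_simps)
      then have "smul l (A (a0 ^ 2)) = A 1" using B by (simp add: B_def p_def q_def A1_def)
      moreover obtain l' where "A (1 + a0 ^ 2) = smul l' (A 1 * A (a0 ^ 2))" using A_add by blast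
      moreover have "A (a0 ^ 2) = smul (inverse l) (smul l (A (a0 ^ 2)))"
        using l(1) by (simp add: smul_simps)
      ultimately have "A (1 + a0 ^ 2) = smul (l' * inverse l) (A1 * A1)"
        by (metis A1_def smul_mult_right smul_smul)
      then have "A (1 + a0 ^ 2) = smul (l' * inverse l * dl) 1" by (simp add: dl smul_smul)
      then have "1 + a0 ^ 2 = 0" by (rule A_scalar)
      moreover have "(1 + a0) ^ 2 = 1 + a0 ^ 2 + (a0 + a0)"
        by (simp add: power2_eq_square algebra_simps)
      ultimately have "(1 + a0) ^ 2 = 0" unfolding twof by simp
      then have "1 + a0 = 0" by simp
      then show False using a0(2) twof[of 1] by (metis add_left_cancel)
    qed
    then have "dl = (p / (1 + q)) ^ 2" using eq by (simp add: power_divide)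
    then show ?thesis by blast
  qed
  then obtain e where e: "dl = e ^ 2" by blast
  define N where "N = A1 - smul e 1"
  have A1N: "A1 = smul e 1 + N" by (simp add: N_def)
  have NN: "N * N = 0"
  proof -
    have N_alt: "N = smul (- e) 1 + smul 1 A1"
      by (simp add: N_def mat2_defs)
    have "N * N = smul (e ^ 2 + dl) 1"
      unfolding N_alt smul_square double by (simp add: dl smul_simps)
    then show ?thesis using two e by (simp add: smul_0)
  qed
  have N_ns: "N \<noteq> smul l 1" for l
    using A1_ns[of "e + l"] by (auto simp: A1N smul_simps)
  have N0: "N \<noteq> 0" using N_ns[of 0] by (simp add: smul_0)
  have "\<exists>x \<beta>. x \<noteq> 0 \<and> A b = smul x (1 + smul \<beta> N)" for b
  proof -
    obtain p q where "A b = smul p 1 + smul q A1" using A_span by blast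
    then have Ab: "A b = smul (p + q * e) 1 + smul q N" by (simp add: A1N smul_simps add.assoc)
    \<comment> \<open>Otherwise \<open>A b\<close> would be a multiple of the nilpotent
      \<open>N\<close>, hence singular.\<close>
    have "p + q * e \<noteq> 0"
    proof
      assume "p + q * e = 0"
      then have "A b * A b = 0" unfolding Ab smul_square NN double by (simp add: smul_simps)
      then have "det2 (A b) * det2 (A b) = 0" by (metis det2_mult det2_smul mult_zero_left smul_0 zero_power2)
      then show False using detA by simp
    qed
    then have "A b = smul (p + q * e) (1 + smul (q / (p + q * e)) N)"
      using Ab by (simp add: smul_simps del: add_smul) 
    then show ?thesis using \<open>p + q * e \<noteq> 0\<close> by blast
  qed
  then obtain x \<beta> where x: "\<And>b. x b \<noteq> 0" and A: "\<And>b. A b = smul (x b) (1 + smul (\<beta> b) N)" by metis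
  have coeffs: "u = v \<and> b = c" if "u \<noteq> 0" "smul u (1 + smul b N) = smul v (1 + smul c N)" for u v b c
    using lin_indep_1[OF N_ns, of u "u * b" v "v * c"] that by (auto simp: smul_simps)
  have \<beta>_add: "\<beta> (b + c) = \<beta> b + \<beta> c" for b c
  proof -
    obtain l where l: "l \<noteq> 0" "A (b + c) = smul l (A b * A c)" using A_add by blast
    have "(1 + smul (\<beta> b) N) * (1 + smul (\<beta> c) N) = 1 + smul (\<beta> b + \<beta> c) N"
      by (simp add: algebra_simps smul_simps NN)
    then have "smul (x (b + c)) (1 + smul (\<beta> (b + c)) N) = smul (l * x b * x c) (1 + smul (\<beta> b + \<beta> c) N)"
      using l(2) unfolding A by (simp add: smul_mult_left smul_mult_right smul_smul mult_ac)
    from coeffs[OF x this] show ?thesis by simp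
  qed
  have \<beta>0: "\<beta> 0 = 0" using \<beta>_add[of 0 0] unfolding two by simp
  have \<beta>1: "\<beta> 1 \<noteq> 0"
    using A_scalar[of 1 "x 1"] by (auto simp: A smul_simps)
  \<comment> \<open>Conjugation by \<open>D a\<close> sends \<open>N\<close> to y + z N, whose
    square is zero; this forces y = 0. So \<open>N\<close> is multiplied by z, which gives \<beta>
    (a^2 b) = z \<beta> b, and the case b = 1 identifies z as \<beta> (a^2) / \<beta> 1.\<close>
  have \<beta>_mult: "\<beta> (a ^ 2 * b) * \<beta> 1 = \<beta> (a ^ 2) * \<beta> b" if a: "a \<noteq> 0" for a b
  proof -
    have conj: "\<exists>u v. u \<noteq> 0 \<and> D a * (1 + smul (\<beta> b) N) = smul u (1 + smul (\<beta> (a ^ 2 * b)) N) * D a" for b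
    proof -
      obtain l where l: "l \<noteq> 0" "D a * A b = smul l (A (a ^ 2 * b) * D a)" using D_conj[OF a] by blast
      then have "smul (inverse (x b)) (D a * A b) = smul (inverse (x b)) (smul l (A (a ^ 2 * b) * D a))" by simp
      then have "D a * (1 + smul (\<beta> b) N) = smul (inverse (x b) * l * x (a ^ 2 * b)) (1 + smul (\<beta> (a ^ 2 * b)) N) * D a"
        using x[of b] unfolding A by (simp add: smul_mult_left smul_mult_right smul_smul smul_1 mult.assoc)
      then show ?thesis using l(1) x by (metis mult_eq_0_iff nonzero_imp_inverse_nonzero)
    qed
    obtain u where u: "D a * (1 + smul (\<beta> 1) N) = smul u (1 + smul (\<beta> (a ^ 2)) N) * D a"
      using conj[of 1] by auto
    define y z where "y = inverse (\<beta> 1) * (u - 1)" and "z = inverse (\<beta> 1) * u * \<beta> (a ^ 2)"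
    have "smul (\<beta> 1) (D a * N) = (smul (u - 1) 1 + smul (u * \<beta> (a ^ 2)) N) * D a"
    proof -
      have "smul (\<beta> 1) (D a * N) = D a * (1 + smul (\<beta> 1) N) - D a"
        by (simp add: algebra_simps smul_simps)
      also have "\<dots> = (smul u (1 + smul (\<beta> (a ^ 2)) N) - 1) * D a" unfolding u by (simp add: left_diff_distrib)
      also have "smul u (1 + smul (\<beta> (a ^ 2)) N) - 1 = smul (u - 1) 1 + smul (u * \<beta> (a ^ 2)) N"
        by (simp add: mat2_defs algebra_simps)
      finally show ?thesis .
    qed
    then have "smul (inverse (\<beta> 1)) (smul (\<beta> 1) (D a * N)) = smul (inverse (\<beta> 1)) ((smul (u - 1) 1 + smul (u * \<beta> (a ^ 2)) N) * D a)"
      by simp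
    then have DN: "D a * N = (smul y 1 + smul z N) * D a"
      using \<beta>1 by (simp add: smul_smul smul_1 y_def z_def flip: smul_mult_left)
        (simp add: smul_add smul_smul mult.assoc)
    define C where "C = smul y 1 + smul z N"
    have "C * C * D a = D a * (N * N)" using DN by (metis C_def mult.assoc)
    then have "C * C * D a = 0 * D a" by (simp add: NN)
    then have "C * C = 0" using detD[OF a] by (rule mult_cancel_det2)
    moreover have "C * C = smul (y ^ 2) 1"
      unfolding C_def smul_square NN double by (simp add: smul_simps)
    ultimately have "smul (y ^ 2) 1 + smul 0 N = smul 0 1 + smul 0 N" by (simp add: smul_0)
    then have "y ^ 2 = 0" by (rule lin_indep_1(1)[OF N_ns])
    then have "y = 0" by simp
    then have "u = 1" using \<beta>1 by (simp add: y_def)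
    have DN: "D a * N = smul z N * D a" using DN \<open>y = 0\<close> by (simp add: smul_0)
    obtain w where w: "w \<noteq> 0" "D a * (1 + smul (\<beta> b) N) = smul w (1 + smul (\<beta> (a ^ 2 * b)) N) * D a"
      using conj[of b] by auto
    have "(1 + smul (\<beta> b * z) N) * D a = D a * (1 + smul (\<beta> b) N)"
      by (simp add: algebra_simps smul_simps DN)
    then have "(1 + smul (\<beta> b * z) N) * D a = smul w (1 + smul (\<beta> (a ^ 2 * b)) N) * D a"
      using w(2) by simp
    then have "1 + smul (\<beta> b * z) N = smul w (1 + smul (\<beta> (a ^ 2 * b)) N)"
      using detD[OF a] by (rule mult_cancel_det2)
    then have "\<beta> b * z = \<beta> (a ^ 2 * b)"
      using coeffs[of 1 "\<beta> b * z" w "\<beta> (a ^ 2 * b)"] by (simp add: smul_1)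
    then show ?thesis using \<beta>1 \<open>u = 1\<close> by (simp add: z_def field_simps)
  qed
  \<comment> \<open>Squaring is bijective on a finite field of characteristic two, so
    multiplicativity for square factors is multiplicativity.\<close>
  have "inj (\<lambda>a::'f. a ^ 2)"
    using twof by (intro injI) (metis power2_eq_iff add_eq_0_iff)
  then have "surj (\<lambda>a::'f. a ^ 2)" by (rule finite_UNIV_inj_surj[OF finite])
  then have sqrt: "\<exists>a. c = a ^ 2" for c :: 'f by (metis surjE)
  have "is_ring_hom (\<lambda>c. \<beta> c / \<beta> 1)"
    unfolding is_ring_hom_def
  proof (intro conjI allI)
    fix c b :: 'f
    show "\<beta> (c * b) / \<beta> 1 = \<beta> c / \<beta> 1 * (\<beta> b / \<beta> 1)"
    proof (cases "c = 0")
      case False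
      obtain a where "c = a ^ 2" using sqrt by blast
      then show ?thesis using \<beta>_mult[of a b] \<beta>1 False by (auto simp: field_simps)
    qed (simp add: \<beta>0)
  qed (use \<beta>1 in \<open>simp_all add: \<beta>_add add_divide_distrib\<close>)
  then show ?thesis by blast
qed

section \<open>Kronecker substitution\<close>

text \<open>Powers of the variable are stripped off, \<open>z\<close> being no zero divisor. The
  nonzero constant term bounds the numerator in \<open>fract_algebraic\<close>, and it is what
  remains in \<open>finitely_generated_luroth\<close> when an element is sent to zero.\<close>

lemma (in ring_homo) ev_coeff_0_nonzero:
  fixes z :: "'b"
  assumes "p \<noteq> 0" "ev p z = 0" "\<And>w. z * w = 0 \<Longrightarrow> w = 0"
  obtains q where "coeff q 0 \<noteq> 0" "ev q z = 0"
  using assms(1,2)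
proof (induction p arbitrary: thesis)
  case (pCons a p)
  show ?case
  proof (cases "a = 0")
    case True
    then have "p \<noteq> 0" "ev p z = 0" using pCons.prems assms(3) by simp_all
    then show ?thesis using pCons.IH pCons.prems(1) by blast
  next
    case False
    then show ?thesis using pCons.prems(1)[of "pCons a p"] pCons.prems(3) by simp
  qed
qed simp

text \<open>By the rational root theorem numerator and denominator of a nonzero root divide nonzero
  constants; thus K is algebraically closed in K(s).\<close>

lemma fract_algebraic:
  fixes z :: "'a::field_gcd poly fract"
  assumes "P \<noteq> 0" "const_fract.ev P z = 0"
  shows "z \<in> range const_fract"
proof (cases "z = 0")
  case True
  then show ?thesis using const_fract.hom_0 by (metis rangeI)
next
  case False
  obtain Q where Q: "coeff Q 0 \<noteq> 0" "const_fract.ev Q z = 0"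
    using const_fract.ev_coeff_0_nonzero[OF assms] False by auto
  obtain a b where ab: "z = to_fract a / to_fract b" "coprime a b" "b \<noteq> 0"
    using fract_coprime_cases .
  define d where "d = degree Q"
  have Q0: "Q \<noteq> 0" using Q(1) by auto
  have pw: "to_fract b ^ d * z ^ i = to_fract (a ^ i * b ^ (d - i))" if "i \<le> d" for i
  proof -
    have "to_fract b ^ d = to_fract b ^ i * to_fract b ^ (d - i)" using that by (simp flip: power_add)
    then show ?thesis using ab(3)
      by (simp add: ab(1) power_divide ring_homo.hom_power[OF ring_homo_to_fract])
  qed
  have "to_fract (\<Sum>i\<le>d. [:coeff Q i:] * a ^ i * b ^ (d - i)) =
      (\<Sum>i\<le>d. const_fract (coeff Q i) * to_fract (a ^ i * b ^ (d - i)))"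
    by (simp only: to_fract_sum to_fract_mult const_fract_def mult.assoc)
  also have "\<dots> = (\<Sum>i\<le>d. to_fract b ^ d * (const_fract (coeff Q i) * z ^ i))"
    by (intro sum.cong refl) (simp only: pw[symmetric] atMost_iff mult.left_commute)
  also have "\<dots> = to_fract b ^ d * const_fract.ev Q z"
    by (simp add: const_fract.ev_altdef[of Q d] d_def sum_distrib_left)
  finally have S: "(\<Sum>i\<le>d. [:coeff Q i:] * a ^ i * b ^ (d - i)) = 0"
    by (simp only: Q(2) mult_zero_right to_fract_eq_0_iff)
  have "b dvd [:coeff Q d:]" "a dvd [:coeff Q 0:]"
    using homogeneous_rational_root[OF S ab(2)] by auto
  moreover have "[:coeff Q d:] \<noteq> 0" "[:coeff Q 0:] \<noteq> 0" using Q0 Q(1) by (simp_all add: d_def)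
  ultimately have "degree b \<le> degree [:coeff Q d:]" "degree a \<le> degree [:coeff Q 0:]"
    by (blast intro: dvd_imp_degree_le)+
  then have "degree a = 0" "degree b = 0" by simp_all
  then obtain a' b' where "a = [:a':]" "b = [:b':]" by (metis degree_eq_zeroE)
  then have "z = const_fract (a' / b')" by (simp add: ab(1) const_fract.hom_divide) (simp add: const_fract_def)
  then show ?thesis by blast
qed

definition exps :: "nat \<Rightarrow> (nat \<Rightarrow> nat) set" where
  "exps n = {\<alpha>. \<forall>i. n \<le> i \<longrightarrow> \<alpha> i = 0}"

text \<open>The exponent of s in the image of the monomial \<alpha> under x i \<mapsto> s ^ w
  i.\<close>

definition weight :: "nat \<Rightarrow> (nat \<Rightarrow> nat) \<Rightarrow> (nat \<Rightarrow> nat) \<Rightarrow> nat" where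
  "weight n w \<alpha> = (\<Sum>i<n. w i * \<alpha> i)"

text \<open>With weights N^i two exponent vectors \<alpha> and \<beta> collide only if N is a root
  of the polynomial with coefficients \<alpha> i - \<beta> i. Finitely many pairs have finitely many
  roots, and some N avoids them all.\<close>

lemma exists_separating_weight:
  assumes "finite A" "A \<subseteq> exps n"
  shows "\<exists>w. inj_on (weight n w) A"
proof -
  define P where "P = (\<lambda>(\<alpha>, \<beta>). \<Sum>i<n. monom (int (\<alpha> i) - int (\<beta> i)) i)"
  have P0: "P (\<alpha>, \<beta>) \<noteq> 0" if "\<alpha> \<in> A" "\<beta> \<in> A" "\<alpha> \<noteq> \<beta>" for \<alpha> \<beta>
  proof
    assume "P (\<alpha>, \<beta>) = 0"
    then have "coeff (P (\<alpha>, \<beta>)) i = 0" for i by simp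
    then have "\<alpha> i = \<beta> i" if "i < n" for i
      using that \<open>\<And>i. coeff (P (\<alpha>, \<beta>)) i = 0\<close>[of i] by (simp add: P_def coeff_sum)
    moreover have "\<alpha> i = \<beta> i" if "\<not> i < n" for i
    proof -
      have "\<alpha> \<in> exps n" "\<beta> \<in> exps n" using \<open>\<alpha> \<in> A\<close> \<open>\<beta> \<in> A\<close> assms(2) by auto
      then show ?thesis using that by (simp add: exps_def)
    qed
    ultimately show False using \<open>\<alpha> \<noteq> \<beta>\<close> by blast
  qed
  define X where "X = (\<Union>p\<in>{(\<alpha>, \<beta>) \<in> A \<times> A. \<alpha> \<noteq> \<beta>}. {z. poly (P p) z = 0})"
  have "finite X" unfolding X_def
  proof (rule finite_UN_I)
    show "finite {(\<alpha>, \<beta>) \<in> A \<times> A. \<alpha> \<noteq> \<beta>}"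
      by (rule finite_subset[of _ "A \<times> A"]) (auto simp: assms(1))
  qed (use P0 in \<open>auto intro!: poly_roots_finite\<close>)
  then have "finite (int -` X)" by (rule finite_vimageI) simp
  then obtain N where N: "int N \<notin> X"
    using ex_new_if_finite[OF infinite_UNIV_nat, of "int -` X"] by auto
  have "inj_on (weight n (\<lambda>i. N ^ i)) A"
  proof (rule inj_onI, rule ccontr)
    fix \<alpha> \<beta> assume *: "\<alpha> \<in> A" "\<beta> \<in> A" "weight n (\<lambda>i. N ^ i) \<alpha> = weight n (\<lambda>i. N ^ i) \<beta>" "\<alpha> \<noteq> \<beta>"
    have "poly (P (\<alpha>, \<beta>)) (int N) = int (weight n (\<lambda>i. N ^ i) \<alpha>) - int (weight n (\<lambda>i. N ^ i) \<beta>)"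
      by (simp add: P_def weight_def poly_sum poly_monom sum_subtractf algebra_simps)
    then have "int N \<in> X" unfolding X_def using * by auto
    with N show False by contradiction
  qed
  then show ?thesis by blast
qed

locale generators = field_homo iota for iota :: "'k::field_gcd \<Rightarrow> 'l::field" +
  fixes x :: "nat \<Rightarrow> 'l" and n :: nat
begin

definition monomial :: "(nat \<Rightarrow> nat) \<Rightarrow> 'l" where
  "monomial \<alpha> = (\<Prod>i<n. x i ^ \<alpha> i)"

text \<open>The graph of the substitution \<open>x i \<mapsto> s ^ w i\<close>; it is single-valued if \<open>x\<close> is algebraically
  independent.\<close>
inductive kron :: "(nat \<Rightarrow> nat) \<Rightarrow> 'l \<Rightarrow> 'k poly \<Rightarrow> bool" for w where
  kron_const: "kron w (iota a) [:a:]"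
| kron_add: "kron w p p' \<Longrightarrow> kron w q q' \<Longrightarrow> kron w (p + q) (p' + q')"
| kron_var_mult: "i < n \<Longrightarrow> kron w p p' \<Longrightarrow> kron w (x i * p) (monom 1 (w i) * p')"

lemma kron_mult: "kron w p p' \<Longrightarrow> kron w q q' \<Longrightarrow> kron w (p * q) (p' * q')"
proof (induction rule: kron.induct)
  case (kron_const a)
  from kron_const show ?case
  proof (induction rule: kron.induct)
    case (kron_const b)
    then show ?case using kron.kron_const[of w "a * b"] by (simp add: hom_mult mult.commute)
  next
    case (kron_add p p' q q')
    then show ?case unfolding distrib_left by (intro kron.kron_add)
  next
    case (kron_var_mult i p p')
    then show ?case
      using kron.kron_var_mult[OF kron_var_mult(1,3)] by (simp only: mult.left_commute)
  qed
next
  case (kron_add p p' q q')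
  then show ?case unfolding distrib_right by (intro kron.kron_add)
next
  case (kron_var_mult i p p')
  then show ?case using kron.kron_var_mult[of i w "p * q" "p' * q'"] by (simp only: mult.assoc)
qed

lemma kron_0: "kron w 0 0" using kron_const[of w 0] by simp
lemma kron_1: "kron w 1 1" using kron_const[of w 1] by (simp add: one_pCons)

lemma kron_var: "i < n \<Longrightarrow> kron w (x i) (monom 1 (w i))"
  using kron_var_mult[OF _ kron_1] by simp

lemma kron_uminus: "kron w p p' \<Longrightarrow> kron w (- p) (- p')"
  using kron_mult[OF kron_const[of w "- 1"], of p p'] by (simp add: hom_uminus)

lemma kron_power: "kron w p p' \<Longrightarrow> kron w (p ^ k) (p' ^ k)"
  by (induction k) (auto intro: kron_mult kron_1)

lemma kron_prod: "(\<And>i. i \<in> A \<Longrightarrow> kron w (f i) (g i)) \<Longrightarrow> kron w (prod f A) (prod g A)"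
  by (induction A rule: infinite_finite_induct) (auto intro: kron_mult kron_1)

lemma kron_sum: "(\<And>i. i \<in> A \<Longrightarrow> kron w (f i) (g i)) \<Longrightarrow> kron w (sum f A) (sum g A)"
  by (induction A rule: infinite_finite_induct) (auto intro: kron_add kron_0)

lemma kron_monomial: "kron w (monomial \<alpha>) (monom 1 (weight n w \<alpha>))"
proof -
  have "(\<Prod>i<k. monom (1::'k) (w i) ^ \<alpha> i) = monom 1 (\<Sum>i<k. w i * \<alpha> i)" for k
    by (induction k) (simp_all add: monom_power mult_monom)
  then show ?thesis
    unfolding monomial_def weight_def using kron_prod[of "{..<n}" w "\<lambda>i. x i ^ \<alpha> i" "\<lambda>i. monom 1 (w i) ^ \<alpha> i"]
    by (auto intro: kron_power kron_var)
qed

lemma kron_sum_monomial: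
  "kron w (\<Sum>\<alpha>\<in>A. iota (c \<alpha>) * monomial \<alpha>) (\<Sum>\<alpha>\<in>A. monom (c \<alpha>) (weight n w \<alpha>))"
proof (rule kron_sum)
  fix \<alpha>
  show "kron w (iota (c \<alpha>) * monomial \<alpha>) (monom (c \<alpha>) (weight n w \<alpha>))"
    using kron_mult[OF kron_const[of w "c \<alpha>"] kron_monomial[of w \<alpha>]] by (simp add: smult_monom)
qed

text \<open>Element and image are written with one common family of coefficients. Algebraic
  independence then makes the image unique, and separating weights allow the coefficients to be read
  off from it. They are zero outside \<open>A\<close> so that two sums can be extended to a common
  index set.\<close>

lemma kron_repr:
  assumes "kron w p p'"
  shows "\<exists>A c. finite A \<and> A \<subseteq> exps n \<and> (\<forall>\<alpha>. \<alpha> \<notin> A \<longrightarrow> c \<alpha> = 0) \<and>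
    p = (\<Sum>\<alpha>\<in>A. iota (c \<alpha>) * monomial \<alpha>) \<and> p' = (\<Sum>\<alpha>\<in>A. monom (c \<alpha>) (weight n w \<alpha>))"
  using assms
proof (induction rule: kron.induct)
  case (kron_const a)
  show ?case
    by (intro exI[of _ "{\<lambda>_. 0}"] exI[of _ "\<lambda>\<alpha>. if \<alpha> = (\<lambda>_. 0) then a else 0"])
       (auto simp: exps_def monomial_def weight_def monom_0)
next
  case (kron_add p p' q q')
  from kron_add.IH obtain A c B d where
    A: "finite A" "A \<subseteq> exps n" "\<And>\<alpha>. \<alpha> \<notin> A \<Longrightarrow> c \<alpha> = 0"
      "p = (\<Sum>\<alpha>\<in>A. iota (c \<alpha>) * monomial \<alpha>)" "p' = (\<Sum>\<alpha>\<in>A. monom (c \<alpha>) (weight n w \<alpha>))"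
    and B: "finite B" "B \<subseteq> exps n" "\<And>\<alpha>. \<alpha> \<notin> B \<Longrightarrow> d \<alpha> = 0"
      "q = (\<Sum>\<alpha>\<in>B. iota (d \<alpha>) * monomial \<alpha>)" "q' = (\<Sum>\<alpha>\<in>B. monom (d \<alpha>) (weight n w \<alpha>))"
    by blast
  define e where "e \<alpha> = c \<alpha> + d \<alpha>" for \<alpha>
  have "(\<Sum>\<alpha>\<in>A. iota (c \<alpha>) * monomial \<alpha>) = (\<Sum>\<alpha>\<in>A \<union> B. iota (c \<alpha>) * monomial \<alpha>)"
    "(\<Sum>\<alpha>\<in>B. iota (d \<alpha>) * monomial \<alpha>) = (\<Sum>\<alpha>\<in>A \<union> B. iota (d \<alpha>) * monomial \<alpha>)"
    "(\<Sum>\<alpha>\<in>A. monom (c \<alpha>) (weight n w \<alpha>)) = (\<Sum>\<alpha>\<in>A \<union> B. monom (c \<alpha>) (weight n w \<alpha>))"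
    "(\<Sum>\<alpha>\<in>B. monom (d \<alpha>) (weight n w \<alpha>)) = (\<Sum>\<alpha>\<in>A \<union> B. monom (d \<alpha>) (weight n w \<alpha>))"
    using A(1,3) B(1,3) by (auto intro!: sum.mono_neutral_left)
  then have 1: "p + q = (\<Sum>\<alpha>\<in>A \<union> B. iota (e \<alpha>) * monomial \<alpha>)"
    and 2: "p' + q' = (\<Sum>\<alpha>\<in>A \<union> B. monom (e \<alpha>) (weight n w \<alpha>))"
    by (simp_all only: A(4,5) B(4,5) e_def hom_add distrib_right sum.distrib add_monom[symmetric])
  have fin: "finite (A \<union> B)" and sub: "A \<union> B \<subseteq> exps n"
    and zero: "\<forall>\<alpha>. \<alpha> \<notin> A \<union> B \<longrightarrow> e \<alpha> = 0"
    using A(1-3) B(1-3) by (auto simp: e_def)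
  show ?case
    by (rule exI[of _ "A \<union> B"], rule exI[of _ e], intro conjI) fact+
next
  case (kron_var_mult i p p')
  from kron_var_mult.IH obtain A c where
    A: "finite A" "A \<subseteq> exps n" "\<And>\<alpha>. \<alpha> \<notin> A \<Longrightarrow> c \<alpha> = 0"
      "p = (\<Sum>\<alpha>\<in>A. iota (c \<alpha>) * monomial \<alpha>)" "p' = (\<Sum>\<alpha>\<in>A. monom (c \<alpha>) (weight n w \<alpha>))"
    by blast
  \<comment> \<open>Multiplication by \<open>x i\<close> shifts exponent vectors by
    \<open>s\<close>; \<open>s'\<close> undoes the shift.\<close>
  define s where "s \<alpha> = \<alpha>(i := Suc (\<alpha> i))" for \<alpha> :: "nat \<Rightarrow> nat"
  define s' where "s' \<alpha> = \<alpha>(i := \<alpha> i - 1)" for \<alpha> :: "nat \<Rightarrow> nat"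
  have s's: "s' (s \<alpha>) = \<alpha>" for \<alpha> by (simp add: s_def s'_def)
  then have inj: "inj_on s A" by (metis inj_onI)
  define c' where "c' \<alpha> = (if \<alpha> \<in> s ` A then c (s' \<alpha>) else 0)" for \<alpha>
  have monomial_s: "monomial (s \<alpha>) = x i * monomial \<alpha>" for \<alpha>
  proof -
    have "monomial \<beta> = x i ^ \<beta> i * (\<Prod>j\<in>{..<n} - {i}. x j ^ \<beta> j)" for \<beta>
      unfolding monomial_def using \<open>i < n\<close> by (intro prod.remove) auto
    from this[of \<alpha>] this[of "s \<alpha>"] show ?thesis by (simp add: s_def mult.assoc)
  qed
  have weight_s: "weight n w (s \<alpha>) = w i + weight n w \<alpha>" for \<alpha>
  proof -
    have "weight n w \<beta> = w i * \<beta> i + (\<Sum>j\<in>{..<n} - {i}. w j * \<beta> j)" for \<beta>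
      unfolding weight_def using \<open>i < n\<close> by (intro sum.remove) auto
    from this[of \<alpha>] this[of "s \<alpha>"] show ?thesis by (simp add: s_def)
  qed
  have c's: "c' (s \<alpha>) = c \<alpha>" if "\<alpha> \<in> A" for \<alpha>
    using that by (simp add: c'_def s's)
  have 1: "x i * p = (\<Sum>\<alpha>\<in>s ` A. iota (c' \<alpha>) * monomial \<alpha>)"
    unfolding A(4) sum_distrib_left sum.reindex[OF inj] o_def monomial_s
    by (intro sum.cong refl) (simp only: c's mult.left_commute)
  have 2: "monom 1 (w i) * p' = (\<Sum>\<alpha>\<in>s ` A. monom (c' \<alpha>) (weight n w \<alpha>))"
    unfolding A(5) sum_distrib_left sum.reindex[OF inj] o_def weight_s
    by (intro sum.cong refl) (simp only: c's mult_monom mult_1_left)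
  have "s ` A \<subseteq> exps n" using A(2) \<open>i < n\<close> by (auto simp: s_def exps_def)
  have fin: "finite (s ` A)" and zero: "\<forall>\<alpha>. \<alpha> \<notin> s ` A \<longrightarrow> c' \<alpha> = 0"
    using A(1) by (simp_all add: c'_def)
  show ?case
    by (rule exI[of _ "s ` A"], rule exI[of _ c'], intro conjI) fact+
qed

text \<open>The ring K[x 0, ..., x (n-1)], obtained as the domain of the substitution; by
  \<open>gen_ring_imp_kron\<close> every weight gives the same domain.\<close>

definition gen_ring :: "'l set" where
  "gen_ring = {p. \<exists>w p'. kron w p p'}"

lemma kron_imp_gen_ring: "kron w p p' \<Longrightarrow> p \<in> gen_ring"
  by (auto simp: gen_ring_def)

lemma gen_ring_imp_kron:
  assumes "p \<in> gen_ring"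
  obtains p' where "kron w p p'"
proof -
  obtain w0 p0 where "kron w0 p p0" using assms by (auto simp: gen_ring_def)
  from kron_repr[OF this] obtain A c where "p = (\<Sum>\<alpha>\<in>A. iota (c \<alpha>) * monomial \<alpha>)" by blast
  then have "kron w p (\<Sum>\<alpha>\<in>A. monom (c \<alpha>) (weight n w \<alpha>))" using kron_sum_monomial[of w c A] by (simp only:)
  then show ?thesis by (rule that)
qed

definition gen_quot :: "'l set" where
  "gen_quot = {p / q | p q. p \<in> gen_ring \<and> q \<in> gen_ring \<and> q \<noteq> 0}"

lemma is_subfield_gen_quot: "is_subfield gen_quot"
  unfolding gen_quot_def
proof (rule subfield_quotients)
  show "1 \<in> gen_ring" by (rule kron_imp_gen_ring[OF kron_1])
  fix a assume "a \<in> gen_ring"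
  then obtain a' where a: "kron (\<lambda>_. 0) a a'" by (rule gen_ring_imp_kron)
  show "- a \<in> gen_ring" by (rule kron_imp_gen_ring[OF kron_uminus[OF a]])
  fix b assume "b \<in> gen_ring"
  then obtain b' where b: "kron (\<lambda>_. 0) b b'" by (rule gen_ring_imp_kron)
  show "a + b \<in> gen_ring" by (rule kron_imp_gen_ring[OF kron_add[OF a b]])
  show "a * b \<in> gen_ring" by (rule kron_imp_gen_ring[OF kron_mult[OF a b]])
qed

lemma gen_ring_subset_gen_quot: "gen_ring \<subseteq> gen_quot"
proof
  fix p assume "p \<in> gen_ring"
  moreover have "1 \<in> gen_ring" by (rule kron_imp_gen_ring[OF kron_1])
  ultimately have "p / 1 \<in> gen_quot"
    unfolding gen_quot_def mem_Collect_eq by (intro exI[of _ p] exI[of _ 1]) simp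
  then show "p \<in> gen_quot" by simp
qed

lemma gen_quot_const: "iota a \<in> gen_quot" and gen_quot_var: "i < n \<Longrightarrow> x i \<in> gen_quot"
  using kron_imp_gen_ring[OF kron_const] kron_imp_gen_ring[OF kron_var] gen_ring_subset_gen_quot by auto

lemma gen_quot_least:
  assumes "is_subfield F" "range iota \<subseteq> F" "x ` {..<n} \<subseteq> F"
  shows "gen_quot \<subseteq> F"
proof -
  interpret F: subfield F by unfold_locales fact
  have "p \<in> F" if "kron w p p'" for w p p'
    using that by induction (use assms(2,3) in \<open>auto intro: F.add_mem F.mult_mem\<close>)
  then have "gen_ring \<subseteq> F" by (auto simp: gen_ring_def)
  then show ?thesis by (auto simp: gen_quot_def intro: F.divide_mem)
qed

end

locale rational_functions = generators iota x n
  for iota :: "'k::field_gcd \<Rightarrow> 'l::field" and x :: "nat \<Rightarrow> 'l" and n :: nat +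
  assumes indep: "alg_indep (range iota) x n"
    and gen: "\<And>E. is_subfield E \<Longrightarrow> range iota \<subseteq> E \<Longrightarrow> x ` {..<n} \<subseteq> E \<Longrightarrow> E = UNIV"
begin

lemma gen_quot_UNIV: "gen_quot = UNIV"
  by (rule gen[OF is_subfield_gen_quot]) (auto intro: gen_quot_const gen_quot_var)

lemma kron_zero:
  assumes "kron w 0 p'"
  shows "p' = 0"
proof -
  from kron_repr[OF assms] obtain A c where A: "finite A" "A \<subseteq> exps n"
    "0 = (\<Sum>\<alpha>\<in>A. iota (c \<alpha>) * monomial \<alpha>)" "p' = (\<Sum>\<alpha>\<in>A. monom (c \<alpha>) (weight n w \<alpha>))" by blast
  have "(\<Sum>\<alpha>\<in>A. iota (c \<alpha>) * (\<Prod>i<n. x i ^ \<alpha> i)) = 0"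
    using A(3)[symmetric] unfolding monomial_def .
  then have "\<forall>\<alpha>\<in>A. iota (c \<alpha>) = 0"
    using spec[OF spec[OF indep[unfolded alg_indep_def], of A], of "\<lambda>\<alpha>. iota (c \<alpha>)"] A(1,2)
    unfolding exps_def by blast
  then show ?thesis using A(4) by simp
qed

lemma kron_unique:
  assumes "kron w p p'" "kron w p q'"
  shows "p' = q'"
proof -
  have "kron w (p + - p) (p' + - q')" by (intro kron_add kron_uminus assms)
  then have "p' + - q' = 0" by (intro kron_zero[of w]) (simp only: add.right_inverse)
  then show ?thesis by simp
qed

text \<open>Weights that are injective on all exponents occurring in \<open>Z\<close> make the
  coefficients visible in the images, so proportional images come from proportional elements. The
  case k = 0 says that no nonzero element of \<open>Z\<close> is sent to zero.\<close>

lemma exists_weight: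
  assumes "finite Z" "Z \<subseteq> gen_ring"
  obtains w where "\<And>p q p' q' k. p \<in> Z \<Longrightarrow> q \<in> Z \<Longrightarrow> kron w p p' \<Longrightarrow> kron w q q' \<Longrightarrow>
    p' = smult k q' \<Longrightarrow> p = iota k * q"
proof -
  define R where "R p Ac \<longleftrightarrow> finite (fst Ac) \<and> fst Ac \<subseteq> exps n \<and> (\<forall>\<alpha>. \<alpha> \<notin> fst Ac \<longrightarrow> snd Ac \<alpha> = 0) \<and>
    p = (\<Sum>\<alpha>\<in>fst Ac. iota (snd Ac \<alpha>) * monomial \<alpha>)" for p and Ac :: "(nat \<Rightarrow> nat) set \<times> ((nat \<Rightarrow> nat) \<Rightarrow> 'k)"
  have "\<forall>p\<in>Z. \<exists>Ac. R p Ac"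
  proof
    fix p assume "p \<in> Z"
    then have "p \<in> gen_ring" using assms(2) by blast
    then obtain w p' where "kron w p p'" unfolding gen_ring_def by blast
    from kron_repr[OF this] obtain A c where "R p (A, c)" unfolding R_def by auto
    then show "\<exists>Ac. R p Ac" ..
  qed
  from bchoice[OF this] obtain f where f: "\<And>p. p \<in> Z \<Longrightarrow> R p (f p)" by blast
  define A c where "A p = fst (f p)" and "c p = snd (f p)" for p
  have A: "finite (A p)" "A p \<subseteq> exps n" "\<forall>\<alpha>. \<alpha> \<notin> A p \<longrightarrow> c p \<alpha> = 0"
    "p = (\<Sum>\<alpha>\<in>A p. iota (c p \<alpha>) * monomial \<alpha>)" if "p \<in> Z" for p
    using f[OF that] unfolding R_def A_def c_def by - (elim conjE, assumption)+
  define B where "B = (\<Union>p\<in>Z. A p)"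
  have B: "finite B" "B \<subseteq> exps n" using A(1,2) assms(1) by (auto simp: B_def)
  have pB: "p = (\<Sum>\<alpha>\<in>B. iota (c p \<alpha>) * monomial \<alpha>)" if "p \<in> Z" for p
  proof -
    have "(\<Sum>\<alpha>\<in>A p. iota (c p \<alpha>) * monomial \<alpha>) = (\<Sum>\<alpha>\<in>B. iota (c p \<alpha>) * monomial \<alpha>)"
      using that A(3) B(1) by (intro sum.mono_neutral_left) (auto simp: B_def)
    then show ?thesis using A(4)[OF that] by simp
  qed
  obtain w where w: "inj_on (weight n w) B" using exists_separating_weight[OF B] by blast
  have coeff: "coeff p' (weight n w \<alpha>) = c p \<alpha>" if "p \<in> Z" "kron w p p'" "\<alpha> \<in> B" for p p' \<alpha>
  proof -
    have "p' = (\<Sum>\<alpha>\<in>B. monom (c p \<alpha>) (weight n w \<alpha>))"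
      using kron_unique[OF that(2)] kron_sum_monomial[of w "c p" B] pB[OF that(1)] by simp
    then have "coeff p' (weight n w \<alpha>) = (\<Sum>\<beta>\<in>B. if weight n w \<beta> = weight n w \<alpha> then c p \<beta> else 0)"
      by (simp add: coeff_sum)
    also have "\<dots> = (\<Sum>\<beta>\<in>B. if \<beta> = \<alpha> then c p \<beta> else 0)"
      using inj_on_eq_iff[OF w] that(3) by (intro sum.cong) auto
    finally show ?thesis using that(3) B(1) by simp
  qed
  show ?thesis
  proof (rule that)
    fix p q p' q' k
    assume *: "p \<in> Z" "q \<in> Z" "kron w p p'" "kron w q q'" "p' = smult k q'"
    have "c p \<alpha> = k * c q \<alpha>" if "\<alpha> \<in> B" for \<alpha>
      using coeff[OF *(1,3) that] coeff[OF *(2,4) that] *(5) by simp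
    then have "(\<Sum>\<alpha>\<in>B. iota (c p \<alpha>) * monomial \<alpha>) = iota k * (\<Sum>\<alpha>\<in>B. iota (c q \<alpha>) * monomial \<alpha>)"
      by (simp add: sum_distrib_left hom_mult mult.assoc)
    then show "p = iota k * q" using pB[OF *(1)] pB[OF *(2)] by simp
  qed
qed

end

section \<open>Finitely generated subfields of transcendence degree one\<close>

context field_homo
begin

definition gen_field :: "'b set \<Rightarrow> 'b set" where
  "gen_field S = \<Inter>{F. is_subfield F \<and> range h \<subseteq> F \<and> S \<subseteq> F}"

lemma is_subfield_gen_field: "is_subfield (gen_field S)"
  unfolding gen_field_def by (auto simp: is_subfield_def)

lemma gen_field_gens: "range h \<subseteq> gen_field S" "S \<subseteq> gen_field S"
  by (auto simp: gen_field_def)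

lemma gen_field_least: "is_subfield F \<Longrightarrow> range h \<subseteq> F \<Longrightarrow> S \<subseteq> F \<Longrightarrow> gen_field S \<subseteq> F"
  by (auto simp: gen_field_def)

lemma ev_mem:
  assumes "is_subfield E" "range h \<subseteq> E" "z \<in> E"
  shows "ev p z \<in> E"
proof -
  interpret E: subfield E by unfold_locales fact
  show ?thesis
    unfolding ev_def using assms(2,3) by (intro E.poly_mem) (auto simp: E.polys_def coeff_map_poly)
qed

end

section \<open>The substitution on fractions\<close>

context rational_functions
begin

text \<open>A partial map to K(s): its domain consists of the fractions that have some denominator
  with nonzero image, in general a local ring rather than a field.\<close>

definition kron_fract :: "(nat \<Rightarrow> nat) \<Rightarrow> 'l \<Rightarrow> 'k poly fract \<Rightarrow> bool" where
  "kron_fract w e z \<longleftrightarrow> (\<exists>p p' q q'. kron w p p' \<and> kron w q q' \<and> q' \<noteq> 0 \<and>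
    e = p / q \<and> z = to_fract p' / to_fract q')"

lemma PsiI: "kron w p p' \<Longrightarrow> kron w q q' \<Longrightarrow> q' \<noteq> 0 \<Longrightarrow> kron_fract w (p / q) (to_fract p' / to_fract q')"
  unfolding kron_fract_def by blast

lemma kron_nonzero: "kron w q q' \<Longrightarrow> q' \<noteq> 0 \<Longrightarrow> q \<noteq> 0"
  using kron_zero by blast

lemma PsiE:
  assumes "kron_fract w e z"
  obtains p p' q q' where "kron w p p'" "kron w q q'" "q' \<noteq> 0" "q \<noteq> 0"
    "e = p / q" "z = to_fract p' / to_fract q'"
  using assms kron_nonzero unfolding kron_fract_def by blast

lemma kron_fract_unique:
  assumes "kron_fract w e z" "kron_fract w e y"
  shows "z = y"
proof -
  obtain p p' q q' where 1: "kron w p p'" "kron w q q'" "q' \<noteq> 0" "q \<noteq> 0"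
    "e = p / q" "z = to_fract p' / to_fract q'" using PsiE[OF assms(1)] .
  obtain r r' s s' where 2: "kron w r r'" "kron w s s'" "s' \<noteq> 0" "s \<noteq> 0"
    "e = r / s" "y = to_fract r' / to_fract s'" using PsiE[OF assms(2)] .
  have "p * s = r * q" using 1 2 by (simp add: frac_eq_eq)
  then have "p' * s' = r' * q'"
    using kron_unique[OF kron_mult[OF 1(1) 2(2)]] kron_mult[OF 2(1) 1(2)] by simp
  then have "to_fract p' * to_fract s' = to_fract r' * to_fract q'" by (simp flip: to_fract_mult)
  then show ?thesis using 1 2 by (simp add: frac_eq_eq)
qed

lemma kron_fract_const: "kron_fract w (iota a) (const_fract a)"
  using PsiI[OF kron_const[of w a] kron_1] by (simp add: const_fract_def)

lemma kron_fract_0: "kron_fract w 0 0"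
  using kron_fract_const[of w 0] by simp

lemma kron_fract_add:
  assumes "kron_fract w e z" "kron_fract w f y"
  shows "kron_fract w (e + f) (z + y)"
proof -
  obtain p p' q q' where 1: "kron w p p'" "kron w q q'" "q' \<noteq> 0" "q \<noteq> 0"
    "e = p / q" "z = to_fract p' / to_fract q'" using PsiE[OF assms(1)] .
  obtain r r' s s' where 2: "kron w r r'" "kron w s s'" "s' \<noteq> 0" "s \<noteq> 0"
    "f = r / s" "y = to_fract r' / to_fract s'" using PsiE[OF assms(2)] .
  have "kron_fract w ((p * s + r * q) / (q * s)) (to_fract (p' * s' + r' * q') / to_fract (q' * s'))"
    using 1 2 by (intro PsiI kron_add kron_mult) auto
  then show ?thesis using 1 2 by (simp add: add_frac_eq)
qed

lemma kron_fract_mult: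
  assumes "kron_fract w e z" "kron_fract w f y"
  shows "kron_fract w (e * f) (z * y)"
proof -
  obtain p p' q q' where 1: "kron w p p'" "kron w q q'" "q' \<noteq> 0" "q \<noteq> 0"
    "e = p / q" "z = to_fract p' / to_fract q'" using PsiE[OF assms(1)] .
  obtain r r' s s' where 2: "kron w r r'" "kron w s s'" "s' \<noteq> 0" "s \<noteq> 0"
    "f = r / s" "y = to_fract r' / to_fract s'" using PsiE[OF assms(2)] .
  have "kron_fract w ((p * r) / (q * s)) (to_fract (p' * r') / to_fract (q' * s'))"
    using 1 2 by (intro PsiI kron_mult) auto
  then show ?thesis using 1 2 by simp
qed

lemma kron_fract_uminus: "kron_fract w e z \<Longrightarrow> kron_fract w (- e) (- z)"
  using kron_fract_mult[OF kron_fract_const[of w "- 1"], of e z] by (simp add: hom_uminus const_fract.hom_uminus)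

lemma kron_fract_inverse:
  assumes "kron_fract w e z" "z \<noteq> 0"
  shows "kron_fract w (inverse e) (inverse z)"
proof -
  obtain p p' q q' where 1: "kron w p p'" "kron w q q'" "q' \<noteq> 0" "q \<noteq> 0"
    "e = p / q" "z = to_fract p' / to_fract q'" using PsiE[OF assms(1)] .
  have "p' \<noteq> 0" using 1(6) assms(2) by auto
  from PsiI[OF 1(2,1) this] show ?thesis using 1 by simp
qed

lemma kron_fract_ev: "kron_fract w e z \<Longrightarrow> kron_fract w (ev P e) (const_fract.ev P z)"
  by (induction P) (simp_all add: kron_fract_0 kron_fract_add kron_fract_mult kron_fract_const)

text \<open>\<open>exists_weight\<close> is applied to all numerators and denominators at once: the
  denominators stay nonzero, and a constant image means that numerator and denominator were
  proportional already.\<close>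

lemma exists_kron_fract:
  assumes "finite S"
  obtains w where "\<And>e. e \<in> S \<Longrightarrow> \<exists>z. kron_fract w e z \<and> (z \<in> range const_fract \<longrightarrow> e \<in> range iota)"
proof -
  have "\<forall>e. \<exists>pq. fst pq \<in> gen_ring \<and> snd pq \<in> gen_ring \<and> snd pq \<noteq> 0 \<and> e = fst pq / snd pq"
  proof
    fix e :: 'l
    have "e \<in> gen_quot" by (simp add: gen_quot_UNIV)
    then show "\<exists>pq. fst pq \<in> gen_ring \<and> snd pq \<in> gen_ring \<and> snd pq \<noteq> 0 \<and> e = fst pq / snd pq"
      unfolding gen_quot_def by auto
  qed
  from choice[OF this] obtain f where f: "\<And>e. fst (f e) \<in> gen_ring" "\<And>e. snd (f e) \<in> gen_ring"
    "\<And>e. snd (f e) \<noteq> 0" "\<And>e. e = fst (f e) / snd (f e)" by blast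
  define Z where "Z = (fst \<circ> f) ` S \<union> (snd \<circ> f) ` S"
  have "finite Z" "Z \<subseteq> gen_ring" using assms f(1,2) by (auto simp: Z_def)
  then obtain w where w: "\<And>p q p' q' k. p \<in> Z \<Longrightarrow> q \<in> Z \<Longrightarrow> kron w p p' \<Longrightarrow> kron w q q' \<Longrightarrow>
    p' = smult k q' \<Longrightarrow> p = iota k * q" by (rule exists_weight) blast
  show ?thesis
  proof (rule that)
    fix e assume e: "e \<in> S"
    have Z: "fst (f e) \<in> Z" "snd (f e) \<in> Z" using e by (auto simp: Z_def)
    obtain p' where p': "kron w (fst (f e)) p'" using gen_ring_imp_kron[OF f(1)] .
    obtain q' where q': "kron w (snd (f e)) q'" using gen_ring_imp_kron[OF f(2)] .
    have "q' \<noteq> 0" using w[OF Z(2,2) q' q', of 0] f(3)[of e] by auto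
    have "kron_fract w e (to_fract p' / to_fract q')"
      by (subst f(4)) (rule PsiI[OF p' q' \<open>q' \<noteq> 0\<close>])
    moreover have "e \<in> range iota" if "to_fract p' / to_fract q' \<in> range const_fract"
    proof -
      from that obtain k where "to_fract p' / to_fract q' = const_fract k" by (rule rangeE)
      then have "to_fract p' = to_fract (smult k q')"
        using \<open>q' \<noteq> 0\<close> by (simp add: const_fract_def field_simps flip: to_fract_mult)
      then have "p' = smult k q'" by (simp only: to_fract_eq_iff)
      from w[OF Z p' q' this] have "fst (f e) / snd (f e) = iota k" using f(3)[of e] by simp
      then show ?thesis using f(4)[of e] by (metis rangeI)
    qed
    ultimately show "\<exists>z. kron_fract w e z \<and> (z \<in> range const_fract \<longrightarrow> e \<in> range iota)" by blast
  qed
qed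

text \<open>A given element can be sent to K(s) in such a way that it becomes constant only if it
  was constant; there \<open>fract_algebraic\<close> applies.\<close>

lemma algebraic_imp_const:
  assumes "P \<noteq> 0" "ev P e = 0"
  shows "e \<in> range iota"
proof -
  obtain w where w: "\<And>f. f \<in> {e} \<Longrightarrow> \<exists>z. kron_fract w f z \<and> (z \<in> range const_fract \<longrightarrow> f \<in> range iota)"
    using exists_kron_fract[of "{e}"] by blast
  then obtain z where z: "kron_fract w e z" "z \<in> range const_fract \<longrightarrow> e \<in> range iota" by blast
  have "const_fract.ev P z = 0" using kron_fract_unique[OF kron_fract_ev[OF z(1), of P]] assms(2) kron_fract_0 by simp
  then show ?thesis using fract_algebraic[OF assms(1)] z(2) by blast
qed

lemma transcendental_iff: "transcendental iota t \<longleftrightarrow> t \<notin> range iota"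
proof
  assume "transcendental iota t"
  then interpret t: transcendental iota t .
  show "t \<notin> range iota" using t.not_const by blast
next
  assume "t \<notin> range iota"
  then show "transcendental iota t" using algebraic_imp_const by unfold_locales blast
qed

text \<open>The substitution is chosen to be defined on \<open>y\<close> and \<open>S\<close> and to
  keep their nonconstant elements nonconstant. By \<open>dep\<close>, which expresses transcendence
  degree one, it is injective on its domain in \<open>E\<close>; this domain is therefore closed
  under inverses and contains the field generated by \<open>S\<close>. The image of that field is a
  subfield of K(s), and a generator found there is pulled back.\<close>

theorem finitely_generated_luroth:
  assumes E: "is_subfield E" "range iota \<subseteq> E" and y: "y \<in> E" "y \<notin> range iota"
    and dep: "\<And>e. e \<in> E \<Longrightarrow> \<exists>P. P \<noteq> 0 \<and> ring_homo.ev (\<lambda>C. ev C y) P e = 0"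
    and S: "finite S" "S \<subseteq> E" and e0: "e0 \<in> S" "e0 \<notin> range iota"
  obtains t where "t \<in> gen_field S" "t \<notin> range iota" "gen_field S \<subseteq> transcendental.simple_ext iota t"
proof -
  interpret E: subfield E by unfold_locales fact
  define F where "F = gen_field S"
  interpret F: subfield F unfolding F_def by unfold_locales (rule is_subfield_gen_field)
  have FE: "F \<subseteq> E" unfolding F_def using E S(2) by (intro gen_field_least)
  obtain w where w: "\<And>e. e \<in> insert y S \<Longrightarrow> \<exists>z. kron_fract w e z \<and> (z \<in> range const_fract \<longrightarrow> e \<in> range iota)"
    using exists_kron_fract[of "insert y S"] S(1) by blast
  obtain yy where yy: "kron_fract w y yy" "yy \<notin> range const_fract" using w[of y] y(2) by blast
  interpret evy: ring_homo "\<lambda>C. ev C y" by (rule ring_homo_ev)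

  text \<open>The lowest coefficient of the relation between \<open>y\<close> and \<open>e\<close> would give an algebraic
    equation for the image of \<open>y\<close> if \<open>e\<close> were mapped to zero.\<close>
  have inj: "e = 0" if e: "e \<in> E" "kron_fract w e 0" for e
  proof (rule ccontr)
    assume "e \<noteq> 0"
    obtain P0 where "P0 \<noteq> 0" "evy.ev P0 e = 0" using dep[OF e(1)] by blast
    then obtain P where P: "coeff P 0 \<noteq> 0" "evy.ev P e = 0"
      using evy.ev_coeff_0_nonzero[of P0 e] \<open>e \<noteq> 0\<close> by auto
    have *: "\<exists>z. kron_fract w (evy.ev Q e) z" for Q
    proof (induction Q)
      case (pCons C Q)
      then show ?case using kron_fract_add[OF kron_fract_ev[OF yy(1), of C] kron_fract_mult[OF e(2)]] by auto
    qed (auto intro: kron_fract_0)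
    obtain C Q where CQ: "P = pCons C Q" by (cases P)
    obtain z where z: "kron_fract w (evy.ev Q e) z" using * by blast
    have "kron_fract w (evy.ev P e) (const_fract.ev C yy + 0 * z)"
      unfolding CQ evy.ev_pCons by (rule kron_fract_add[OF kron_fract_ev[OF yy(1)] kron_fract_mult[OF e(2) z]])
    then have "kron_fract w 0 (const_fract.ev C yy)" using P(2) by simp
    then have "const_fract.ev C yy = 0" by (rule kron_fract_unique[OF _ kron_fract_0])
    then show False using fract_algebraic[of C yy] P(1) CQ yy(2) by auto
  qed

  define D where "D = {e \<in> E. \<exists>z. kron_fract w e z}"
  have "is_subfield D"
    unfolding is_subfield_def
  proof (intro conjI ballI)
    show "0 \<in> D" using kron_fract_0 by (auto simp: D_def)
    show "1 \<in> D" using kron_fract_const[of w 1] by (auto simp: D_def)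
    fix a assume a: "a \<in> D"
    then obtain z where z: "a \<in> E" "kron_fract w a z" by (auto simp: D_def)
    show "- a \<in> D" using z by (auto simp: D_def intro: E.uminus_mem kron_fract_uminus)
    show "inverse a \<in> D"
    proof (cases "z = 0")
      case True
      then have "a = 0" using inj z by simp
      then show ?thesis using a by simp
    next
      case False
      then show ?thesis using z kron_fract_inverse by (auto simp: D_def intro: E.inverse_mem)
    qed
    fix b assume b: "b \<in> D"
    then show "a + b \<in> D" "a * b \<in> D"
      using z by (auto simp: D_def intro: E.add_mem E.mult_mem kron_fract_add kron_fract_mult)
  qed
  moreover have "range iota \<subseteq> D" using E(2) kron_fract_const by (auto simp: D_def)
  moreover have "S \<subseteq> D" using S(2) w unfolding D_def by blast
  ultimately have "F \<subseteq> D" unfolding F_def by (rule gen_field_least)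
  then have Fz: "\<exists>z. kron_fract w e z" if "e \<in> F" for e using that by (auto simp: D_def)

  define F' where "F' = {z. \<exists>e\<in>F. kron_fract w e z}"
  have F'I: "z \<in> F'" if "kron_fract w e z" "e \<in> F" for e z using that by (auto simp: F'_def)
  have F': "is_subfield F'"
    unfolding is_subfield_def
  proof (intro conjI ballI)
    show "0 \<in> F'" by (rule F'I[OF kron_fract_0]) simp
    show "1 \<in> F'" using F'I[OF kron_fract_const[of w 1]] by simp
    fix z assume "z \<in> F'"
    then obtain e where e: "e \<in> F" "kron_fract w e z" by (auto simp: F'_def)
    show "- z \<in> F'" by (rule F'I[OF kron_fract_uminus[OF e(2)] F.uminus_mem[OF e(1)]])
    show "inverse z \<in> F'"
    proof (cases "z = 0")
      case False
      then show ?thesis by (rule F'I[OF kron_fract_inverse[OF e(2)] F.inverse_mem[OF e(1)]])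
    qed (use \<open>0 \<in> F'\<close> in simp)
    fix u assume "u \<in> F'"
    then obtain f where f: "f \<in> F" "kron_fract w f u" by (auto simp: F'_def)
    show "z + u \<in> F'" by (rule F'I[OF kron_fract_add[OF e(2) f(2)] F.add_mem[OF e(1) f(1)]])
    show "z * u \<in> F'" by (rule F'I[OF kron_fract_mult[OF e(2) f(2)] F.mult_mem[OF e(1) f(1)]])
  qed
  have kF: "range iota \<subseteq> F" and SF: "S \<subseteq> F" unfolding F_def by (rule gen_field_gens)+
  then have kF': "range const_fract \<subseteq> F'" using F'I[OF kron_fract_const] by blast
  obtain z0 where z0: "kron_fract w e0 z0" "z0 \<notin> range const_fract" using w[of e0] e0 by blast
  have "z0 \<in> F'" by (rule F'I[OF z0(1)]) (use e0 SF in blast)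
  from luroth[OF F' kF' this z0(2)] obtain t' where t': "t' \<in> F'" "t' \<notin> range const_fract"
    "\<And>z. z \<in> F' \<Longrightarrow> \<exists>a b. const_fract.ev b t' \<noteq> 0 \<and> z = const_fract.ev a t' / const_fract.ev b t'" by blast
  obtain t where t: "t \<in> F" "kron_fract w t t'" using t'(1) by (auto simp: F'_def)
  have tk: "t \<notin> range iota" using t(2) t'(2) kron_fract_const kron_fract_unique by blast
  then interpret t: transcendental iota t by (simp add: transcendental_iff)
  have "F \<subseteq> t.simple_ext"
  proof
    fix e assume e: "e \<in> F"
    then obtain z where z: "kron_fract w e z" using Fz by blast
    then have "z \<in> F'" by (rule F'I[OF _ e])
    then obtain a b where ab: "const_fract.ev b t' \<noteq> 0" "z = const_fract.ev a t' / const_fract.ev b t'" using t'(3) by blast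
    \<comment> \<open>The equation between z and t' is lifted by injectivity: the corresponding
      element of \<open>F\<close> is sent to zero, hence is zero.\<close>
    have "kron_fract w (e * ev b t + - ev a t) (z * const_fract.ev b t' + - const_fract.ev a t')"
      by (intro kron_fract_add kron_fract_mult kron_fract_uminus kron_fract_ev z t)
    then have "kron_fract w (e * ev b t + - ev a t) 0" using ab by simp
    moreover have "e * ev b t + - ev a t \<in> F"
      using ev_mem[OF F.is_subfield kF t(1)] e by (intro F.add_mem F.mult_mem F.uminus_mem) auto
    ultimately have "e * ev b t + - ev a t = 0" using inj FE by blast
    moreover have "ev b t \<noteq> 0"
    proof
      assume "ev b t = 0"
      then have "const_fract.ev b t' = 0" using kron_fract_unique[OF kron_fract_ev[OF t(2), of b]] kron_fract_0 by simp
      with ab(1) show False by contradiction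
    qed
    ultimately have "e = ev a t / ev b t" by (simp add: field_simps)
    then show "e \<in> t.simple_ext" using \<open>ev b t \<noteq> 0\<close> unfolding t.simple_ext_def by blast
  qed
  then show ?thesis using that t(1) tk by (simp add: F_def)
qed

end

section \<open>Transcendence degree\<close>

definition exps_le :: "nat \<Rightarrow> nat \<Rightarrow> (nat \<Rightarrow> nat) set" where
  "exps_le n e = {\<alpha> \<in> exps n. \<forall>i<n. \<alpha> i \<le> e}"

lemma card_exps_le: "finite (exps_le n e)" "card (exps_le n e) = Suc e ^ n"
proof -
  define f where "f \<alpha> = restrict \<alpha> {..<n}" for \<alpha> :: "nat \<Rightarrow> nat"
  have bij: "bij_betw f (exps_le n e) ({..<n} \<rightarrow>\<^sub>E {..e})"
  proof (rule bij_betw_byWitness[where f' = "\<lambda>\<alpha> i. if i < n then \<alpha> i else 0"])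
    show "\<forall>a\<in>exps_le n e. (\<lambda>i. if i < n then f a i else 0) = a"
      by (auto simp: f_def exps_le_def exps_def)
    show "\<forall>a'\<in>{..<n} \<rightarrow>\<^sub>E {..e}. f (\<lambda>i. if i < n then a' i else 0) = a'"
      by (auto simp: f_def restrict_def PiE_def extensional_def fun_eq_iff)
  qed (auto simp: f_def exps_le_def exps_def PiE_def Pi_def)
  have fin: "finite ({..<n} \<rightarrow>\<^sub>E {..e})" by (intro finite_PiE) auto
  show "finite (exps_le n e)" using bij_betw_finite[OF bij] fin by simp
  show "card (exps_le n e) = Suc e ^ n" using bij_betw_same_card[OF bij] by (simp add: card_PiE)
qed

section \<open>Counting monomials to bound the transcendence degree\<close>

context generators
begin

sublocale vs: vector_space "\<lambda>a v. iota a * v"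
  by unfold_locales (simp_all add: algebra_simps hom_add hom_mult)

definition bounded_span :: "nat \<Rightarrow> 'l set" where
  "bounded_span e = vs.span (monomial ` exps_le n e)"

lemma bounded_span_subset: "a \<le> b \<Longrightarrow> bounded_span a \<subseteq> bounded_span b"
  unfolding bounded_span_def by (intro vs.span_mono image_mono) (auto simp: exps_le_def)

lemma monomial_add: "monomial (\<lambda>i. \<alpha> i + \<beta> i) = monomial \<alpha> * monomial \<beta>"
  by (simp add: monomial_def power_add prod.distrib)

lemma bounded_span_mult:
  assumes "p \<in> bounded_span a" "q \<in> bounded_span b"
  shows "p * q \<in> bounded_span (a + b)"
proof -
  have sub1: "vs.subspace {q. r * q \<in> bounded_span c}" and sub2: "vs.subspace {q. q * r \<in> bounded_span c}" for r c
    unfolding vs.subspace_def bounded_span_def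
    by (auto simp: distrib_left distrib_right vs.span_zero mult.left_commute[of r] mult.assoc
        intro: vs.span_add vs.span_scale)
  have base: "monomial \<alpha> * monomial \<beta> \<in> bounded_span (a + b)" if "\<alpha> \<in> exps_le n a" "\<beta> \<in> exps_le n b" for \<alpha> \<beta>
  proof -
    have "(\<lambda>i. \<alpha> i + \<beta> i) \<in> exps_le n (a + b)" using that by (auto simp: exps_le_def exps_def add_mono)
    then show ?thesis unfolding bounded_span_def by (intro vs.span_base) (auto simp: monomial_add[symmetric])
  qed
  have 1: "monomial \<alpha> * q \<in> bounded_span (a + b)" if "\<alpha> \<in> exps_le n a" for \<alpha>
    using assms(2)[unfolded bounded_span_def]
    by (induction rule: vs.span_induct) (use sub1 base that in auto)
  show ?thesis using assms(1)[unfolded bounded_span_def]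
    by (induction rule: vs.span_induct) (use sub2 1 in auto)
qed

lemma bounded_span_const: "iota a \<in> bounded_span e"
proof -
  have "iota a * monomial (\<lambda>_. 0) \<in> bounded_span e"
    unfolding bounded_span_def by (intro vs.span_scale vs.span_base imageI) (auto simp: exps_le_def exps_def)
  then show ?thesis by (simp add: monomial_def)
qed

lemma bounded_span_1: "1 \<in> bounded_span e" using bounded_span_const[of 1] by simp

lemma bounded_span_power: "p \<in> bounded_span e \<Longrightarrow> p ^ k \<in> bounded_span (k * e)"
  by (induction k) (auto intro: bounded_span_1 bounded_span_mult)

lemma bounded_span_prod: "(\<And>j. j < d \<Longrightarrow> f j \<in> bounded_span e) \<Longrightarrow> (\<Prod>j<d. f j) \<in> bounded_span (d * e)" for d :: nat
  by (induction d) (auto intro: bounded_span_1 bounded_span_mult simp: add.commute mult.commute)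

lemma kron_imp_bounded_span: "kron w p p' \<Longrightarrow> \<exists>e. p \<in> bounded_span e"
proof (induction rule: kron.induct)
  case (kron_const a)
  then show ?case using bounded_span_const by blast
next
  case (kron_add p p' q q')
  then obtain a b where "p \<in> bounded_span a" "q \<in> bounded_span b" by blast
  then have "p \<in> bounded_span (max a b)" "q \<in> bounded_span (max a b)"
    using bounded_span_subset[of a "max a b"] bounded_span_subset[of b "max a b"] by auto
  then have "p + q \<in> bounded_span (max a b)" unfolding bounded_span_def by (rule vs.span_add)
  then show ?case by blast
next
  case (kron_var_mult i p p')
  then obtain e where e: "p \<in> bounded_span e" by blast
  have "(\<lambda>j. if j = i then 1 else 0) \<in> exps_le n 1" using kron_var_mult(1) by (auto simp: exps_le_def exps_def)
  moreover have "monomial (\<lambda>j. if j = i then 1 else 0) = x i"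
    using kron_var_mult(1) by (simp add: monomial_def if_distrib[of "power _"] prod.delta cong: if_cong)
  ultimately have "x i \<in> bounded_span 1" unfolding bounded_span_def by (metis image_eqI vs.span_base)
  then show ?case using bounded_span_mult e by blast
qed

text \<open>The \<open>(N+1)^d\<close> monomials of degree at most \<open>N\<close> in each \<open>y i\<close> lie, up to a common denominator,
  in a space of dimension \<open>O(N^n)\<close>.\<close>
theorem not_alg_indep:
  assumes y: "\<And>i. i < d \<Longrightarrow> y i \<in> gen_quot" and "n < d"
  shows "\<not> alg_indep (range iota) y d"
proof
  assume indep: "alg_indep (range iota) y d"
  have "\<forall>i. \<exists>pq. i < d \<longrightarrow> fst pq \<in> gen_ring \<and> snd pq \<in> gen_ring \<and> snd pq \<noteq> 0 \<and> y i = fst pq / snd pq"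
    using y unfolding gen_quot_def by fastforce
  from choice[OF this] obtain f where f: "\<And>i. i < d \<Longrightarrow> fst (f i) \<in> gen_ring"
    "\<And>i. i < d \<Longrightarrow> snd (f i) \<in> gen_ring" "\<And>i. i < d \<Longrightarrow> snd (f i) \<noteq> 0"
    "\<And>i. i < d \<Longrightarrow> y i = fst (f i) / snd (f i)" by blast
  have "\<forall>i. \<exists>e. i < d \<longrightarrow> fst (f i) \<in> bounded_span e \<and> snd (f i) \<in> bounded_span e"
  proof safe
    fix i
    show "\<exists>e. i < d \<longrightarrow> fst (f i) \<in> bounded_span e \<and> snd (f i) \<in> bounded_span e"
    proof (cases "i < d")
      case True
      obtain a b where "fst (f i) \<in> bounded_span a" "snd (f i) \<in> bounded_span b"
        using f(1,2)[OF True] kron_imp_bounded_span unfolding gen_ring_def by blast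
      then have "fst (f i) \<in> bounded_span (max a b)" "snd (f i) \<in> bounded_span (max a b)"
        using bounded_span_subset[of a "max a b"] bounded_span_subset[of b "max a b"] by auto
      then show ?thesis by blast
    qed simp
  qed
  from choice[OF this] obtain g where g: "\<And>i. i < d \<Longrightarrow> fst (f i) \<in> bounded_span (g i) \<and> snd (f i) \<in> bounded_span (g i)"
    by blast
  define e where "e = (\<Sum>i<d. g i)"
  have "g i \<le> e" if "i < d" for i unfolding e_def using that by (intro member_le_sum) auto
  then have e: "fst (f i) \<in> bounded_span e" "snd (f i) \<in> bounded_span e" if "i < d" for i
    using g[OF that] bounded_span_subset[of "g i" e] that by auto

  \<comment> \<open>The choice yields (d N e + 1)^n \<le> (N + 1)^n (d e + 1)^n = (N + 1)^n N < (N +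
    1)^(n + 1) \<le> (N + 1)^d, so there are more monomials in \<open>y\<close> than the dimension
    allows.\<close>
  define N where "N = Suc (d * e) ^ n"
  define V where "V = (\<Prod>j<d. snd (f j) ^ N)"
  define u where "u \<beta> = V * (\<Prod>j<d. y j ^ \<beta> j)" for \<beta> :: "nat \<Rightarrow> nat"
  have V0: "V \<noteq> 0" using f(3) by (simp add: V_def)
  have u_bounded_span: "u \<beta> \<in> bounded_span (d * (N * e))" if \<beta>: "\<beta> \<in> exps_le d N" for \<beta>
  proof -
    have *: "snd (f j) ^ N * y j ^ \<beta> j = fst (f j) ^ \<beta> j * snd (f j) ^ (N - \<beta> j)" if "j < d" for j
    proof -
      have "\<beta> j \<le> N" using \<beta> that by (simp add: exps_le_def)
      then have "snd (f j) ^ N = snd (f j) ^ \<beta> j * snd (f j) ^ (N - \<beta> j)" by (simp flip: power_add)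
      then show ?thesis using f(3)[OF that] by (subst f(4)[OF that]) (simp add: power_divide)
    qed
    have "u \<beta> = (\<Prod>j<d. fst (f j) ^ \<beta> j * snd (f j) ^ (N - \<beta> j))"
      unfolding u_def V_def prod.distrib[symmetric] by (intro prod.cong) (auto simp: *)
    also have "\<dots> \<in> bounded_span (d * (N * e))"
    proof (rule bounded_span_prod)
      fix j assume j: "j < d"
      have "\<beta> j * e + (N - \<beta> j) * e = N * e" using \<beta> j
        by (simp add: exps_le_def flip: add_mult_distrib)
      then show "fst (f j) ^ \<beta> j * snd (f j) ^ (N - \<beta> j) \<in> bounded_span (N * e)"
        using bounded_span_mult[OF bounded_span_power[OF e(1)[OF j]] bounded_span_power[OF e(2)[OF j]], of "\<beta> j" "N - \<beta> j"] by simp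
    qed
    finally show ?thesis .
  qed
  have lin: "c \<beta> = 0" if "B \<subseteq> exps_le d N" "(\<Sum>\<beta>\<in>B. iota (c \<beta>) * u \<beta>) = 0" "\<beta> \<in> B" for B c \<beta>
  proof -
    have "V * (\<Sum>\<beta>\<in>B. iota (c \<beta>) * (\<Prod>j<d. y j ^ \<beta> j)) = 0"
      using that(2) by (simp add: u_def sum_distrib_left mult.left_commute)
    then have "(\<Sum>\<beta>\<in>B. iota (c \<beta>) * (\<Prod>j<d. y j ^ \<beta> j)) = 0" using V0 by simp
    moreover have "finite B" using that(1) card_exps_le(1) by (rule finite_subset)
    moreover have "\<forall>\<alpha>\<in>B. \<forall>i. d \<le> i \<longrightarrow> \<alpha> i = 0" using that(1) unfolding exps_le_def exps_def by blast
    ultimately have "\<forall>\<alpha>\<in>B. iota (c \<alpha>) = 0"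
      using spec[OF spec[OF indep[unfolded alg_indep_def], of B], of "\<lambda>\<alpha>. iota (c \<alpha>)"] by blast
    then show ?thesis using that(3) by simp
  qed
  \<comment> \<open>The count needs distinct values for distinct exponents; two equal values would
    satisfy a relation with coefficients 1 and -1.\<close>
  have inj: "inj_on u (exps_le d N)"
  proof (rule inj_onI, rule ccontr)
    fix \<beta> \<gamma> assume *: "\<beta> \<in> exps_le d N" "\<gamma> \<in> exps_le d N" "u \<beta> = u \<gamma>" "\<beta> \<noteq> \<gamma>"
    have "(if \<beta> = \<beta> then 1 else - 1 :: 'k) = 0"
      by (rule lin[of "{\<beta>, \<gamma>}" "\<lambda>\<delta>. if \<delta> = \<beta> then 1 else - 1"])
         (use * in \<open>auto simp: hom_uminus\<close>)
    then show False by simp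
  qed
  have "vs.independent (u ` exps_le d N)"
  proof (rule vs.independent_if_scalars_zero)
    fix c v assume c: "(\<Sum>v\<in>u ` exps_le d N. iota (c v) * v) = 0" "v \<in> u ` exps_le d N"
    then obtain \<beta> where "\<beta> \<in> exps_le d N" "v = u \<beta>" by blast
    then show "c v = 0" using lin[of "exps_le d N" "\<lambda>\<beta>. c (u \<beta>)" \<beta>] c(1) by (simp add: sum.reindex[OF inj])
  qed (simp add: card_exps_le)
  moreover have "u ` exps_le d N \<subseteq> vs.span (monomial ` exps_le n (d * (N * e)))" using u_bounded_span by (auto simp: bounded_span_def)
  ultimately have "card (u ` exps_le d N) \<le> card (monomial ` exps_le n (d * (N * e)))"
    using vs.independent_span_bound[of "monomial ` exps_le n (d * (N * e))" "u ` exps_le d N"] card_exps_le(1) by auto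
  also have "\<dots> \<le> Suc (d * (N * e)) ^ n" using card_image_le[OF card_exps_le(1)] card_exps_le(2) by metis
  also have "card (u ` exps_le d N) = Suc N ^ d" using inj by (simp add: card_image card_exps_le)
  also have "Suc (d * (N * e)) ^ n \<le> (Suc N * Suc (d * e)) ^ n" by (intro power_mono) auto
  also have "\<dots> = Suc N ^ n * N" by (simp only: power_mult_distrib N_def)
  also have "\<dots> < Suc N ^ n * Suc N" by simp
  also have "\<dots> = Suc N ^ Suc n" by simp
  also have "\<dots> \<le> Suc N ^ d" using \<open>n < d\<close> by (intro power_increasing) auto
  finally show False by simp
qed

text \<open>\<open>GREATEST\<close> is meaningful only for a nonempty bounded set of lengths: the
  empty family is independent, and \<open>not_alg_indep\<close> bounds the length by the number of
  generators.\<close>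

lemma trdeg_bound:
  assumes "E \<subseteq> gen_quot"
  shows "\<exists>y. (\<forall>i<trdeg (range iota) E. y i \<in> E) \<and> alg_indep (range iota) y (trdeg (range iota) E)"
    and "(\<forall>i<d. y i \<in> E) \<Longrightarrow> alg_indep (range iota) y d \<Longrightarrow> d \<le> trdeg (range iota) E"
    and "trdeg (range iota) E \<le> n"
proof -
  define P where "P d \<longleftrightarrow> (\<exists>y. (\<forall>i<d. y i \<in> E) \<and> alg_indep (range iota) y d)" for d
  have t: "trdeg (range iota) E = Greatest P" by (simp add: trdeg_def P_def[abs_def])
  have "alg_indep (range iota) y 0" for y
    unfolding alg_indep_def
  proof (intro allI impI, elim conjE)
    fix Q :: "(nat \<Rightarrow> nat) set" and c
    assume *: "\<forall>\<alpha>\<in>Q. \<forall>i\<ge>0. \<alpha> i = 0" "(\<Sum>\<alpha>\<in>Q. c \<alpha> * (\<Prod>i<0. y i ^ \<alpha> i)) = 0"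
    then have "Q \<subseteq> {\<lambda>_. 0}" by auto
    then have "Q = {} \<or> Q = {\<lambda>_. 0}" by blast
    then show "\<forall>\<alpha>\<in>Q. c \<alpha> = 0" using *(2) by auto
  qed
  then have "P 0" by (simp add: P_def)
  have bound: "d \<le> n" if "P d" for d
  proof (rule ccontr)
    assume "\<not> d \<le> n"
    from that obtain y where "\<forall>i<d. y i \<in> E" "alg_indep (range iota) y d" unfolding P_def by blast
    then show False using not_alg_indep[of d y] assms \<open>\<not> d \<le> n\<close> by auto
  qed
  have "P (Greatest P)" using GreatestI_nat[of P 0 n] \<open>P 0\<close> bound by blast
  then show "\<exists>y. (\<forall>i<trdeg (range iota) E. y i \<in> E) \<and> alg_indep (range iota) y (trdeg (range iota) E)"
    and "trdeg (range iota) E \<le> n"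
    using bound unfolding t by (simp_all add: P_def)
  show "d \<le> trdeg (range iota) E" if "\<forall>i<d. y i \<in> E" "alg_indep (range iota) y d" for d y
    unfolding t by (rule Greatest_le_nat[of P d n]) (use that bound in \<open>auto simp: P_def\<close>)
qed

end

lemma exps_1_eq: "\<alpha> \<in> exps 1 \<Longrightarrow> \<beta> \<in> exps 1 \<Longrightarrow> \<alpha> 0 = \<beta> 0 \<Longrightarrow> \<alpha> = \<beta>"
  by (rule ext) (metis (mono_tags, lifting) One_nat_def exps_def mem_Collect_eq not_less_eq_eq le0 le_zero_eq)

lemma exps_2_eq: "\<alpha> \<in> exps 2 \<Longrightarrow> \<beta> \<in> exps 2 \<Longrightarrow> \<alpha> 0 = \<beta> 0 \<Longrightarrow> \<alpha> 1 = \<beta> 1 \<Longrightarrow> \<alpha> = \<beta>"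
proof (rule ext)
  fix i :: nat assume *: "\<alpha> \<in> exps 2" "\<beta> \<in> exps 2" "\<alpha> 0 = \<beta> 0" "\<alpha> 1 = \<beta> 1"
  consider "i = 0" | "i = 1" | "2 \<le> i" by linarith
  then show "\<alpha> i = \<beta> i" using * by cases (auto simp: exps_def)
qed

context field_homo
begin

lemma not_alg_indep_witness:
  assumes "\<not> alg_indep (range h) y d"
  obtains P c \<alpha>0 where "finite P" "P \<subseteq> exps d" "\<alpha>0 \<in> P" "c \<alpha>0 \<noteq> 0"
    "(\<Sum>\<alpha>\<in>P. h (c \<alpha>) * (\<Prod>i<d. y i ^ \<alpha> i)) = 0"
proof -
  obtain P c \<alpha>0 where *: "finite P" "\<forall>\<alpha>\<in>P. \<forall>i. d \<le> i \<longrightarrow> \<alpha> i = 0" "\<forall>\<alpha>\<in>P. c \<alpha> \<in> range h"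
    "(\<Sum>\<alpha>\<in>P. c \<alpha> * (\<Prod>i<d. y i ^ \<alpha> i)) = 0" "\<alpha>0 \<in> P" "c \<alpha>0 \<noteq> 0"
    using assms unfolding alg_indep_def by blast
  define c' where "c' \<alpha> = inv h (c \<alpha>)" for \<alpha>
  have c': "h (c' \<alpha>) = c \<alpha>" if "\<alpha> \<in> P" for \<alpha>
    unfolding c'_def using *(3) that by (intro f_inv_into_f) auto
  show ?thesis
  proof (rule that[of P \<alpha>0 c'])
    show "(\<Sum>\<alpha>\<in>P. h (c' \<alpha>) * (\<Prod>i<d. y i ^ \<alpha> i)) = 0"
      using *(4) c' by (simp cong: sum.cong)
    show "c' \<alpha>0 \<noteq> 0" using c'[OF *(5)] *(6) by auto
  qed (use * in \<open>auto simp: exps_def\<close>)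
qed

lemma not_alg_indep_1:
  assumes "\<not> alg_indep (range h) y 1"
  shows "\<exists>p. p \<noteq> 0 \<and> ev p (y 0) = 0"
proof -
  from not_alg_indep_witness[OF assms] obtain P c \<alpha>0 where P: "finite P" "P \<subseteq> exps 1" "\<alpha>0 \<in> P"
    "c \<alpha>0 \<noteq> 0" "(\<Sum>\<alpha>\<in>P. h (c \<alpha>) * (\<Prod>i<1. y i ^ \<alpha> i)) = 0" .
  define p where "p = (\<Sum>\<alpha>\<in>P. monom (c \<alpha>) (\<alpha> 0))"
  have "coeff p (\<alpha>0 0) = (\<Sum>\<alpha>\<in>P. if \<alpha> = \<alpha>0 then c \<alpha> else 0)"
    unfolding p_def coeff_sum coeff_monom using P(2,3) exps_1_eq[of _ \<alpha>0]
    by (intro sum.cong) (auto simp: subset_iff)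
  then have "p \<noteq> 0" using P(1,3,4) by auto
  moreover have "ev p (y 0) = 0" using P(5) by (simp add: p_def ev_sum ev_monom)
  ultimately show ?thesis by blast
qed

text \<open>The relation is ordered by powers of \<open>y 1\<close> with coefficients in K[y 0],
  since its lowest coefficient is what is used later.\<close>

lemma not_alg_indep_2:
  assumes "\<not> alg_indep (range h) y 2"
  shows "\<exists>p. p \<noteq> 0 \<and> ring_homo.ev (\<lambda>C. ev C (y 0)) p (y 1) = 0"
proof -
  interpret ev2: ring_homo "\<lambda>C. ev C (y 0)" by (rule ring_homo_ev)
  from not_alg_indep_witness[OF assms] obtain P c \<alpha>0 where P: "finite P" "P \<subseteq> exps 2" "\<alpha>0 \<in> P"
    "c \<alpha>0 \<noteq> 0" "(\<Sum>\<alpha>\<in>P. h (c \<alpha>) * (\<Prod>i<2. y i ^ \<alpha> i)) = 0" .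
  define p where "p = (\<Sum>\<alpha>\<in>P. monom (monom (c \<alpha>) (\<alpha> 0)) (\<alpha> 1))"
  have "coeff (coeff p (\<alpha>0 1)) (\<alpha>0 0) = (\<Sum>\<alpha>\<in>P. if \<alpha> = \<alpha>0 then c \<alpha> else 0)"
    unfolding p_def coeff_sum coeff_monom using P(2,3) exps_2_eq[of _ \<alpha>0]
    by (intro sum.cong) (auto simp: subset_iff)
  then have "p \<noteq> 0" using P(1,3,4) by auto
  moreover have "ev2.ev p (y 1) = 0"
    using P(5) by (simp add: p_def ev_sum ev_monom ev2.ev_sum ev2.ev_monom lessThan_nat_numeral
        lessThan_Suc numeral_2_eq_2 mult_ac)
  ultimately show ?thesis by blast
qed

lemma alg_indep_1:
  assumes "\<And>p. ev p t = 0 \<Longrightarrow> p = 0"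
  shows "alg_indep (range h) (\<lambda>_. t) 1"
  unfolding alg_indep_def
proof (intro allI impI, elim conjE)
  fix P :: "(nat \<Rightarrow> nat) set" and c
  assume P: "finite P" "\<forall>\<alpha>\<in>P. \<forall>i\<ge>1. \<alpha> i = 0" "\<forall>\<alpha>\<in>P. c \<alpha> \<in> range h"
    "(\<Sum>\<alpha>\<in>P. c \<alpha> * (\<Prod>i<1. t ^ \<alpha> i)) = 0"
  define c' where "c' \<alpha> = inv h (c \<alpha>)" for \<alpha>
  have c': "h (c' \<alpha>) = c \<alpha>" if "\<alpha> \<in> P" for \<alpha>
    unfolding c'_def using P(3) that by (intro f_inv_into_f) auto
  define p where "p = (\<Sum>\<alpha>\<in>P. monom (c' \<alpha>) (\<alpha> 0))"
  have "ev p t = 0" using P(4) c' by (simp add: p_def ev_sum ev_monom cong: sum.cong)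
  then have "p = 0" by (rule assms)
  show "\<forall>\<alpha>\<in>P. c \<alpha> = 0"
  proof
    fix \<alpha>0 assume \<alpha>0: "\<alpha>0 \<in> P"
    have "P \<subseteq> exps 1" using P(2) by (auto simp: exps_def)
    then have "coeff p (\<alpha>0 0) = (\<Sum>\<alpha>\<in>P. if \<alpha> = \<alpha>0 then c' \<alpha> else 0)"
      unfolding p_def coeff_sum coeff_monom using \<alpha>0 exps_1_eq[of _ \<alpha>0]
      by (intro sum.cong) (auto simp: subset_iff)
    then have "c' \<alpha>0 = 0" using \<open>p = 0\<close> P(1) \<alpha>0 by simp
    then show "c \<alpha>0 = 0" using c'[OF \<alpha>0] by simp
  qed
qed

end

context rational_functions
begin

lemma trdeg_0D:
  assumes "trdeg (range iota) E = 0" "e \<in> E"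
  shows "e \<in> range iota"
proof -
  have "\<not> alg_indep (range iota) (\<lambda>_. e) 1"
    using trdeg_bound(2)[of E 1 "\<lambda>_. e"] assms gen_quot_UNIV by auto
  then show ?thesis using not_alg_indep_1 algebraic_imp_const by blast
qed

lemma trdeg_1D:
  assumes "trdeg (range iota) E = 1" "y \<in> E" "e \<in> E"
  shows "\<exists>P. P \<noteq> 0 \<and> ring_homo.ev (\<lambda>C. ev C y) P e = 0"
proof -
  define f where "f i = (if i = 0 then y else e)" for i :: nat
  have "\<forall>i<2. f i \<in> E" using assms by (simp add: f_def)
  then have "\<not> alg_indep (range iota) f 2"
    using trdeg_bound(2)[of E 2 f] assms(1) gen_quot_UNIV by auto
  from not_alg_indep_2[OF this] show ?thesis by (simp add: f_def)
qed

text \<open>\<open>t\<close> alone is taken as the family of generators, so that the general bound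
  by their number gives the upper estimate.\<close>

lemma trdeg_eq_1I:
  assumes "t \<in> E" "t \<notin> range iota" "E \<subseteq> generators.gen_quot iota (\<lambda>_. t) 1"
  shows "trdeg (range iota) E = 1"
proof -
  interpret t: generators iota "\<lambda>_. t" 1 by unfold_locales
  interpret tt: transcendental iota t using assms(2) by (simp add: transcendental_iff)
  have "alg_indep (range iota) (\<lambda>_. t) 1" by (rule alg_indep_1) (rule tt.transcendental)
  then have "1 \<le> trdeg (range iota) E"
    using t.trdeg_bound(2)[OF assms(3), of 1 "\<lambda>_. t"] assms(1) by simp
  with t.trdeg_bound(3)[OF assms(3)] show ?thesis by simp
qed

end

section \<open>Essential dimension of the special linear group\<close>

lemma dedekind_independence:
  fixes \<tau> :: "'i \<Rightarrow> 'a::field \<Rightarrow> 'b::field"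
  assumes "finite I" "\<And>i. i \<in> I \<Longrightarrow> field_homo (\<tau> i)" "inj_on \<tau> I"
    and "\<And>f. (\<Sum>i\<in>I. c i * \<tau> i f) = 0" "j \<in> I"
  shows "c j = 0"
  using assms
proof (induction I arbitrary: c j rule: finite_induct)
  case (insert k I)
  have mult: "\<tau> i (u * f) = \<tau> i u * \<tau> i f" if "i \<in> insert k I" for i u f
  proof -
    interpret field_homo "\<tau> i" using insert.prems(1)[OF that] .
    show ?thesis by (rule hom_mult)
  qed
  have zero: "c i = 0" if i: "i \<in> I" for i
  proof -
    \<comment> \<open>The relation at u f minus \<tau> k u times the relation at f has no term for
      k, so the induction hypothesis applies to it.\<close>
    have "c i * (\<tau> i u - \<tau> k u) = 0" for u
    proof (rule insert.IH[OF _ _ _ i])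
      fix f
      have "(\<Sum>i\<in>I. c i * (\<tau> i u - \<tau> k u) * \<tau> i f) =
          (\<Sum>i\<in>insert k I. c i * (\<tau> i u - \<tau> k u) * \<tau> i f)"
        using insert.hyps by simp
      also have "\<dots> = (\<Sum>i\<in>insert k I. c i * \<tau> i (u * f) - \<tau> k u * (c i * \<tau> i f))"
        by (intro sum.cong refl) (simp add: mult algebra_simps)
      also have "\<dots> = 0"
        by (simp only: sum_subtractf sum_distrib_left[symmetric] insert.prems(3) mult_zero_right diff_zero)
      finally show "(\<Sum>i\<in>I. c i * (\<tau> i u - \<tau> k u) * \<tau> i f) = 0" .
    qed (use insert.prems in auto)
    moreover have "\<tau> i \<noteq> \<tau> k" using insert.prems(2) i insert.hyps(2) by (auto simp: inj_on_def)
    then obtain u where "\<tau> i u \<noteq> \<tau> k u" by (auto simp: fun_eq_iff)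
    ultimately show ?thesis by (metis mult_eq_0_iff right_minus_eq)
  qed
  then have "(\<Sum>i\<in>insert k I. c i * \<tau> i 1) = c k * \<tau> k 1" using insert.hyps by simp
  moreover have "\<tau> k 1 = 1" using insert.prems(1)[of k] by (simp add: field_homo_def ring_homo_def)
  ultimately have "c k = 0" using insert.prems(3)[of 1] by simp
  then show ?case using zero insert.prems(4) by blast
qed simp

section \<open>Matrices in SL_2\<close>

definition mk_mat :: "'f \<Rightarrow> 'f \<Rightarrow> 'f \<Rightarrow> 'f \<Rightarrow> 'f ^ 2 ^ 2" where
  "mk_mat a b c d = (\<chi> i j. if i = 1 then if j = 1 then a else b else if j = 1 then c else d)"

lemma mk_mat_entries [simp]:
  "mk_mat a b c d $ 1 $ 1 = a" "mk_mat a b c d $ 1 $ 2 = b"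
  "mk_mat a b c d $ 2 $ 1 = c" "mk_mat a b c d $ 2 $ 2 = d"
  by (simp_all add: mk_mat_def)

lemma mat_eq_2_iff: "A = B \<longleftrightarrow> A $ 1 $ 1 = B $ 1 $ 1 \<and> A $ 1 $ 2 = B $ 1 $ 2 \<and>
    A $ 2 $ 1 = B $ 2 $ 1 \<and> A $ 2 $ 2 = B $ 2 $ 2"
  for A B :: "'f ^ 2 ^ 2"
  by (auto simp: vec_eq_iff forall_2)

lemma mult_entries_2: "(A ** B) $ i $ j = A $ i $ 1 * B $ 1 $ j + A $ i $ 2 * B $ 2 $ j"
  for A B :: "'f::semiring_1 ^ 2 ^ 2"
  by (simp add: matrix_matrix_mult_def sum_2)

lemma mat_1_entries [simp]:
  "(mat 1 :: 'f::semiring_1 ^ 2 ^ 2) $ 1 $ 1 = 1" "(mat 1 :: 'f ^ 2 ^ 2) $ 1 $ 2 = 0"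
  "(mat 1 :: 'f ^ 2 ^ 2) $ 2 $ 1 = 0" "(mat 1 :: 'f ^ 2 ^ 2) $ 2 $ 2 = 1"
  by (simp_all add: mat_def)

lemma SL2_iff: "A \<in> SL2 \<longleftrightarrow> A $ 1 $ 1 * A $ 2 $ 2 - A $ 1 $ 2 * A $ 2 $ 1 = 1"
  by (simp add: SL2_def det_2)

definition SL2_inv :: "'f::field ^ 2 ^ 2 \<Rightarrow> 'f ^ 2 ^ 2" where
  "SL2_inv A = mk_mat (A $ 2 $ 2) (- A $ 1 $ 2) (- A $ 2 $ 1) (A $ 1 $ 1)"

lemma SL2_inv: "A \<in> SL2 \<Longrightarrow> SL2_inv A \<in> SL2"
  "A \<in> SL2 \<Longrightarrow> A ** SL2_inv A = mat 1" "A \<in> SL2 \<Longrightarrow> SL2_inv A ** A = mat 1"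
  by (simp_all add: SL2_iff mat_eq_2_iff mult_entries_2 SL2_inv_def algebra_simps)

lemma SL2_mult: "A \<in> SL2 \<Longrightarrow> B \<in> SL2 \<Longrightarrow> A ** B \<in> SL2"
  by (simp add: SL2_def det_mul)

lemma mat_1_SL2: "mat 1 \<in> SL2"
  by (simp add: SL2_def)

definition Umat :: "'f::field \<Rightarrow> 'f ^ 2 ^ 2" where "Umat b = mk_mat 1 b 0 1"
definition Tmat :: "'f::field \<Rightarrow> 'f ^ 2 ^ 2" where "Tmat a = mk_mat a 0 0 (inverse a)"

lemma Umat_SL2: "Umat b \<in> SL2" by (simp add: SL2_iff Umat_def)
lemma Tmat_SL2: "a \<noteq> 0 \<Longrightarrow> Tmat a \<in> SL2" by (simp add: SL2_iff Tmat_def)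
lemma Umat_mult: "Umat b ** Umat c = Umat (b + c)"
  by (simp add: Umat_def mat_eq_2_iff mult_entries_2 add.commute)
text \<open>Conjugation by the torus multiplies the unipotent entry by a square. The form with
  \<open>inverse a\<close> fits \<open>ess_dim_1_imp_hom\<close>, where passing from group elements
  to matrices reverses products.\<close>

lemma Tmat_Umat: "a \<noteq> 0 \<Longrightarrow> Tmat (inverse a) ** Umat (a ^ 2 * b) = Umat b ** Tmat (inverse a)"
  by (simp add: Umat_def Tmat_def mat_eq_2_iff mult_entries_2 power2_eq_square field_simps)
lemma Umat_eq_1_iff: "Umat b = mat 1 \<longleftrightarrow> b = 0"
  by (simp add: Umat_def mat_eq_2_iff)

section \<open>Fractional linear transformations of t\<close>

context transcendental
begin

definition moebius :: "'k mat2 \<Rightarrow> 'l \<Rightarrow> 'l" where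
  "moebius A z = (h (m11 A) * z + h (m12 A)) / (h (m21 A) * z + h (m22 A))"

lemma moebius_mult:
  assumes "det2 B \<noteq> 0"
  shows "moebius A (moebius B t) = moebius (A * B) t"
proof -
  define p q where "p = h (m11 B) * t + h (m12 B)" and "q = h (m21 B) * t + h (m22 B)"
  have q: "q \<noteq> 0" unfolding q_def using assms by (intro linear_nonzero) (auto simp: det2_def)
  have "moebius A (p / q) = (h (m11 A) * p + h (m12 A) * q) / (h (m21 A) * p + h (m22 A) * q)"
  proof -
    have "h a * (p / q) + h b = (h a * p + h b * q) / q" for a b using q by (simp add: field_simps)
    then show ?thesis using q by (simp add: moebius_def)
  qed
  then show ?thesis by (simp add: moebius_def[of B] moebius_def[of "A * B"] p_def[symmetric] q_def[symmetric])
    (simp add: p_def q_def times_mat2_def hom_add hom_mult algebra_simps)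
qed

text \<open>Cross multiplication gives a quadratic polynomial vanishing at the transcendental t. Its
  outer coefficients make corresponding columns proportional, and the middle one identifies the two
  factors.\<close>

lemma moebius_eq:
  assumes "det2 A \<noteq> 0" "det2 B \<noteq> 0" "moebius A t = moebius B t"
  shows "\<exists>l. l \<noteq> 0 \<and> A = smul l B"
proof -
  obtain a b c d where A: "A = Mat2 a b c d" by (cases A)
  obtain a' b' c' d' where B: "B = Mat2 a' b' c' d'" by (cases B)
  have detA: "a * d - b * c \<noteq> 0" and detB: "a' * d' - b' * c' \<noteq> 0"
    using assms(1,2) by (simp_all add: A B det2_def)
  have "h c * t + h d \<noteq> 0" "h c' * t + h d' \<noteq> 0"
    using detA detB by (auto intro!: linear_nonzero)
  then have "(h a * t + h b) * (h c' * t + h d') = (h a' * t + h b') * (h c * t + h d)"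
    using assms(3) by (simp add: moebius_def A B frac_eq_eq)
  then have "h (a * c' - a' * c) * t ^ 2 + h (a * d' + b * c' - a' * d - b' * c) * t + h (b * d' - b' * d) = 0"
    by (simp add: hom_add hom_mult hom_diff power2_eq_square algebra_simps)
  from quadratic_zero[OF this] have eqs: "a * c' = a' * c" "a * d' + b * c' = a' * d + b' * c" "b * d' = b' * d"
    by (auto simp: algebra_simps)
  have proportional: "\<exists>l. u = l * u' \<and> v = l * v'" if "u * v' = u' * v" "u' \<noteq> 0 \<or> v' \<noteq> 0" for u v u' v' :: "'k"
  proof (cases "u' = 0")
    case True
    then show ?thesis using that by (intro exI[of _ "v / v'"]) auto
  next
    case False
    then show ?thesis using that by (intro exI[of _ "u / u'"]) (simp add: field_simps)
  qed
  have nz: "a' \<noteq> 0 \<or> c' \<noteq> 0" "b' \<noteq> 0 \<or> d' \<noteq> 0" using detB by auto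
  obtain l where l: "a = l * a'" "c = l * c'" using proportional[OF eqs(1) nz(1)] by blast
  obtain k where k: "b = k * b'" "d = k * d'" using proportional[OF eqs(3) nz(2)] by blast
  have "(l - k) * (a' * d' - b' * c') = 0" using eqs(2) by (simp add: l k algebra_simps)
  then have "l = k" using detB by simp
  then have "A = smul l B" by (simp add: A B smul_def l k)
  moreover from this have "l \<noteq> 0" using assms(1) by (auto simp: det2_smul)
  ultimately show ?thesis by blast
qed

lemma moebius_scalar: "l \<noteq> 0 \<Longrightarrow> moebius (smul l 1) t = t"
  by (simp add: moebius_def mat2_defs)

end

section \<open>The action of SL_2(F_q)\<close>

locale sl2_rep = rational_functions iota x n
  for iota :: "'k::field_gcd \<Rightarrow> 'l::field" and x :: "nat \<Rightarrow> 'l" and n :: nat +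
  fixes \<sigma> :: "'f::{finite,field} ^ 2 ^ 2 \<Rightarrow> 'l \<Rightarrow> 'l"
  assumes action_1: "\<sigma> (mat 1) = id"
    and action_mult: "g \<in> SL2 \<Longrightarrow> h \<in> SL2 \<Longrightarrow> \<sigma> (g ** h) = \<sigma> g \<circ> \<sigma> h"
    and action_hom: "g \<in> SL2 \<Longrightarrow> field_homo (\<sigma> g)"
    and action_const: "g \<in> SL2 \<Longrightarrow> \<sigma> g (iota a) = iota a"
    and action_faithful: "g \<in> SL2 \<Longrightarrow> (\<And>j. j < n \<Longrightarrow> \<sigma> g (x j) = x j) \<Longrightarrow> g = mat 1"
    and char_k: "(1::'k) + 1 = 0" and char_f: "(1::'f) + 1 = 0"
begin

abbreviation "G \<equiv> (SL2 :: ('f ^ 2 ^ 2) set)"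

lemma action_inv: "g \<in> G \<Longrightarrow> \<sigma> g (\<sigma> (SL2_inv g) e) = e"
  using action_mult[of g "SL2_inv g"] SL2_inv[of g] action_1 by (metis comp_apply id_apply)

text \<open>Reduces the stability of a generated subfield to its generators.\<close>

lemma action_preimage_subfield:
  assumes "g \<in> G" "is_subfield F"
  shows "is_subfield {e. \<sigma> g e \<in> F}"
proof -
  interpret s: field_homo "\<sigma> g" by (rule action_hom[OF assms(1)])
  interpret F: subfield F by unfold_locales fact
  show ?thesis
    by (auto simp: is_subfield_def s.hom_add s.hom_mult s.hom_uminus s.hom_inverse
        intro: F.add_mem F.mult_mem F.uminus_mem F.inverse_mem)
qed

text \<open>Ensures that the minimum in \<open>ess_dim\<close> is taken over a nonempty set and
  hence attained.\<close>

lemma ex_faithful: "faithful_G_subfield iota G \<sigma> UNIV"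
  unfolding faithful_G_subfield_def using action_faithful by (auto simp: is_subfield_def)

lemma ess_dim_1_imp_hom:
  assumes "ess_dim iota G \<sigma> = 1" and a0: "a0 \<noteq> 0" "a0 \<noteq> (1::'f)"
  shows "\<exists>\<phi> :: 'f \<Rightarrow> 'k. is_ring_hom \<phi>"
proof -
  define Q where "Q d \<longleftrightarrow> (\<exists>E. faithful_G_subfield iota G \<sigma> E \<and> trdeg (range iota) E = d)" for d
  have "Q (trdeg (range iota) UNIV)" using ex_faithful by (auto simp: Q_def)
  then have "Q (LEAST d. Q d)" by (rule LeastI)
  moreover have "(LEAST d. Q d) = 1" using assms(1) by (simp add: ess_dim_def Q_def)
  ultimately have "Q 1" by (simp only:)
  then obtain E where faithful: "faithful_G_subfield iota G \<sigma> E" and tr: "trdeg (range iota) E = 1"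
    unfolding Q_def by blast
  have E: "is_subfield E" "range iota \<subseteq> E" "\<And>g. g \<in> G \<Longrightarrow> \<sigma> g ` E \<subseteq> E"
    "\<And>g. g \<in> G \<Longrightarrow> (\<forall>e\<in>E. \<sigma> g e = e) \<Longrightarrow> g = mat 1"
    using faithful unfolding faithful_G_subfield_def by simp_all
  \<comment> \<open>\<open>mv g\<close> is an element of \<open>E\<close> moved by g. The union
    \<open>S\<close> of the orbits of these elements is finite and stable, and the group still acts
    faithfully on the field it generates.\<close>
  have "\<forall>g. \<exists>e. g \<in> G \<and> g \<noteq> mat 1 \<longrightarrow> e \<in> E \<and> \<sigma> g e \<noteq> e" using E(4) by blast
  from choice[OF this] obtain mv where mv: "\<And>g. g \<in> G \<Longrightarrow> g \<noteq> mat 1 \<Longrightarrow> mv g \<in> E"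
    "\<And>g. g \<in> G \<Longrightarrow> g \<noteq> mat 1 \<Longrightarrow> \<sigma> g (mv g) \<noteq> mv g" by blast
  define S where "S = (\<Union>h\<in>G. (\<lambda>g. \<sigma> h (mv g)) ` (G - {mat 1}))"
  have SI: "\<sigma> h (mv g) \<in> S" if "h \<in> G" "g \<in> G" "g \<noteq> mat 1" for g h
    unfolding S_def using that by (intro UN_I[of h] image_eqI[where x = g]) simp_all
  have SE: "\<exists>h\<in>G. \<exists>g\<in>G - {mat 1}. s = \<sigma> h (mv g)" if "s \<in> S" for s
    using that unfolding S_def UN_iff image_iff .
  have S: "finite S" "S \<subseteq> E"
  proof -
    show "finite S" unfolding S_def by (intro finite_UN_I finite_imageI finite)
    show "S \<subseteq> E"
    proof
      fix s assume "s \<in> S"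
      from SE[OF this] obtain h g where hg: "h \<in> G" "g \<in> G - {mat 1}" "s = \<sigma> h (mv g)"
        by (elim bexE)
      have "mv g \<in> E" using hg(2) by (intro mv(1)) simp_all
      from subsetD[OF E(3)[OF hg(1)] imageI[OF this]] show "s \<in> E" by (simp only: hg(3))
    qed
  qed
  have mvS: "mv g \<in> S" if "g \<in> G" "g \<noteq> mat 1" for g
  proof -
    have "mv g = \<sigma> (mat 1) (mv g)" by (simp add: action_1)
    with SI[OF mat_1_SL2 that] show ?thesis by (simp only:)
  qed
  have not_const: "e \<notin> range iota" if "g \<in> G" "\<sigma> g e \<noteq> e" for g e
    using that(2) action_const[OF that(1)] by (metis rangeE)
  \<comment> \<open>Any nontrivial group element will do: what it moves is a nonconstant element of
    \<open>S\<close>.\<close>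
  have U1: "Umat 1 \<in> G" "Umat (1::'f) \<noteq> mat 1" by (simp_all add: Umat_SL2 Umat_eq_1_iff)
  define e1 where "e1 = mv (Umat 1)"
  have e1: "e1 \<in> S" "e1 \<notin> range iota" "e1 \<in> E"
    unfolding e1_def using mvS[OF U1] not_const[OF U1(1) mv(2)[OF U1]] mv(1)[OF U1] by auto
  obtain t where t: "t \<in> gen_field S" "t \<notin> range iota" "gen_field S \<subseteq> transcendental.simple_ext iota t"
    using finitely_generated_luroth[OF E(1,2) e1(3,2) trdeg_1D[OF tr e1(3)] S e1(1,2)] .
  interpret t: transcendental iota t using t(2) by (simp add: transcendental_iff)
  have stable: "\<sigma> g e \<in> gen_field S" if "g \<in> G" "e \<in> gen_field S" for g e
  proof -
    have "gen_field S \<subseteq> {e. \<sigma> g e \<in> gen_field S}"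
    proof (rule gen_field_least)
      show "is_subfield {e. \<sigma> g e \<in> gen_field S}"
        by (rule action_preimage_subfield[OF that(1) is_subfield_gen_field])
      show "range iota \<subseteq> {e. \<sigma> g e \<in> gen_field S}"
        using action_const[OF that(1)] gen_field_gens(1) by auto
      have "\<sigma> g e \<in> S" if e: "e \<in> S" for e
      proof -
        obtain h k where hk: "h \<in> G" "k \<in> G - {mat 1}" "e = \<sigma> h (mv k)"
          using SE[OF e] by (elim bexE)
        then have "\<sigma> g e = \<sigma> (g ** h) (mv k)" using action_mult[OF \<open>g \<in> G\<close> hk(1)] by simp
        then show ?thesis using SI[OF SL2_mult[OF \<open>g \<in> G\<close> hk(1)], of k] hk(2) by simp
      qed
      then show "S \<subseteq> {e. \<sigma> g e \<in> gen_field S}" using gen_field_gens(2) by blast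
    qed
    then show ?thesis using that(2) by blast
  qed
  have ex: "\<exists>A. det2 A \<noteq> 0 \<and> \<sigma> g t = t.moebius A t" if g: "g \<in> G" for g
  proof -
    have "\<sigma> (SL2_inv g) t \<in> t.simple_ext" "\<sigma> g t \<in> t.simple_ext"
      using stable[OF SL2_inv(1)[OF g] t(1)] stable[OF g t(1)] t(3) by auto
    from t.automorphism_fractional_linear[OF action_hom[OF g] action_const[OF g] this(1) action_inv[OF g] this(2)]
    obtain a b c d where "\<sigma> g t = (iota a * t + iota b) / (iota c * t + iota d)" "a * d - b * c \<noteq> 0" .
    then show ?thesis by (intro exI[of _ "Mat2 a b c d"]) (simp add: t.moebius_def det2_def)
  qed
  then have "\<forall>g. \<exists>A. g \<in> G \<longrightarrow> det2 A \<noteq> 0 \<and> \<sigma> g t = t.moebius A t" by blast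
  from choice[OF this] obtain M where M: "\<And>g. g \<in> G \<Longrightarrow> det2 (M g) \<noteq> 0"
    "\<And>g. g \<in> G \<Longrightarrow> \<sigma> g t = t.moebius (M g) t" by blast
  \<comment> \<open>\<sigma> g fixes the coefficients of the fraction \<sigma> h t and acts on the t
    inside it, which reverses the order of the matrices.\<close>
  have M_mult: "\<exists>l. l \<noteq> 0 \<and> M (g ** h) = smul l (M h * M g)" if gh: "g \<in> G" "h \<in> G" for g h
  proof (rule t.moebius_eq)
    interpret s: field_homo "\<sigma> g" by (rule action_hom[OF gh(1)])
    have "\<sigma> g (t.moebius (M h) t) = t.moebius (M h) (\<sigma> g t)"
      by (simp add: t.moebius_def s.hom_divide s.hom_add s.hom_mult action_const[OF gh(1)])
    then show "t.moebius (M (g ** h)) t = t.moebius (M h * M g) t"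
      using M(2)[OF SL2_mult[OF gh]] M(2)[OF gh(1)] M(2)[OF gh(2)] action_mult[OF gh]
        t.moebius_mult[OF M(1)[OF gh(1)], of "M h"] by simp
    show "det2 (M (g ** h)) \<noteq> 0" by (rule M(1)[OF SL2_mult[OF gh]])
    show "det2 (M h * M g) \<noteq> 0" using M(1) gh by (simp add: det2_mult)
  qed
  \<comment> \<open>An element that fixes t fixes K(t), which contains \<open>mv g\<close>.\<close>
  have fixed: "g = mat 1" if g: "g \<in> G" "\<sigma> g t = t" for g
  proof (rule ccontr)
    assume ne: "g \<noteq> mat 1"
    interpret s: field_homo "\<sigma> g" by (rule action_hom[OF g(1)])
    have "mv g \<in> t.simple_ext" using mvS[OF g(1) ne] gen_field_gens(2)[of S] t(3) by blast
    then obtain a b where ab: "mv g = ev a t / ev b t" by (auto simp: t.simple_ext_def)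
    have "\<sigma> g (ev p t) = ev p t" for p
      using ev_comp[OF ring_homo_axioms s.ring_homo_axioms, of p t] g(2) action_const[OF g(1)] by simp
    then have "\<sigma> g (mv g) = mv g" by (simp add: ab s.hom_divide)
    then show False using mv(2)[OF g(1) ne] by contradiction
  qed
  show ?thesis
  proof (rule additive_projective_ring_hom[where A = "\<lambda>b. M (Umat b)" and D = "\<lambda>a. M (Tmat (inverse a))" and ?a0.0 = a0])
    show "det2 (M (Umat b)) \<noteq> 0" for b by (rule M(1)[OF Umat_SL2])
    show "det2 (M (Tmat (inverse a))) \<noteq> 0" if "a \<noteq> 0" for a :: 'f using that by (intro M(1) Tmat_SL2) simp
    show "\<exists>l. l \<noteq> 0 \<and> M (Umat (b + c)) = smul l (M (Umat b) * M (Umat c))" for b c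
      using M_mult[OF Umat_SL2 Umat_SL2, of c b] by (simp add: Umat_mult add.commute)
    show "\<exists>l. l \<noteq> 0 \<and> M (Tmat (inverse a)) * M (Umat b) =
        smul l (M (Umat (a ^ 2 * b)) * M (Tmat (inverse a)))" if a: "a \<noteq> 0" for a b
    proof -
      have T: "Tmat (inverse a) \<in> G" using a by (intro Tmat_SL2) simp
      obtain l where l: "l \<noteq> 0" "M (Umat b ** Tmat (inverse a)) =
        smul l (M (Umat (a ^ 2 * b)) * M (Tmat (inverse a)))"
        using M_mult[OF T Umat_SL2, of "a ^ 2 * b"] Tmat_Umat[OF a, of b] by auto
      obtain l' where l': "l' \<noteq> 0" "M (Umat b ** Tmat (inverse a)) = smul l' (M (Tmat (inverse a)) * M (Umat b))"
        using M_mult[OF Umat_SL2 T, of b] by auto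
      have "M (Tmat (inverse a)) * M (Umat b) = smul (inverse l') (smul l' (M (Tmat (inverse a)) * M (Umat b)))"
        using l'(1) by (simp add: smul_smul smul_1)
      also have "\<dots> = smul (inverse l' * l) (M (Umat (a ^ 2 * b)) * M (Tmat (inverse a)))"
        unfolding l'(2)[symmetric] l(2) by (simp add: smul_smul)
      finally show ?thesis using l(1) l'(1) by (intro exI[of _ "inverse l' * l"]) simp
    qed
    show "b = 0" if "M (Umat b) = smul l 1" for b l
    proof -
      have "l \<noteq> 0" using M(1)[OF Umat_SL2, of b] that by (auto simp: det2_smul)
      then have "\<sigma> (Umat b) t = t" using M(2)[OF Umat_SL2, of b] that t.moebius_scalar by simp
      then have "Umat b = mat 1" by (rule fixed[OF Umat_SL2])
      then show ?thesis by (simp add: Umat_eq_1_iff)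
    qed
  qed (fact char_k char_f a0)+
qed

lemma hom_imp_ess_dim_1:
  fixes \<phi> :: "'f \<Rightarrow> 'k"
  assumes "is_ring_hom \<phi>"
  shows "ess_dim iota G \<sigma> = 1"
proof -
  interpret phi: field_homo \<phi> using assms by (simp add: is_ring_hom_iff_field_homo)
  define \<psi> where "\<psi> a = iota (\<phi> a)" for a
  interpret psi: field_homo \<psi>
    by unfold_locales (simp_all add: \<psi>_def phi.hom_add phi.hom_mult hom_add hom_mult)
  have action_psi: "\<sigma> g (\<psi> a) = \<psi> a" if "g \<in> G" for g a
    by (simp add: \<psi>_def action_const[OF that])
  \<comment> \<open>Independence of characters requires the automorphisms, and not only the group
    elements, to be distinct.\<close>
  have inj: "inj_on \<sigma> G"
  proof (rule inj_onI)
    fix g h assume gh: "g \<in> G" "h \<in> G" "\<sigma> g = \<sigma> h"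
    have "\<sigma> (SL2_inv h ** g) = \<sigma> (SL2_inv h ** h)"
      using action_mult[OF SL2_inv(1)[OF gh(2)]] gh by simp
    then have "\<sigma> (SL2_inv h ** g) = id" using SL2_inv(3)[OF gh(2)] action_1 by simp
    then have "SL2_inv h ** g = mat 1"
      using action_faithful[OF SL2_mult[OF SL2_inv(1)[OF gh(2)] gh(1)]] by simp
    then have "h ** (SL2_inv h ** g) = h" by simp
    then show "g = h" using SL2_inv(2)[OF gh(2)] by (simp add: matrix_mul_assoc)
  qed
  define W where "W i f = (\<Sum>g\<in>G. \<psi> (g $ i $ 1) * \<sigma> g f)" for i f
  have "\<exists>f. W 1 f \<noteq> 0"
  proof (rule ccontr)
    assume *: "\<nexists>f. W 1 f \<noteq> 0"
    \<comment> \<open>The identity enters \<open>W 1\<close> with coefficient 1, which independence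
      would force to vanish.\<close>
    have "\<psi> ((mat 1 :: 'f ^ 2 ^ 2) $ 1 $ 1) = 0"
      by (rule dedekind_independence[OF _ action_hom inj _ mat_1_SL2]) (use * in \<open>simp_all add: W_def\<close>)
    then show False by simp
  qed
  then obtain f where f: "W 1 f \<noteq> 0" by blast
  define w1 w2 where "w1 = W 1 f" and "w2 = W 2 f"
  \<comment> \<open>Replacing g by h^-1 g in the sum turns the action of h into the matrix of h^-1
    applied to the vector (w1, w2).\<close>
  have act: "\<sigma> h (W i f) = \<psi> (SL2_inv h $ i $ 1) * w1 + \<psi> (SL2_inv h $ i $ 2) * w2" if h: "h \<in> G" for h i
  proof -
    interpret s: field_homo "\<sigma> h" by (rule action_hom[OF h])
    have "\<sigma> h (W i f) = (\<Sum>g\<in>G. \<psi> (g $ i $ 1) * \<sigma> (h ** g) f)"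
      unfolding W_def s.hom_sum by (intro sum.cong) (simp_all add: s.hom_mult action_psi[OF h] action_mult[OF h])
    also have "\<dots> = (\<Sum>g\<in>G. \<psi> ((SL2_inv h ** g) $ i $ 1) * \<sigma> g f)"
      by (rule sum.reindex_bij_witness[where i = "\<lambda>g. SL2_inv h ** g" and j = "\<lambda>g. h ** g"])
         (use h in \<open>auto simp: matrix_mul_assoc SL2_inv intro: SL2_mult SL2_inv\<close>)
    also have "\<dots> = (\<Sum>g\<in>G. \<psi> (SL2_inv h $ i $ 1) * (\<psi> (g $ 1 $ 1) * \<sigma> g f)
        + \<psi> (SL2_inv h $ i $ 2) * (\<psi> (g $ 2 $ 1) * \<sigma> g f))"
      by (simp add: mult_entries_2 psi.hom_add psi.hom_mult algebra_simps)
    also have "\<dots> = \<psi> (SL2_inv h $ i $ 1) * w1 + \<psi> (SL2_inv h $ i $ 2) * w2"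
      by (simp add: sum.distrib sum_distrib_left w1_def w2_def W_def)
    finally show ?thesis .
  qed
  have act1: "\<sigma> h w1 = \<psi> (h $ 2 $ 2) * w1 - \<psi> (h $ 1 $ 2) * w2"
    and act2: "\<sigma> h w2 = \<psi> (h $ 1 $ 1) * w2 - \<psi> (h $ 2 $ 1) * w1" if "h \<in> G" for h
    using act[OF that, of 1] act[OF that, of 2]
    by (simp_all add: w1_def w2_def SL2_inv_def psi.hom_uminus)
  have w1: "w1 \<noteq> 0" using f by (simp add: w1_def)
  \<comment> \<open>The Weyl element exchanges the two coordinates up to sign, so they vanish
    together.\<close>
  have w2: "w2 \<noteq> 0"
  proof
    assume "w2 = 0"
    have J: "mk_mat 0 1 (- 1) 0 \<in> G" by (simp add: SL2_iff)
    have "\<sigma> (mk_mat 0 1 (- 1) 0) w2 = w1" using act2[OF J] \<open>w2 = 0\<close> by (simp add: psi.hom_uminus)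
    moreover have "\<sigma> (mk_mat 0 1 (- 1) 0) w2 = 0"
      using \<open>w2 = 0\<close> field_homo.axioms(1)[OF action_hom[OF J], THEN ring_homo.hom_0] by simp
    ultimately show False using w1 by simp
  qed
  define t where "t = w1 / w2"
  have act_t: "\<sigma> h t = (\<psi> (h $ 2 $ 2) * t - \<psi> (h $ 1 $ 2)) / (\<psi> (h $ 1 $ 1) - \<psi> (h $ 2 $ 1) * t)"
    and den: "\<psi> (h $ 1 $ 1) - \<psi> (h $ 2 $ 1) * t \<noteq> 0" if h: "h \<in> G" for h
  proof -
    interpret s: field_homo "\<sigma> h" by (rule action_hom[OF h])
    have 1: "\<sigma> h w1 = w2 * (\<psi> (h $ 2 $ 2) * t - \<psi> (h $ 1 $ 2))"
      and 2: "\<sigma> h w2 = w2 * (\<psi> (h $ 1 $ 1) - \<psi> (h $ 2 $ 1) * t)"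
      unfolding act1[OF h] act2[OF h] using w2 by (simp_all add: t_def right_diff_distrib)
    have "\<sigma> h w2 \<noteq> 0" using w2 by simp
    then show "\<psi> (h $ 1 $ 1) - \<psi> (h $ 2 $ 1) * t \<noteq> 0" using 2 by auto
    have "\<sigma> h t = \<sigma> h w1 / \<sigma> h w2" by (simp add: t_def s.hom_divide)
    then show "\<sigma> h t = (\<psi> (h $ 2 $ 2) * t - \<psi> (h $ 1 $ 2)) / (\<psi> (h $ 1 $ 1) - \<psi> (h $ 2 $ 1) * t)"
      unfolding 1 2 using w2 by simp
  qed
  have tk: "t \<notin> range iota"
  proof
    assume "t \<in> range iota"
    then have "\<sigma> (Umat 1) t = t" using action_const[OF Umat_SL2] by auto
    moreover have "\<sigma> (Umat 1) t = t - 1" using act_t[OF Umat_SL2, of 1] by (simp add: Umat_def)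
    ultimately show False by simp
  qed
  then interpret t: transcendental iota t by (simp add: transcendental_iff)
  interpret kt: generators iota "\<lambda>_. t" 1 by unfold_locales
  interpret gen_quot: subfield kt.gen_quot by unfold_locales (rule kt.is_subfield_gen_quot)
  have tKQ: "t \<in> kt.gen_quot" using kt.gen_quot_var[of 0] by simp
  have "faithful_G_subfield iota G \<sigma> kt.gen_quot"
    unfolding faithful_G_subfield_def
  proof (intro conjI ballI impI)
    show "is_subfield kt.gen_quot" by (rule kt.is_subfield_gen_quot)
    show "range iota \<subseteq> kt.gen_quot" using kt.gen_quot_const by blast
    fix h assume h: "h \<in> G"
    have "\<sigma> h t \<in> kt.gen_quot"
      unfolding act_t[OF h] \<psi>_def by (intro gen_quot.divide_mem gen_quot.diff_mem gen_quot.mult_mem tKQ kt.gen_quot_const)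
    then have "kt.gen_quot \<subseteq> {e. \<sigma> h e \<in> kt.gen_quot}"
      using action_const[OF h] kt.gen_quot_const
      by (intro kt.gen_quot_least action_preimage_subfield[OF h kt.is_subfield_gen_quot]) auto
    then show "\<sigma> h ` kt.gen_quot \<subseteq> kt.gen_quot" by blast
    assume "\<forall>e\<in>kt.gen_quot. \<sigma> h e = e"
    then have "\<sigma> h t = t" using tKQ by blast
    then have "\<psi> (h $ 2 $ 2) * t - \<psi> (h $ 1 $ 2) = t * (\<psi> (h $ 1 $ 1) - \<psi> (h $ 2 $ 1) * t)"
      using act_t[OF h] den[OF h] by (simp add: field_simps)
    \<comment> \<open>As t is transcendental, the quadratic relation makes h scalar, and a scalar
      matrix of determinant 1 is the identity in characteristic two.\<close>
    then have "iota (\<phi> (h $ 2 $ 1)) * t ^ 2 + iota (\<phi> (h $ 2 $ 2) - \<phi> (h $ 1 $ 1)) * t + iota (- \<phi> (h $ 1 $ 2)) = 0"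
      by (simp add: \<psi>_def hom_diff hom_uminus power2_eq_square algebra_simps)
    from t.quadratic_zero[OF this] have z: "h $ 2 $ 1 = 0" "h $ 1 $ 2 = 0" "h $ 2 $ 2 = h $ 1 $ 1" by auto
    have "h $ 1 $ 1 * h $ 1 $ 1 = 1" using h z by (simp add: SL2_iff)
    moreover have "(h $ 1 $ 1 + 1) * (h $ 1 $ 1 + 1) = h $ 1 $ 1 * h $ 1 $ 1 + 1 + h $ 1 $ 1 * (1 + 1)"
      by (simp add: algebra_simps)
    ultimately have "(h $ 1 $ 1 + 1) * (h $ 1 $ 1 + 1) = 0" using char_f by simp
    then have "h $ 1 $ 1 + 1 = 0" by simp
    then have "h $ 1 $ 1 = 1" using char_f by (metis add_right_cancel)
    then show "h = mat 1" using z by (simp add: mat_eq_2_iff)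
  qed
  moreover have "trdeg (range iota) kt.gen_quot = 1" by (rule trdeg_eq_1I[OF tKQ tk]) simp
  \<comment> \<open>Transcendence degree zero leaves only constants, on which the group acts
    trivially.\<close>
  moreover have "1 \<le> d" if d: "\<exists>E. faithful_G_subfield iota G \<sigma> E \<and> trdeg (range iota) E = d" for d
  proof (rule ccontr)
    assume "\<not> 1 \<le> d"
    then obtain E where E: "faithful_G_subfield iota G \<sigma> E" "trdeg (range iota) E = 0" using d by auto
    have "\<forall>e\<in>E. \<sigma> (Umat 1) e = e" using trdeg_0D[OF E(2)] action_const[OF Umat_SL2] by fastforce
    then have "Umat (1::'f) = mat 1" using E(1) Umat_SL2 unfolding faithful_G_subfield_def by blast
    then show False by (simp add: Umat_eq_1_iff)
  qed
  ultimately show ?thesis unfolding ess_dim_def by (intro Least_equality) blast+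
qed

end

text \<open>Adding 1 permutes the elements, so the sum of all of them is unchanged when each summand
  grows by 1.\<close>

lemma of_nat_CARD_eq_0: "of_nat CARD('a) = (0 :: 'a::{finite,ring_1})"
proof -
  have "(\<Sum>a\<in>UNIV. a + 1) = (\<Sum>a\<in>UNIV. a :: 'a)"
    by (rule sum.reindex_bij_witness[of _ "\<lambda>a. a - 1" "\<lambda>a. a + 1"]) auto
  then show ?thesis by (simp add: sum.distrib)
qed

lemma is_ring_hom_of_gfield: "is_ring_hom of_gfield"
  by (simp add: is_ring_hom_def one_gfield.rep_eq plus_gfield.rep_eq times_gfield.rep_eq)

lemma range_of_gfield: "range (\<lambda>a. iota (of_gfield a)) = range iota"
  by (metis image_image surj_def to_gfield_inverse UNIV_I)

theorem theorem1p6: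
  fixes iota :: "'k::field \<Rightarrow> 'l::field"
    and x :: "nat \<Rightarrow> 'l"
    and n m :: nat
    and \<sigma> :: "'f::{finite,field} ^ 2 ^ 2 \<Rightarrow> 'l \<Rightarrow> 'l"
  assumes "CHAR('k) = 2"
    and "m \<ge> 1"
    and "CARD('f) = 2 ^ m"
    and "rat_fun_field_rep iota x n (SL2 :: ('f ^ 2 ^ 2) set) \<sigma>"
  shows "ess_dim iota (SL2 :: ('f ^ 2 ^ 2) set) \<sigma> = 1 \<longleftrightarrow>
         (\<exists>\<phi> :: 'f \<Rightarrow> 'k. is_ring_hom \<phi>)"
proof -
  define iota' where "iota' a = iota (of_gfield a)" for a
  have range: "range iota' = range iota" unfolding iota'_def by (rule range_of_gfield)
  have two_k: "(1::'k) + 1 = 0" using of_nat_CHAR[where 'a = 'k] assms(1) by simp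
  have "of_nat (2 ^ m) = (0::'f)" using of_nat_CARD_eq_0[where 'a = 'f] by (simp only: assms(3))
  then have "(2::'f) ^ m = 0" by simp
  then have two_f: "(1::'f) + 1 = 0" by simp
  have rep: "is_ring_hom iota" "alg_indep (range iota) x n"
    "\<And>E. is_subfield E \<Longrightarrow> range iota \<subseteq> E \<Longrightarrow> x ` {..<n} \<subseteq> E \<Longrightarrow> E = UNIV"
    "\<sigma> (mat 1) = id"
    "\<And>g h. g \<in> SL2 \<Longrightarrow> h \<in> SL2 \<Longrightarrow> \<sigma> (g ** h) = \<sigma> g \<circ> \<sigma> h"
    "\<And>g. g \<in> SL2 \<Longrightarrow> is_ring_hom (\<sigma> g)" "\<And>g a. g \<in> SL2 \<Longrightarrow> \<sigma> g (iota a) = iota a"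
    "\<And>g. g \<in> SL2 \<Longrightarrow> (\<And>j. j < n \<Longrightarrow> \<sigma> g (x j) = x j) \<Longrightarrow> g = mat 1"
    using assms(4) unfolding rat_fun_field_rep_def by blast+
  interpret I: sl2_rep iota' x n \<sigma>
  proof unfold_locales
    show "iota' 1 = 1" "iota' (a + b) = iota' a + iota' b" "iota' (a * b) = iota' a * iota' b" for a b
      using rep(1) is_ring_hom_of_gfield[where 'a = 'k] by (auto simp: iota'_def is_ring_hom_def)
    show "alg_indep (range iota') x n" unfolding range by (rule rep(2))
    show "E = UNIV" if "is_subfield E" "range iota' \<subseteq> E" "x ` {..<n} \<subseteq> E" for E
      using that unfolding range by (rule rep(3))
    show "\<sigma> g (iota' a) = iota' a" if "g \<in> SL2" for g a
      unfolding iota'_def using that by (rule rep(7))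
    show "(1::'k gfield) + 1 = 0" using two_k by transfer
  qed (use rep two_f in \<open>auto simp: is_ring_hom_iff_field_homo field_homo_def ring_homo_def\<close>)
  \<comment> \<open>Without such an element the field is F_2, which embeds into every field of
    characteristic two; the torus is trivial then and provides no \<open>a0\<close>.\<close>
  have trivial: "\<exists>\<phi> :: 'f \<Rightarrow> 'k gfield. is_ring_hom \<phi>" if "\<not> (\<exists>a::'f. a \<noteq> 0 \<and> a \<noteq> 1)"
  proof -
    have *: "a = 0 \<or> a = 1" for a :: 'f using that by blast
    have "is_ring_hom (\<lambda>a::'f. if a = 0 then 0 else 1 :: 'k gfield)"
      unfolding is_ring_hom_def
    proof (intro conjI allI)
      fix a b :: 'f
      show "(if a + b = 0 then 0 else 1 :: 'k gfield) = (if a = 0 then 0 else 1) + (if b = 0 then 0 else 1)"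
        using *[of a] *[of b] two_f I.char_k by auto
    qed auto
    then show ?thesis by blast
  qed
  \<comment> \<open>The embedding of K enters \<open>ess_dim\<close> only through its range, so
    replacing K by its copy changes nothing.\<close>
  have "ess_dim iota' (SL2 :: ('f ^ 2 ^ 2) set) \<sigma> = ess_dim iota SL2 \<sigma>"
    unfolding ess_dim_def faithful_G_subfield_def range ..
  moreover have "(\<exists>\<phi> :: 'f \<Rightarrow> 'k gfield. is_ring_hom \<phi>) \<longleftrightarrow> (\<exists>\<phi> :: 'f \<Rightarrow> 'k. is_ring_hom \<phi>)"
  proof
    assume "\<exists>\<phi> :: 'f \<Rightarrow> 'k gfield. is_ring_hom \<phi>"
    then obtain \<phi> :: "'f \<Rightarrow> 'k gfield" where "is_ring_hom \<phi>" ..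
    then have "is_ring_hom (\<lambda>a. of_gfield (\<phi> a))"
      using is_ring_hom_of_gfield[where 'a = 'k] by (simp add: is_ring_hom_def)
    then show "\<exists>\<phi> :: 'f \<Rightarrow> 'k. is_ring_hom \<phi>" by blast
  next
    assume "\<exists>\<phi> :: 'f \<Rightarrow> 'k. is_ring_hom \<phi>"
    then obtain \<phi> :: "'f \<Rightarrow> 'k" where "is_ring_hom \<phi>" ..
    then have "is_ring_hom (\<lambda>a. to_gfield (\<phi> a))"
      by (simp add: is_ring_hom_def one_gfield_def plus_gfield_def times_gfield_def to_gfield_inverse)
    then show "\<exists>\<phi> :: 'f \<Rightarrow> 'k gfield. is_ring_hom \<phi>" by blast
  qed
  moreover have "ess_dim iota' (SL2 :: ('f ^ 2 ^ 2) set) \<sigma> = 1 \<longleftrightarrow>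
      (\<exists>\<phi> :: 'f \<Rightarrow> 'k gfield. is_ring_hom \<phi>)" (is "?L \<longleftrightarrow> ?R")
  proof
    assume ?L
    show ?R
    proof (cases "\<exists>a::'f. a \<noteq> 0 \<and> a \<noteq> 1")
      case True
      then obtain a :: 'f where "a \<noteq> 0" "a \<noteq> 1" by blast
      with \<open>?L\<close> show ?thesis by (rule I.ess_dim_1_imp_hom)
    qed (rule trivial)
  next
    assume ?R
    then obtain \<phi> :: "'f \<Rightarrow> 'k gfield" where "is_ring_hom \<phi>" ..
    then show ?L by (rule I.hom_imp_ess_dim_1)
  qed
  ultimately show ?thesis by simp
qed

end
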